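(* Let $n\ge1$ and let $S$ be a maximum independent set of the matching derangement graph $\Gamma$ on $\mathcal{M}_{2n}$, with characteristic vector $v_S\in\mathbb{C}^{\mathcal{M}_{2n}}$. Then $v_S \in S^{(2n)} \oplus S^{(2n-2,2)}$.
   Context: $\mathcal{M}_{2n}$ is the set of perfect matchings of $K_{2n}$; $\Gamma$ has vertex set $\mathcal{M}_{2n}$, two matchings adjacent iff they share no edge. The symmetric group $S_{2n}$ acts on $\mathcal{M}_{2n}$ and hence on the space $\mathbb{C}^{\mathcal{M}_{2n}}$ of functions on $\mathcal{M}_{2n}$; this permutation representation is multiplicity-free and decomposes as $\bigoplus_{\lambda\vdash n} S^{2\lambda}$, where $2\lambda=(2\lambda_1,\dots,2\lambda_k)$ and $S^{2\lambda}$ denotes the unique subspace of $\mathbb{C}^{\mathcal{M}_{2n}}$ isomorphic to the Specht module of $S_{2n}$ indexed by $2\lambda$. Thus $S^{(2n)}$ is the space of constant functions and $S^{(2n-2,2)}$ is the component corresponding to $\lambda=(n-1,1)$. *)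

theory Defs
  imports
    Complex_Main
    "HOL-Combinatorics.Permutations"
    "HOL-Library.Function_Algebras"
    "HOL-Library.Set_Algebras"
    "HOL-Library.Indicator_Function"
begin

definition complete_graph_edges :: "nat \<Rightarrow> nat set set" where
  "complete_graph_edges m = {e. e \<subseteq> {1..m} \<and> card e = 2}"

definition perfect_matchings :: "nat \<Rightarrow> nat set set set" where
  "perfect_matchings n =
     {M. M \<subseteq> complete_graph_edges (2 * n) \<and> (\<forall>v\<in>{1..2 * n}. \<exists>!e. e \<in> M \<and> v \<in> e)}"

definition derangement_adj :: "nat set set \<Rightarrow> nat set set \<Rightarrow> bool" where
  "derangement_adj M N \<longleftrightarrow> M \<inter> N = {}"

text \<open>A graph is given by its vertex set and adjacency relation. The relation
  \<open>derangement_adj\<close> is irreflexive on \<open>perfect_matchings n\<close> for \<open>n \<ge> 1\<close>, as a matching is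
  then nonempty.\<close>

definition independent_set :: "'v set \<Rightarrow> ('v \<Rightarrow> 'v \<Rightarrow> bool) \<Rightarrow> 'v set \<Rightarrow> bool" where
  "independent_set V adj S \<longleftrightarrow> S \<subseteq> V \<and> (\<forall>x\<in>S. \<forall>y\<in>S. \<not> adj x y)"

definition maximum_independent_set :: "'v set \<Rightarrow> ('v \<Rightarrow> 'v \<Rightarrow> bool) \<Rightarrow> 'v set \<Rightarrow> bool" where
  "maximum_independent_set V adj S \<longleftrightarrow>
     independent_set V adj S \<and> (\<forall>T. independent_set V adj T \<longrightarrow> card T \<le> card S)"

definition cscale :: "complex \<Rightarrow> ('x \<Rightarrow> complex) \<Rightarrow> 'x \<Rightarrow> complex" where
  "cscale c f = (\<lambda>x. c * f x)"

global_interpretation cfun: vector_space "cscale :: complex \<Rightarrow> ('x \<Rightarrow> complex) \<Rightarrow> 'x \<Rightarrow> complex"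
  by unfold_locales (auto simp: cscale_def fun_eq_iff algebra_simps)

text \<open>The space of complex functions on a set \<open>X\<close>: functions on the type vanishing
  outside \<open>X\<close>.\<close>

definition functions_on :: "'x set \<Rightarrow> ('x \<Rightarrow> complex) set" where
  "functions_on X = {f. \<forall>x. x \<notin> X \<longrightarrow> f x = 0}"

text \<open>An action \<open>a\<close> of permutations on points induces the left action
  \<open>(p f)(x) = f (p\<^sup>-\<^sup>1 x)\<close> on functions; it sends \<open>indicator {x}\<close> to \<open>indicator {p x}\<close>.\<close>

definition fun_action ::
  "((nat \<Rightarrow> nat) \<Rightarrow> 'x \<Rightarrow> 'x) \<Rightarrow> (nat \<Rightarrow> nat) \<Rightarrow> ('x \<Rightarrow> complex) \<Rightarrow> 'x \<Rightarrow> complex" where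
  "fun_action a p f = (\<lambda>x. f (a (inv p) x))"

definition matching_action :: "(nat \<Rightarrow> nat) \<Rightarrow> nat set set \<Rightarrow> nat set set" where
  "matching_action p M = (\<lambda>e. p ` e) ` M"

definition tabloid_action :: "(nat \<Rightarrow> nat) \<Rightarrow> nat set list \<Rightarrow> nat set list" where
  "tabloid_action p T = map (\<lambda>R. p ` R) T"

definition subrepresentation ::
  "nat \<Rightarrow> ((nat \<Rightarrow> nat) \<Rightarrow> 'x \<Rightarrow> 'x) \<Rightarrow> 'x set \<Rightarrow> ('x \<Rightarrow> complex) set \<Rightarrow> bool" where
  "subrepresentation m a X W \<longleftrightarrow>
     cfun.subspace W \<and> W \<subseteq> functions_on X \<and>
     (\<forall>p. p permutes {1..m} \<longrightarrow> (\<forall>f\<in>W. fun_action a p f \<in> W))"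

definition isomorphic_reps ::
  "nat \<Rightarrow> ((nat \<Rightarrow> nat) \<Rightarrow> 'x \<Rightarrow> 'x) \<Rightarrow> ('x \<Rightarrow> complex) set \<Rightarrow>
     ((nat \<Rightarrow> nat) \<Rightarrow> 'y \<Rightarrow> 'y) \<Rightarrow> ('y \<Rightarrow> complex) set \<Rightarrow> bool" where
  "isomorphic_reps m a U b W \<longleftrightarrow>
     (\<exists>T. bij_betw T U W \<and>
        (\<forall>f\<in>U. \<forall>g\<in>U. T (f + g) = T f + T g) \<and>
        (\<forall>c. \<forall>f\<in>U. T (cscale c f) = cscale c (T f)) \<and>
        (\<forall>p. p permutes {1..m} \<longrightarrow> (\<forall>f\<in>U. T (fun_action a p f) = fun_action b p (T f))))"

definition is_partition :: "nat \<Rightarrow> nat list \<Rightarrow> bool" where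
  "is_partition m \<mu> \<longleftrightarrow> sorted_wrt (\<ge>) \<mu> \<and> 0 \<notin> set \<mu> \<and> sum_list \<mu> = m"

text \<open>Cells are pairs (row, column), both counted from 0.\<close>

definition diagram :: "nat list \<Rightarrow> (nat \<times> nat) set" where
  "diagram \<mu> = {(i, j). i < length \<mu> \<and> j < \<mu> ! i}"

definition tableau :: "nat list \<Rightarrow> (nat \<times> nat \<Rightarrow> nat) \<Rightarrow> bool" where
  "tableau \<mu> t \<longleftrightarrow> bij_betw t (diagram \<mu>) {1..sum_list \<mu>}"

definition tableau_row :: "nat list \<Rightarrow> (nat \<times> nat \<Rightarrow> nat) \<Rightarrow> nat \<Rightarrow> nat set" where
  "tableau_row \<mu> t i = {t (i, j) | j. (i, j) \<in> diagram \<mu>}"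

definition tableau_column :: "nat list \<Rightarrow> (nat \<times> nat \<Rightarrow> nat) \<Rightarrow> nat \<Rightarrow> nat set" where
  "tableau_column \<mu> t j = {t (i, j) | i. (i, j) \<in> diagram \<mu>}"

text \<open>The row-equivalence class of a tableau is represented by the list of its row sets.\<close>

definition tabloid :: "nat list \<Rightarrow> (nat \<times> nat \<Rightarrow> nat) \<Rightarrow> nat set list" where
  "tabloid \<mu> t = map (tableau_row \<mu> t) [0..<length \<mu>]"

definition column_stabilizer :: "nat list \<Rightarrow> (nat \<times> nat \<Rightarrow> nat) \<Rightarrow> (nat \<Rightarrow> nat) set" where
  "column_stabilizer \<mu> t =
     {p. p permutes {1..sum_list \<mu>} \<and> (\<forall>j. p ` tableau_column \<mu> t j = tableau_column \<mu> t j)}"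

definition polytabloid :: "nat list \<Rightarrow> (nat \<times> nat \<Rightarrow> nat) \<Rightarrow> nat set list \<Rightarrow> complex" where
  "polytabloid \<mu> t =
     (\<Sum>p\<in>column_stabilizer \<mu> t.
        cscale (of_int (sign p)) (indicator {tabloid_action p (tabloid \<mu> t)}))"

definition specht_module :: "nat list \<Rightarrow> (nat set list \<Rightarrow> complex) set" where
  "specht_module \<mu> = cfun.span {polytabloid \<mu> t | t. tableau \<mu> t}"

text \<open>The unique copy of the Specht module of \<open>\<mu>\<close> in the functions on perfect matchings; it
  exists and is unique when \<open>\<mu>\<close> is a partition of \<open>2 * n\<close> with even parts. If \<open>\<mu>\<close> is no
  partition of \<open>2 * n\<close>, there is no such component and the zero space is used: this concerns
  \<open>[2 * n - 2, 2]\<close> for \<open>n = 1\<close>.\<close>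

definition matching_component :: "nat \<Rightarrow> nat list \<Rightarrow> (nat set set \<Rightarrow> complex) set" where
  "matching_component n \<mu> =
     (if is_partition (2 * n) \<mu>
      then (THE W. subrepresentation (2 * n) matching_action (perfect_matchings n) W \<and>
                   isomorphic_reps (2 * n) tabloid_action (specht_module \<mu>) matching_action W)
      else {0})"

end

theory Submission
  imports Defs
begin

text \<open>Join two matchings when their union is a Hamiltonian cycle. Disjointness makes this a subgraph
  of the derangement graph, and its adjacency operator \<open>H\<close> factors: fixing a vertex \<open>v\<close>, \<open>H\<close> is the
  switch operator \<open>J\<close>, which exchanges the partner of \<open>v\<close> with another vertex, followed by the operator
  \<open>H\<close> of the remaining \<open>2 n - 2\<close> vertices. On functions whose average over each set of matchings
  with a given partner of \<open>v\<close> vanishes, \<open>J\<close> has spectrum in \<open>[-(n - 1), 2 n - 4]\<close>, by induction on \<open>n\<close>: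
  \<open>J\<close> is an average of its analogues on the matchings through a fixed edge. Hence on the complement of
  the constants \<open>H\<close> has norm \<open>(2 n - 4)!!\<close>, while its degree is \<open>(2 n - 2)!!\<close>, and the eigenspace of
  \<open>- (2 n - 4)!!\<close> lies in the span of the indicators of edges. The ratio bound is then tight for a
  maximum intersecting family, which puts its indicator into that span.

  The span of the edge indicators is the sum of the two components: an equivariant map from the Specht
  module of \<open>[2 n - 2, 2]\<close> to functions on matchings is a multiple of summation over the edges, because
  averaging over the stabilizer of a matching leaves only a line in the Specht module.\<close>

section \<open>Perfect matchings of a finite set\<close>

text \<open>The detour through Hamiltonian cycles avoids the spectrum of the derangement graph
  itself and loses nothing: the quotient of (2 n - 2)!! and (2 n - 4)!! is 2 n - 2, so the ratio
  bound is (2 n - 1)!! / (2 n - 1) = (2 n - 3)!!, the size of the family through one edge. H factors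
  because of the stretch y - v - x - z of a Hamiltonian cycle with v x in M. Exchanging x and y in
  the other matching N leaves v x as a double edge and closes the rest to a shorter cycle through y
  z, on two vertices fewer. The obstacle in the induction for J is that restricting f to the
  matchings through a fixed edge destroys the vanishing of its partner averages. The resulting error
  is a sum of squares over triples of vertices. It must be compared with the part of f in the edge
  span with exact constants, because the equality case is what identifies the eigenspace. H itself
  is handled through norms: the ratio bound becomes an estimate of the squared norm of H g + (2 n -
  4)!! g, fed by the row sums, the column sums and the norm bound of H.\<close>

definition matchings :: "'a set \<Rightarrow> 'a set set set" where
  "matchings V = {M. M \<subseteq> {e. e \<subseteq> V \<and> card e = 2} \<and> (\<forall>v\<in>V. \<exists>!e. e \<in> M \<and> v \<in> e)}"

text \<open>Real-valued, so that case distinctions on the partner of a vertex become products, and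
  double counting becomes the interchange of finite sums.\<close>

definition edge :: "'a set set \<Rightarrow> 'a \<Rightarrow> 'a \<Rightarrow> real" where
  "edge M a b = of_bool ({a, b} \<in> M)"

definition swap_pts :: "'a \<Rightarrow> 'a \<Rightarrow> 'a set set \<Rightarrow> 'a set set" where
  "swap_pts a b M = (`) (transpose a b) ` M"

lemma perfect_matchings_eq_matchings: "perfect_matchings n = matchings {1..2 * n}"
  by (simp add: perfect_matchings_def matchings_def complete_graph_edges_def)

lemma finite_matchings: "finite V \<Longrightarrow> finite (matchings V)"
  by (rule finite_subset[of _ "Pow (Pow V)"]) (auto simp: matchings_def)

lemma matchings_empty: "matchings {} = {{}}"
  by (auto simp: matchings_def)

lemma matchings_edgeD:
  assumes "M \<in> matchings V" "e \<in> M"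
  shows "e \<subseteq> V" "card e = 2"
  using assms by (auto simp: matchings_def)

lemma matchings_pairD:
  assumes "M \<in> matchings V" "{a, b} \<in> M"
  shows "a \<in> V" "b \<in> V" "a \<noteq> b"
  using matchings_edgeD[OF assms] by auto

lemma matchings_edge_unique:
  assumes "M \<in> matchings V" "e \<in> M" "e' \<in> M" "x \<in> e" "x \<in> e'"
  shows "e = e'"
  using assms matchings_edgeD(1)[of M V e] unfolding matchings_def by blast

lemma matchings_pair_unique:
  assumes "M \<in> matchings V" "{a, b} \<in> M" "{a, c} \<in> M"
  shows "b = c"
  using matchings_edge_unique[OF assms, of a] matchings_pairD(3)[OF assms(1,2)] by (auto simp: doubleton_eq_iff)

lemma matchings_partner:
  assumes "M \<in> matchings V" "a \<in> V"
  obtains b where "b \<in> V" "b \<noteq> a" "{a, b} \<in> M"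
proof -
  obtain e where e: "e \<in> M" "a \<in> e" using assms unfolding matchings_def by blast
  then obtain b c where "e = {b, c}" "b \<noteq> c"
    using matchings_edgeD(2)[OF assms(1) e(1)] by (auto simp: card_2_iff)
  then show thesis
    using e that matchings_edgeD(1)[OF assms(1) e(1)] by (cases "a = b") (auto simp: insert_commute)
qed

lemma edge_commute: "edge M a b = edge M b a"
  by (simp add: edge_def insert_commute)

lemma edge_self: "M \<in> matchings V \<Longrightarrow> edge M a a = 0"
  using matchings_pairD(3)[of M V a a] by (auto simp: edge_def)

lemma edge_mult_cancel: "M \<in> matchings V \<Longrightarrow> b \<noteq> c \<Longrightarrow> edge M a b * edge M a c = 0"
  using matchings_pair_unique[of M V a b c] by (auto simp: edge_def)

lemma sum_edge_mult:
  assumes "M \<in> matchings V" "a \<in> V" "finite V" "{a, b} \<in> M"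
  shows "(\<Sum>x\<in>V. edge M a x * g x) = g b"
proof -
  have "(\<Sum>x\<in>V. edge M a x * g x) = (\<Sum>x\<in>V. if x = b then g b else 0)"
  proof (intro sum.cong refl)
    fix x
    show "edge M a x * g x = (if x = b then g b else 0)"
      using assms(4) matchings_pair_unique[OF assms(1,4), of x] by (cases "x = b") (auto simp: edge_def)
  qed
  then show ?thesis using assms matchings_pairD(2)[OF assms(1,4)] by simp
qed

lemma sum_edge:
  assumes "M \<in> matchings V" "a \<in> V" "finite V"
  shows "(\<Sum>x\<in>V. edge M a x) = 1"
proof -
  obtain b where "{a, b} \<in> M" using matchings_partner assms by metis
  then show ?thesis using sum_edge_mult[OF assms, of b "\<lambda>_. 1"] by simp
qed

lemma sum_edge_diff:
  assumes "M \<in> matchings V" "a \<in> V" "finite V" "D \<subseteq> V"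
  shows "(\<Sum>x\<in>V - D. edge M a x) = 1 - (\<Sum>x\<in>D. edge M a x)"
  using assms by (simp add: sum_diff sum_edge)

lemma matchings_insert:
  assumes "a \<in> V" "b \<in> V" "a \<noteq> b" "M \<in> matchings (V - {a, b})"
  shows "insert {a, b} M \<in> matchings V" "{a, b} \<notin> M"
proof -
  have sub: "e \<subseteq> V - {a, b}" "card e = 2" if "e \<in> M" for e
    using matchings_edgeD[OF assms(4) that] by auto
  have "\<exists>!e. e \<in> insert {a, b} M \<and> v \<in> e" if "v \<in> V" for v
  proof (cases "v \<in> {a, b}")
    case True
    then show ?thesis using sub by (intro ex1I[of _ "{a, b}"]) auto
  next
    case False
    then have "\<exists>!e. e \<in> M \<and> v \<in> e" using assms(4) that unfolding matchings_def by auto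
    then show ?thesis using False by blast
  qed
  then show "insert {a, b} M \<in> matchings V"
    using sub assms by (auto simp: matchings_def)
  show "{a, b} \<notin> M" using sub by blast
qed

lemma matchings_remove:
  assumes "M \<in> matchings V" "{a, b} \<in> M"
  shows "M - {{a, b}} \<in> matchings (V - {a, b})"
proof -
  have "e \<subseteq> V - {a, b}" "card e = 2" if "e \<in> M" "e \<noteq> {a, b}" for e
    using matchings_edgeD[OF assms(1) that(1)] matchings_edge_unique[OF assms(1,2) that(1)] that by auto
  moreover have "\<exists>!e. e \<in> M - {{a, b}} \<and> v \<in> e" if "v \<in> V - {a, b}" for v
  proof -
    have "\<exists>!e. e \<in> M \<and> v \<in> e" using assms(1) that unfolding matchings_def by auto
    moreover have "v \<notin> {a, b}" using that by auto
    ultimately show ?thesis by (metis DiffE DiffI singletonD)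
  qed
  ultimately show ?thesis by (auto simp: matchings_def)
qed

lemma bij_betw_insert_edge:
  assumes "a \<in> V" "b \<in> V" "a \<noteq> b"
  shows "bij_betw (insert {a, b}) (matchings (V - {a, b})) {M \<in> matchings V. {a, b} \<in> M}"
  using assms
  by (intro bij_betwI[where g = "\<lambda>M. M - {{a, b}}"]) (auto simp: matchings_insert matchings_remove)

lemma sum_edge_slice:
  assumes "finite V" "a \<in> V" "b \<in> V" "a \<noteq> b"
  shows "(\<Sum>M\<in>matchings V. edge M a b * \<phi> M) = (\<Sum>M\<in>matchings (V - {a, b}). \<phi> (insert {a, b} M))"
proof -
  have "(\<Sum>M\<in>matchings V. edge M a b * \<phi> M) = (\<Sum>M\<in>{M \<in> matchings V. {a, b} \<in> M}. \<phi> M)"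
    using finite_matchings[OF assms(1)]
    by (simp only: sum.inter_filter) (rule sum.cong, simp_all add: edge_def)
  then show ?thesis
    using sum.reindex_bij_betw[OF bij_betw_insert_edge[OF assms(2-4)], of \<phi>] by simp
qed

lemma sum_matchings_slices:
  assumes "finite V" "v \<in> V"
  shows "(\<Sum>M\<in>matchings V. \<phi> M) = (\<Sum>x\<in>V - {v}. \<Sum>M\<in>matchings (V - {x, v}). \<phi> (insert {x, v} M) :: real)"
proof -
  have "(\<Sum>M\<in>matchings V. \<phi> M) = (\<Sum>M\<in>matchings V. \<Sum>x\<in>V. edge M x v * \<phi> M)"
    using assms by (intro sum.cong) (simp_all add: sum_edge edge_commute[of _ _ v] flip: sum_distrib_right)
  also have "\<dots> = (\<Sum>x\<in>V. \<Sum>M\<in>matchings V. edge M x v * \<phi> M)" by (rule sum.swap)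
  also have "\<dots> = (\<Sum>x\<in>V - {v}. \<Sum>M\<in>matchings V. edge M x v * \<phi> M)"
    using assms by (simp add: sum.remove[of V v] edge_self)
  finally show ?thesis using assms by (simp add: sum_edge_slice)
qed

section \<open>Counting perfect matchings\<close>

text \<open>The double factorial (2 k - 1)!!, the number of perfect matchings of 2 k points.\<close>

definition odd_fact :: "nat \<Rightarrow> real" where "odd_fact k = (\<Prod>i<k. 2 * real i + 1)"

lemma odd_fact_simps: "odd_fact 0 = 1" "odd_fact (Suc k) = (2 * real k + 1) * odd_fact k"
  by (simp_all add: odd_fact_def)

lemma odd_fact_pos: "odd_fact k > 0"
  by (auto simp: odd_fact_def intro!: prod_pos)

lemma card_matchings:
  assumes "finite V" "card V = 2 * n"
  shows "real (card (matchings V)) = odd_fact n"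
  using assms
proof (induction n arbitrary: V)
  case 0
  then show ?case by (simp add: matchings_empty odd_fact_simps)
next
  case (Suc n)
  then obtain v where v: "v \<in> V" by fastforce
  have "real (card (matchings V)) = (\<Sum>M\<in>matchings V. 1)" by simp
  also have "\<dots> = (\<Sum>x\<in>V - {v}. \<Sum>M\<in>matchings (V - {x, v}). 1)"
    by (rule sum_matchings_slices) (use Suc v in auto)
  also have "\<dots> = (\<Sum>x\<in>V - {v}. odd_fact n)"
  proof (intro sum.cong refl)
    fix x assume "x \<in> V - {v}"
    then have "card (V - {x, v}) = 2 * n" using Suc.prems v by (subst card_Diff_subset) auto
    then show "(\<Sum>M\<in>matchings (V - {x, v}). 1) = odd_fact n" using Suc.IH[of "V - {x, v}"] Suc.prems by simp
  qed
  also have "\<dots> = odd_fact (Suc n)" using Suc.prems v by (simp add: odd_fact_simps)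
  finally show ?case .
qed

section \<open>Permutations acting transitively on matchings\<close>

lemma matchings_image:
  assumes "p permutes V" "M \<in> matchings V"
  shows "(`) p ` M \<in> matchings V"
proof -
  have inj: "inj p" using assms(1) by (rule permutes_inj)
  have "\<exists>!e. e \<in> (`) p ` M \<and> v \<in> e" if "v \<in> V" for v
  proof -
    have "inv p v \<in> V" using assms(1) that by (simp add: permutes_in_image permutes_inv)
    then have "\<exists>!e. e \<in> M \<and> inv p v \<in> e" using assms(2) by (simp add: matchings_def)
    then obtain e where e: "e \<in> M" "inv p v \<in> e" by (auto dest: ex1_implies_ex)
    have *: "v \<in> p ` e' \<longleftrightarrow> inv p v \<in> e'" for e'
      using assms(1) by (metis image_iff permutes_inverses)
    show ?thesis
    proof (intro ex1I[of _ "p ` e"] conjI)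
      show "p ` e \<in> (`) p ` M" "v \<in> p ` e" using e(1,2) * by auto
      show "e' = p ` e" if e': "e' \<in> (`) p ` M \<and> v \<in> e'" for e'
      proof -
        obtain e'' where e'': "e'' \<in> M" "e' = p ` e''" using e' by auto
        then show ?thesis using matchings_edge_unique[OF assms(2) e(1) e''(1) e(2)] *[of e''] e' by simp
      qed
    qed
  qed
  moreover have "(`) p ` M \<subseteq> {e. e \<subseteq> V \<and> card e = 2}"
    using matchings_edgeD[OF assms(2)] permutes_image[OF assms(1)] card_image[OF inj_on_subset[OF inj]]
    by (auto simp: subset_iff)
  ultimately show ?thesis by (simp add: matchings_def)
qed

lemma swap_pts_matchings: "a \<in> V \<Longrightarrow> b \<in> V \<Longrightarrow> M \<in> matchings V \<Longrightarrow> swap_pts a b M \<in> matchings V"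
  unfolding swap_pts_def by (intro matchings_image permutes_swap_id)

lemma swap_pts_swap_pts: "swap_pts a b (swap_pts a b M) = M"
  by (simp add: swap_pts_def image_image)

lemma swap_pts_commute: "swap_pts a b M = swap_pts b a M"
  by (simp add: swap_pts_def transpose_commute)

lemma edge_swap_pts: "edge (swap_pts a b M) (transpose a b x) (transpose a b y) = edge M x y"
proof -
  have "inj ((`) (transpose a b))"
    by (metis bij_transpose bij_betw_def inj_image_eq_iff injI)
  then have "transpose a b ` {x, y} \<in> swap_pts a b M \<longleftrightarrow> {x, y} \<in> M"
    unfolding swap_pts_def by (rule inj_image_mem_iff)
  then show ?thesis by (simp add: edge_def)
qed

lemma sum_matchings_swap_pts:
  assumes "a \<in> V" "b \<in> V"
  shows "(\<Sum>M\<in>matchings V. \<phi> (swap_pts a b M)) = (\<Sum>M\<in>matchings V. \<phi> M)"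
  by (rule sum.reindex_bij_witness[of _ "swap_pts a b" "swap_pts a b"]) (auto simp: swap_pts_swap_pts swap_pts_matchings assms)

lemma swap_pts_insert: "x \<notin> {a, b} \<Longrightarrow> y \<notin> {a, b} \<Longrightarrow> swap_pts x y (insert {a, b} M) = insert {a, b} (swap_pts x y M)"
  by (auto simp: swap_pts_def transpose_def)

text \<open>Transitivity of the symmetric group, phrased for functions invariant under
  transpositions. Transposing the partners x and y of v turns M into a matching that shares the edge
  v y with N. The induction then runs on the remaining points with the function
  \<open>\<lambda>M. f (insert {v, y} M)\<close>, which is why \<open>f\<close> is arbitrary in
  it.\<close>

lemma matchings_swap_pts_invariant_const:
  assumes "finite V" "\<And>a b M. a \<in> V \<Longrightarrow> b \<in> V \<Longrightarrow> M \<in> matchings V \<Longrightarrow> f (swap_pts a b M) = f M"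
    and "M \<in> matchings V" "N \<in> matchings V"
  shows "f M = f N"
  using assms
proof (induction "card V" arbitrary: V M N f rule: less_induct)
  case less
  show ?case
  proof (cases "V = {}")
    case True
    then show ?thesis using less.prems(3,4) by (simp add: matchings_empty)
  next
    case False
    then obtain v where v: "v \<in> V" by blast
    obtain x where x: "x \<in> V" "x \<noteq> v" "{v, x} \<in> M" using matchings_partner[OF less.prems(3) v] .
    obtain y where "y \<in> V" "y \<noteq> v" "{v, y} \<in> N" using matchings_partner[OF less.prems(4) v] .
    note xy = x this
    define M' where "M' = swap_pts x y M"
    have M': "M' \<in> matchings V" "f M' = f M"
      using xy less.prems(3) less.prems(2)[of x y M] by (auto simp: M'_def swap_pts_matchings)
    have "transpose x y ` {v, x} = {v, y}" using xy by (auto simp: transpose_def)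
    then have vy: "{v, y} \<in> M'" using xy unfolding M'_def swap_pts_def by (metis imageI)
    have "f (insert {v, y} (M' - {{v, y}})) = f (insert {v, y} (N - {{v, y}}))"
    proof (rule less.hyps[of "V - {v, y}" "\<lambda>M. f (insert {v, y} M)"])
      show lt: "card (V - {v, y}) < card V" using v less.prems(1) by (intro psubset_card_mono) auto
      show "f (insert {v, y} (swap_pts a b L)) = f (insert {v, y} L)"
        if "a \<in> V - {v, y}" "b \<in> V - {v, y}" "L \<in> matchings (V - {v, y})" for a b L
        using less.prems(2)[of a b "insert {v, y} L"] that v xy by (simp add: swap_pts_insert matchings_insert)
      show "finite (V - {v, y})" using less.prems(1) by simp
      show "M' - {{v, y}} \<in> matchings (V - {v, y})" by (rule matchings_remove[OF M'(1) vy])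
      show "N - {{v, y}} \<in> matchings (V - {v, y})" by (rule matchings_remove[OF less.prems(4) xy(6)])
    qed
    then show ?thesis using M' vy xy by (simp add: insert_absorb)
  qed
qed

section \<open>The switch operator\<close>

definition inner :: "'a set \<Rightarrow> ('a set set \<Rightarrow> real) \<Rightarrow> ('a set set \<Rightarrow> real) \<Rightarrow> real" where
  "inner V f g = (\<Sum>M\<in>matchings V. f M * g M)"

text \<open>The operator J. The factor \<open>edge M x v\<close> selects the one x matched to v;
  then v is rematched to y while x takes over the old partner of y. So J is the adjacency operator
  of a graph in which M has one neighbour for each y, that is 2 n - 2 of them.\<close>

definition switch :: "'a set \<Rightarrow> 'a \<Rightarrow> ('a set set \<Rightarrow> real) \<Rightarrow> 'a set set \<Rightarrow> real" where
  "switch V v f M = (\<Sum>x\<in>V - {v}. \<Sum>y\<in>V - {v} - {x}. edge M x v * f (swap_pts x y M))"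

text \<open>This plays two roles: for fixed v it is the sum of f over a partner class of v, and for
  varying v it is the symmetric matrix, with zero diagonal, of the pairings of f with the edge
  indicators.\<close>

definition slice_sum :: "'a set \<Rightarrow> 'a \<Rightarrow> ('a set set \<Rightarrow> real) \<Rightarrow> 'a \<Rightarrow> real" where
  "slice_sum V v f x = (\<Sum>M\<in>matchings V. edge M x v * f M)"

lemma inner_commute: "inner V f g = inner V g f"
  by (simp add: inner_def mult.commute)

lemma inner_add: "inner V (\<lambda>M. f M + g M) k = inner V f k + inner V g k"
  and inner_add2: "inner V k (\<lambda>M. f M + g M) = inner V k f + inner V k g"
  and inner_diff: "inner V (\<lambda>M. f M - g M) k = inner V f k - inner V g k"
  and inner_diff2: "inner V k (\<lambda>M. f M - g M) = inner V k f - inner V k g"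
  and inner_scale: "inner V (\<lambda>M. c * f M) k = c * inner V f k"
  and inner_scale2: "inner V k (\<lambda>M. c * f M) = c * inner V k f"
  by (simp_all add: inner_def algebra_simps sum.distrib sum_subtractf sum_distrib_left)

lemmas inner_linear = inner_add inner_add2 inner_diff inner_diff2 inner_scale inner_scale2

lemma inner_self_ge0: "inner V f f \<ge> 0"
  by (simp add: inner_def sum_nonneg)

lemma inner_self_eq0: "finite V \<Longrightarrow> inner V f f = 0 \<Longrightarrow> M \<in> matchings V \<Longrightarrow> f M = 0"
  unfolding inner_def using sum_nonneg_eq_0_iff[OF finite_matchings, of V "\<lambda>M. f M * f M"] by auto

lemma inner_cong: "(\<And>M. M \<in> matchings V \<Longrightarrow> f M = f' M) \<Longrightarrow> (\<And>M. M \<in> matchings V \<Longrightarrow> g M = g' M)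
    \<Longrightarrow> inner V f g = inner V f' g'"
  by (simp add: inner_def)

lemma switch_linear:
  "switch V v (\<lambda>M. f M + g M) = (\<lambda>M. switch V v f M + switch V v g M)"
  "switch V v (\<lambda>M. f M - g M) = (\<lambda>M. switch V v f M - switch V v g M)"
  "switch V v (\<lambda>M. c * f M) = (\<lambda>M. c * switch V v f M)"
  by (simp_all add: fun_eq_iff switch_def algebra_simps sum.distrib sum_subtractf sum_distrib_left)

lemma switch_cong:
  assumes "M \<in> matchings V" "\<And>N. N \<in> matchings V \<Longrightarrow> f N = g N"
  shows "switch V v f M = switch V v g M"
  unfolding switch_def using assms by (intro sum.cong refl) (simp add: swap_pts_matchings)

lemma switch_at:
  assumes "finite V" "M \<in> matchings V" "{x, v} \<in> M"
  shows "switch V v f M = (\<Sum>y\<in>V - {v} - {x}. f (swap_pts x y M))"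
proof -
  have xv: "v \<in> V" "x \<in> V" "x \<noteq> v" using matchings_pairD[OF assms(2,3)] by auto
  have "(\<Sum>z\<in>V. edge M v z * (\<Sum>y\<in>V - {v} - {z}. f (swap_pts z y M)))
      = (\<Sum>z\<in>V - {v}. edge M v z * (\<Sum>y\<in>V - {v} - {z}. f (swap_pts z y M)))"
    using assms(1) xv(1) by (simp add: sum.remove[of V v] edge_self[OF assms(2)])
  also have "\<dots> = switch V v f M"
    unfolding switch_def by (simp add: sum_distrib_left edge_commute)
  finally show ?thesis
    using sum_edge_mult[OF assms(2) xv(1) assms(1), of x] assms(3) by (simp add: insert_commute)
qed

lemma inner_switch:
  "inner V g (switch V v f) = (\<Sum>x\<in>V - {v}. \<Sum>y\<in>V - {v} - {x}. \<Sum>M\<in>matchings V. edge M x v * (g M * f (swap_pts x y M)))"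
proof -
  have "inner V g (switch V v f) = (\<Sum>M\<in>matchings V. \<Sum>x\<in>V - {v}. \<Sum>y\<in>V - {v} - {x}. edge M x v * (g M * f (swap_pts x y M)))"
    by (simp add: inner_def switch_def sum_distrib_left mult_ac)
  also have "\<dots> = (\<Sum>x\<in>V - {v}. \<Sum>M\<in>matchings V. \<Sum>y\<in>V - {v} - {x}. edge M x v * (g M * f (swap_pts x y M)))"
    by (rule sum.swap)
  also have "\<dots> = (\<Sum>x\<in>V - {v}. \<Sum>y\<in>V - {v} - {x}. \<Sum>M\<in>matchings V. edge M x v * (g M * f (swap_pts x y M)))"
    by (intro sum.cong refl sum.swap)
  finally show ?thesis .
qed

lemma sum_edge_swap_pts:
  assumes "x \<in> V" "y \<in> V" "v \<noteq> x" "v \<noteq> y"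
  shows "(\<Sum>M\<in>matchings V. edge M x v * \<phi> M (swap_pts x y M)) = (\<Sum>M\<in>matchings V. edge M y v * \<phi> (swap_pts x y M) M)"
proof -
  have e: "edge (swap_pts x y M) x v = edge M y v" for M
    using edge_swap_pts[of x y M y v] assms by (simp add: transpose_def)
  show ?thesis
    using sum_matchings_swap_pts[OF assms(1,2), of "\<lambda>M. edge M x v * \<phi> M (swap_pts x y M)"] by (simp add: swap_pts_swap_pts e)
qed

text \<open>A switch is undone by the same transposition, which carries the class with edge x v to
  the class with edge y v; the sum over ordered pairs x, y is symmetric.\<close>

lemma switch_sym:
  assumes "finite V"
  shows "inner V g (switch V v f) = inner V f (switch V v g)"
proof -
  have "inner V g (switch V v f)
      = (\<Sum>x\<in>V - {v}. \<Sum>y\<in>V - {v} - {x}. \<Sum>M\<in>matchings V. edge M y v * (f M * g (swap_pts y x M)))"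
    unfolding inner_switch
  proof (rule sum.cong[OF refl], rule sum.cong[OF refl])
    fix x y assume "x \<in> V - {v}" "y \<in> V - {v} - {x}"
    then show "(\<Sum>M\<in>matchings V. edge M x v * (g M * f (swap_pts x y M))) = (\<Sum>M\<in>matchings V. edge M y v * (f M * g (swap_pts y x M)))"
      using sum_edge_swap_pts[of x V y v "\<lambda>M N. g M * f N"] by (auto simp: swap_pts_commute[of y x] mult.commute)
  qed
  also have "\<dots> = (\<Sum>x\<in>V - {v}. \<Sum>y\<in>V - {v} - {x}. \<Sum>M\<in>matchings V. edge M x v * (f M * g (swap_pts x y M)))"
    using assms by (simp add: sum.Sigma)
      (rule sum.reindex_bij_witness[of _ "\<lambda>(x, y). (y, x)" "\<lambda>(x, y). (y, x)"]; auto)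
  finally show ?thesis by (simp add: inner_switch)
qed

text \<open>On class sums J acts as the adjacency matrix of the complete graph on the possible
  partners of v. In particular vanishing of all class sums is preserved by J.\<close>

lemma slice_sum_switch:
  assumes "finite V" "v \<in> V" "x \<in> V - {v}"
  shows "slice_sum V v (switch V v f) x = (\<Sum>y\<in>V - {v} - {x}. slice_sum V v f y)"
proof -
  have "slice_sum V v (switch V v f) x = (\<Sum>M\<in>matchings V. \<Sum>y\<in>V - {v} - {x}. edge M x v * f (swap_pts x y M))"
    unfolding slice_sum_def
  proof (intro sum.cong refl)
    fix M assume "M \<in> matchings V"
    then show "edge M x v * switch V v f M = (\<Sum>y\<in>V - {v} - {x}. edge M x v * f (swap_pts x y M))"
      using switch_at[OF assms(1), of M x v f] by (cases "{x, v} \<in> M") (auto simp: edge_def)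
  qed
  also have "\<dots> = (\<Sum>y\<in>V - {v} - {x}. \<Sum>M\<in>matchings V. edge M x v * f (swap_pts x y M))" by (rule sum.swap)
  also have "\<dots> = (\<Sum>y\<in>V - {v} - {x}. slice_sum V v f y)"
    unfolding slice_sum_def
  proof (rule sum.cong[OF refl])
    fix y assume "y \<in> V - {v} - {x}"
    then show "(\<Sum>M\<in>matchings V. edge M x v * f (swap_pts x y M)) = (\<Sum>M\<in>matchings V. edge M y v * f M)"
      using sum_edge_swap_pts[of x V y v "\<lambda>M N. f N"] assms by auto
  qed
  finally show ?thesis .
qed

lemma sum_slice_sum:
  assumes "finite V" "v \<in> V"
  shows "(\<Sum>x\<in>V - {v}. slice_sum V v f x) = (\<Sum>M\<in>matchings V. f M)"
  using sum_matchings_slices[OF assms, of f] assms by (simp add: slice_sum_def sum_edge_slice)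

section \<open>Averaging over the matchings through a fixed edge\<close>

text \<open>Since v and x are partners, excluding v, x, y spoils only one further vertex, the
  partner of y. The other 2 n - 4 vertices each start one ordered edge.\<close>

lemma edge_count_avoiding:
  assumes "finite V" "card V = 2 * n" "M \<in> matchings V" "{x, v} \<in> M" "y \<in> V - {v} - {x}"
  shows "(\<Sum>a\<in>V - {v} - {x, y}. \<Sum>b\<in>V - {v} - {x, y} - {a}. edge M a b) = 2 * real n - 4"
proof -
  have xv: "v \<in> V" "x \<in> V" "x \<noteq> v" using matchings_pairD[OF assms(3,4)] by auto
  have D: "V - {v} - {x, y} = V - {v, x, y}" by auto
  have zero: "edge M a x = 0" "edge M a v = 0" if "a \<noteq> v" "a \<noteq> x" for a
    using edge_mult_cancel[OF assms(3), of a v x] edge_mult_cancel[OF assms(3), of a x v] that assms(4)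
    by (auto simp: edge_def insert_commute)
  have "(\<Sum>a\<in>V - {v, x, y}. \<Sum>b\<in>V - {v, x, y} - {a}. edge M a b) = (\<Sum>a\<in>V - {v, x, y}. 1 - edge M y a)"
  proof (intro sum.cong refl)
    fix a assume a: "a \<in> V - {v, x, y}"
    then have "(\<Sum>b\<in>V - {v, x, y} - {a}. edge M a b) = (\<Sum>b\<in>V - {v, x, y}. edge M a b)"
      using assms by (subst sum.remove[of "V - {v, x, y}" a]) (auto simp: edge_self)
    also have "\<dots> = 1 - (\<Sum>b\<in>{v, x, y}. edge M a b)"
      using a assms xv by (intro sum_edge_diff) auto
    also have "(\<Sum>b\<in>{v, x, y}. edge M a b) = edge M a y"
      using zero[of a] a assms(5) xv by auto
    finally show "(\<Sum>b\<in>V - {v, x, y} - {a}. edge M a b) = 1 - edge M y a"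
      by (simp add: edge_commute)
  qed
  also have "\<dots> = real (card (V - {v, x, y})) - (\<Sum>a\<in>V - {v, x, y}. edge M y a)"
    by (simp add: sum_subtractf)
  also have "(\<Sum>a\<in>V - {v, x, y}. edge M y a) = 1 - (\<Sum>a\<in>{v, x, y}. edge M y a)"
    using assms xv by (intro sum_edge_diff) auto
  also have "\<dots> = 1" using zero[of y] assms xv by (auto simp: edge_self)
  also have "real (card (V - {v, x, y})) = 2 * real n - 3"
  proof -
    have "card {v, x, y} = 3" "{v, x, y} \<subseteq> V" using assms(5) xv by auto
    then show ?thesis
      using assms(1,2) card_mono[of V "{v, x, y}"] by (simp add: card_Diff_subset of_nat_diff)
  qed
  finally show ?thesis by (simp add: D)
qed

lemma edge_count:
  assumes "finite V" "card V = 2 * n" "M \<in> matchings V" "v \<in> V"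
  shows "(\<Sum>a\<in>V - {v}. \<Sum>b\<in>V - {v} - {a}. edge M a b) = 2 * real n - 2"
proof -
  have "(\<Sum>a\<in>V - {v}. \<Sum>b\<in>V - {v} - {a}. edge M a b) = (\<Sum>a\<in>V - {v}. 1 - edge M v a)"
  proof (intro sum.cong refl)
    fix a assume a: "a \<in> V - {v}"
    then have "(\<Sum>b\<in>V - {v} - {a}. edge M a b) = (\<Sum>b\<in>V - {v}. edge M a b)"
      using assms by (subst sum.remove[of "V - {v}" a]) (auto simp: edge_self)
    also have "\<dots> = 1 - (\<Sum>b\<in>{v}. edge M a b)"
      using a assms by (intro sum_edge_diff) auto
    finally show "(\<Sum>b\<in>V - {v} - {a}. edge M a b) = 1 - edge M v a" by (simp add: edge_commute)
  qed
  also have "\<dots> = real (card (V - {v})) - (\<Sum>a\<in>V - {v}. edge M v a)"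
    by (simp add: sum_subtractf)
  also have "(\<Sum>a\<in>V - {v}. edge M v a) = 1 - (\<Sum>a\<in>{v}. edge M v a)"
    using assms by (intro sum_edge_diff) auto
  also have "\<dots> = 1" using assms by (simp add: edge_self)
  also have "real (card (V - {v})) = 2 * real n - 1"
    using assms card_gt_0_iff[of V] by (auto simp: of_nat_diff)
  finally show ?thesis by simp
qed

lemma sum_swap_quadruples:
  assumes "finite U"
  shows "(\<Sum>a\<in>U. \<Sum>b\<in>U - {a}. \<Sum>x\<in>U - {a, b}. \<Sum>y\<in>U - {a, b} - {x}. P a b x y)
       = (\<Sum>x\<in>U. \<Sum>y\<in>U - {x}. \<Sum>a\<in>U - {x, y}. \<Sum>b\<in>U - {x, y} - {a}. P a b x y :: real)"
  using assms
  by (simp add: sum.Sigma)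
    (rule sum.reindex_bij_witness[of _ "\<lambda>(x, y, a, b). (a, b, x, y)" "\<lambda>(x, y, a, b). (a, b, x, y)"]; auto)

definition slice :: "'a \<Rightarrow> 'a \<Rightarrow> ('a set set \<Rightarrow> real) \<Rightarrow> 'a set set \<Rightarrow> real" where
  "slice a b f M = f (insert {a, b} M)"

lemma inner_switch_slice:
  assumes "finite V" "v \<in> V" "a \<in> V - {v}" "b \<in> V - {v} - {a}"
  shows "inner (V - {a, b}) (slice a b f) (switch (V - {a, b}) v (slice a b f))
       = (\<Sum>x\<in>V - {v} - {a, b}. \<Sum>y\<in>V - {v} - {a, b} - {x}.
            \<Sum>M\<in>matchings V. edge M a b * (edge M x v * (f M * f (swap_pts x y M))))"
proof -
  have D: "V - {a, b} - {v} = V - {v} - {a, b}" by auto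
  have "(\<Sum>M\<in>matchings (V - {a, b}). edge M x v * (slice a b f M * slice a b f (swap_pts x y M)))
      = (\<Sum>M\<in>matchings V. edge M a b * (edge M x v * (f M * f (swap_pts x y M))))"
    if "x \<in> V - {v} - {a, b}" "y \<in> V - {v} - {a, b} - {x}" for x y
  proof -
    have "{x, v} \<noteq> {a, b}" using that by auto
    then show ?thesis
      using assms that by (subst sum_edge_slice) (auto simp: slice_def swap_pts_insert edge_def)
  qed
  then show ?thesis unfolding inner_switch D by (intro sum.cong[OF refl]) blast
qed

text \<open>Double counting: the switch of x and y in M is seen by the slice through the edge a b of
  M exactly when a b avoids v, x and y, and there are 2 n - 4 such ordered edges.\<close>

lemma switch_average:
  assumes "finite V" "card V = 2 * n" "v \<in> V"
  shows "(\<Sum>a\<in>V - {v}. \<Sum>b\<in>V - {v} - {a}. inner (V - {a, b}) (slice a b f) (switch (V - {a, b}) v (slice a b f)))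
       = (2 * real n - 4) * inner V f (switch V v f)"
proof -
  define U where "U = V - {v}"
  have "(\<Sum>a\<in>U. \<Sum>b\<in>U - {a}. inner (V - {a, b}) (slice a b f) (switch (V - {a, b}) v (slice a b f)))
      = (\<Sum>a\<in>U. \<Sum>b\<in>U - {a}. \<Sum>x\<in>U - {a, b}. \<Sum>y\<in>U - {a, b} - {x}.
            \<Sum>M\<in>matchings V. edge M a b * (edge M x v * (f M * f (swap_pts x y M))))"
    unfolding U_def by (rule sum.cong[OF refl], rule sum.cong[OF refl], rule inner_switch_slice[OF assms(1,3)])
  also have "\<dots> = (\<Sum>x\<in>U. \<Sum>y\<in>U - {x}. \<Sum>a\<in>U - {x, y}. \<Sum>b\<in>U - {x, y} - {a}.
            \<Sum>M\<in>matchings V. edge M a b * (edge M x v * (f M * f (swap_pts x y M))))"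
    using assms(1) by (intro sum_swap_quadruples) (simp add: U_def)
  also have "\<dots> = (\<Sum>x\<in>U. \<Sum>y\<in>U - {x}. (2 * real n - 4) * (\<Sum>M\<in>matchings V. edge M x v * (f M * f (swap_pts x y M))))"
  proof (intro sum.cong refl)
    fix x y assume xy: "x \<in> U" "y \<in> U - {x}"
    let ?g = "\<lambda>M. edge M x v * (f M * f (swap_pts x y M))"
    have "(\<Sum>a\<in>U - {x, y}. \<Sum>b\<in>U - {x, y} - {a}. \<Sum>M\<in>matchings V. edge M a b * ?g M)
        = (\<Sum>a\<in>U - {x, y}. \<Sum>M\<in>matchings V. \<Sum>b\<in>U - {x, y} - {a}. edge M a b * ?g M)"
      by (intro sum.cong refl sum.swap)
    also have "\<dots> = (\<Sum>M\<in>matchings V. \<Sum>a\<in>U - {x, y}. \<Sum>b\<in>U - {x, y} - {a}. edge M a b * ?g M)"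
      by (rule sum.swap)
    also have "\<dots> = (\<Sum>M\<in>matchings V. (\<Sum>a\<in>U - {x, y}. \<Sum>b\<in>U - {x, y} - {a}. edge M a b) * ?g M)"
      by (simp add: sum_distrib_right)
    also have "\<dots> = (\<Sum>M\<in>matchings V. (2 * real n - 4) * ?g M)"
    proof (intro sum.cong refl)
      fix M assume M: "M \<in> matchings V"
      show "(\<Sum>a\<in>U - {x, y}. \<Sum>b\<in>U - {x, y} - {a}. edge M a b) * ?g M = (2 * real n - 4) * ?g M"
      proof (cases "{x, v} \<in> M")
        case True
        then show ?thesis
          using edge_count_avoiding[OF assms(1,2) M, of x v y] xy by (simp add: U_def)
      qed (simp add: edge_def)
    qed
    finally show "(\<Sum>a\<in>U - {x, y}. \<Sum>b\<in>U - {x, y} - {a}. \<Sum>M\<in>matchings V. edge M a b * ?g M)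
        = (2 * real n - 4) * (\<Sum>M\<in>matchings V. ?g M)"
      by (simp add: sum_distrib_left)
  qed
  also have "\<dots> = (2 * real n - 4) * inner V f (switch V v f)"
    by (simp add: inner_switch U_def sum_distrib_left)
  finally show ?thesis by (simp add: U_def)
qed

lemma inner_slice:
  assumes "finite V" "v \<in> V" "a \<in> V - {v}" "b \<in> V - {v} - {a}"
  shows "inner (V - {a, b}) (slice a b f) (slice a b f) = (\<Sum>M\<in>matchings V. edge M a b * (f M * f M))"
  using assms by (subst sum_edge_slice) (auto simp: slice_def inner_def)

text \<open>The squared norm is counted 2 n - 2 times, against 2 n - 4 for the quadratic form of J.
  Averaging therefore worsens a bound by the factor (n - 1) / (n - 2), which drives both
  inductions.\<close>

lemma inner_average:
  assumes "finite V" "card V = 2 * n" "v \<in> V"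
  shows "(\<Sum>a\<in>V - {v}. \<Sum>b\<in>V - {v} - {a}. inner (V - {a, b}) (slice a b f) (slice a b f))
       = (2 * real n - 2) * inner V f f"
proof -
  have "(\<Sum>a\<in>V - {v}. \<Sum>b\<in>V - {v} - {a}. inner (V - {a, b}) (slice a b f) (slice a b f))
      = (\<Sum>a\<in>V - {v}. \<Sum>b\<in>V - {v} - {a}. \<Sum>M\<in>matchings V. edge M a b * (f M * f M))"
    by (rule sum.cong[OF refl], rule sum.cong[OF refl], rule inner_slice[OF assms(1,3)])
  also have "\<dots> = (\<Sum>a\<in>V - {v}. \<Sum>M\<in>matchings V. \<Sum>b\<in>V - {v} - {a}. edge M a b * (f M * f M))"
    by (intro sum.cong refl sum.swap)
  also have "\<dots> = (\<Sum>M\<in>matchings V. \<Sum>a\<in>V - {v}. \<Sum>b\<in>V - {v} - {a}. edge M a b * (f M * f M))"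
    by (rule sum.swap)
  also have "\<dots> = (\<Sum>M\<in>matchings V. (\<Sum>a\<in>V - {v}. \<Sum>b\<in>V - {v} - {a}. edge M a b) * (f M * f M))"
    by (simp add: sum_distrib_right)
  also have "\<dots> = (2 * real n - 2) * inner V f f"
    using edge_count[OF assms(1,2) _ assms(3)] by (simp add: inner_def sum_distrib_left)
  finally show ?thesis .
qed

section \<open>Bounds on the switch operator\<close>

definition partner_fun :: "'a set \<Rightarrow> 'a \<Rightarrow> ('a \<Rightarrow> real) \<Rightarrow> 'a set set \<Rightarrow> real" where
  "partner_fun V v a M = (\<Sum>x\<in>V - {v}. edge M x v * a x)"

lemma partner_fun_at:
  assumes "finite V" "M \<in> matchings V" "{x, v} \<in> M"
  shows "partner_fun V v a M = a x"
proof -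
  have xv: "v \<in> V" using matchings_pairD[OF assms(2,3)] by auto
  have "(\<Sum>z\<in>V. edge M v z * a z) = (\<Sum>z\<in>V - {v}. edge M v z * a z)"
    using assms(1) xv by (simp add: sum.remove[of V v] edge_self[OF assms(2)])
  also have "\<dots> = partner_fun V v a M" by (simp add: partner_fun_def edge_commute)
  finally show ?thesis
    using sum_edge_mult[OF assms(2) xv assms(1), of x] assms(3) by (simp add: insert_commute)
qed

lemma inner_partner_fun: "inner V f (partner_fun V v a) = (\<Sum>x\<in>V - {v}. a x * slice_sum V v f x)"
proof -
  have "inner V f (partner_fun V v a) = (\<Sum>M\<in>matchings V. \<Sum>x\<in>V - {v}. a x * (edge M x v * f M))"
    by (simp add: inner_def partner_fun_def sum_distrib_left mult_ac)
  also have "\<dots> = (\<Sum>x\<in>V - {v}. \<Sum>M\<in>matchings V. a x * (edge M x v * f M))" by (rule sum.swap)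
  finally show ?thesis by (simp add: slice_sum_def sum_distrib_left)
qed

lemma switch_partner_fun:
  assumes "finite V" "M \<in> matchings V" "v \<in> V"
  shows "switch V v (partner_fun V v a) M = partner_fun V v (\<lambda>x. \<Sum>y\<in>V - {v} - {x}. a y) M"
proof -
  obtain x where x: "x \<in> V" "x \<noteq> v" "{v, x} \<in> M" using matchings_partner[OF assms(2,3)] .
  then have xv: "{x, v} \<in> M" by (simp add: insert_commute)
  have "partner_fun V v a (swap_pts x y M) = a y" if "y \<in> V - {v} - {x}" for y
  proof (rule partner_fun_at[OF assms(1)])
    show "swap_pts x y M \<in> matchings V" using x that assms by (intro swap_pts_matchings) auto
    have "edge (swap_pts x y M) y v = edge M x v"
      using edge_swap_pts[of x y M x v] x that by (auto simp: transpose_def)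
    then show "{y, v} \<in> swap_pts x y M" using xv by (simp add: edge_def split: if_splits)
  qed
  then show ?thesis by (simp add: switch_at[OF assms(1,2) xv] partner_fun_at[OF assms(1,2) xv])
qed

lemma slice_sum_edge:
  assumes "finite V" "v \<in> V" "x \<in> V - {v}"
  shows "slice_sum V v f x = (\<Sum>M\<in>matchings (V - {x, v}). f (insert {x, v} M))"
  unfolding slice_sum_def using assms by (intro sum_edge_slice) auto

lemma card_remove_pair:
  assumes "finite V" "card V = 2 * n" "a \<in> V" "b \<in> V" "a \<noteq> b"
  shows "card (V - {a, b}) = 2 * (n - 1)"
  using assms by (simp add: card_Diff_subset)

lemma slice_sum_partner_fun:
  assumes "finite V" "card V = 2 * n" "v \<in> V" "x \<in> V - {v}"
  shows "slice_sum V v (partner_fun V v a) x = odd_fact (n - 1) * a x"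
proof -
  have "slice_sum V v (partner_fun V v a) x = (\<Sum>M\<in>matchings (V - {x, v}). a x)"
    unfolding slice_sum_edge[OF assms(1,3,4)]
  proof (intro sum.cong refl)
    fix M assume "M \<in> matchings (V - {x, v})"
    then show "partner_fun V v a (insert {x, v} M) = a x"
      using assms by (intro partner_fun_at) (auto intro: matchings_insert)
  qed
  then show ?thesis
    using card_matchings[of "V - {x, v}" "n - 1"] card_remove_pair[OF assms(1,2)] assms by simp
qed

text \<open>For n at most 2 each partner class of v is a single matching, so a function is the same
  as its class sums.\<close>

lemma inner_small:
  assumes "finite V" "card V = 2 * n" "n \<le> 2" "v \<in> V"
  shows "inner V f g = (\<Sum>x\<in>V - {v}. slice_sum V v f x * slice_sum V v g x)"
proof -
  have "(\<Sum>M\<in>matchings (V - {x, v}). f (insert {x, v} M) * g (insert {x, v} M)) = slice_sum V v f x * slice_sum V v g x"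
    if "x \<in> V - {v}" for x
  proof -
    have "n - 1 = 0 \<or> n - 1 = Suc 0" using assms by auto
    then have "odd_fact (n - 1) = 1" by (auto simp: odd_fact_simps)
    then have "card (matchings (V - {x, v})) = 1"
      using card_matchings[of "V - {x, v}" "n - 1"] card_remove_pair[OF assms(1,2)] assms that by simp
    then obtain m where "matchings (V - {x, v}) = {m}" by (auto simp: card_1_singleton_iff)
    then show ?thesis using slice_sum_edge[OF assms(1,4) that] by simp
  qed
  then show ?thesis
    unfolding inner_def using sum_matchings_slices[OF assms(1,4), of "\<lambda>M. f M * g M"] by simp
qed

lemma sum_mult_others:
  fixes F :: "'a \<Rightarrow> real"
  assumes "finite U"
  shows "(\<Sum>x\<in>U. F x * (\<Sum>y\<in>U - {x}. F y)) = (\<Sum>x\<in>U. F x)\<^sup>2 - (\<Sum>x\<in>U. (F x)\<^sup>2)"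
proof -
  have "(\<Sum>x\<in>U. F x * (\<Sum>y\<in>U - {x}. F y)) = (\<Sum>x\<in>U. F x * ((\<Sum>y\<in>U. F y) - F x))"
    using assms by (intro sum.cong refl) (simp add: sum_diff1)
  also have "\<dots> = (\<Sum>x\<in>U. F x) * (\<Sum>y\<in>U. F y) - (\<Sum>x\<in>U. (F x)\<^sup>2)"
    by (simp add: right_diff_distrib sum_subtractf sum_distrib_right power2_eq_square)
  finally show ?thesis by (simp add: power2_eq_square)
qed

text \<open>The averaging factor turns - (n - 2) into exactly - (n - 1). At n = 2 the operator J is
  the complete graph on three matchings, with least eigenvalue - 1, and at n = 1 it is zero.\<close>

lemma switch_lower:
  assumes "finite V" "card V = 2 * n" "v \<in> V"
  shows "inner V f (switch V v f) \<ge> - (real n - 1) * inner V f f"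
  using assms
proof (induction n arbitrary: V f rule: less_induct)
  case (less n)
  have n0: "n \<ge> 1" using less.prems card_gt_0_iff[of V] by auto
  show ?case
  proof (cases "n \<le> 2")
    case True
    have "inner V f (switch V v f) = (\<Sum>x\<in>V - {v}. slice_sum V v f x * (\<Sum>y\<in>V - {v} - {x}. slice_sum V v f y))"
      using less.prems True by (simp add: inner_small[of V n v] slice_sum_switch)
    then have e: "inner V f (switch V v f) = (\<Sum>x\<in>V - {v}. slice_sum V v f x)\<^sup>2 - inner V f f"
      using less.prems True by (simp only: sum_mult_others finite_Diff inner_small[of V n v] power2_eq_square)
    show ?thesis
    proof (cases "n = 2")
      case True
      then show ?thesis by (simp add: e)
    next
      case False
      then have "n = 1" using n0 True by simp
      then have "card (V - {v}) = 1" using less.prems by simp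
      then obtain w where "V - {v} = {w}" by (auto simp: card_1_singleton_iff)
      then have "inner V f (switch V v f) = 0" by (simp add: inner_switch)
      then show ?thesis using \<open>n = 1\<close> by simp
    qed
  next
    case False
    \<comment> \<open>Averaging divides by 2 n - 4, which is positive only from n = 3 on; hence two
      base cases.\<close>
    have "(2 * real n - 4) * inner V f (switch V v f)
        = (\<Sum>a\<in>V - {v}. \<Sum>b\<in>V - {v} - {a}. inner (V - {a, b}) (slice a b f) (switch (V - {a, b}) v (slice a b f)))"
      using switch_average[OF less.prems] by simp
    also have "\<dots> \<ge> (\<Sum>a\<in>V - {v}. \<Sum>b\<in>V - {v} - {a}. - (real n - 2) * inner (V - {a, b}) (slice a b f) (slice a b f))"
    proof (intro sum_mono)
      fix a b assume ab: "a \<in> V - {v}" "b \<in> V - {v} - {a}"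
      have "- (real (n - 1) - 1) * inner (V - {a, b}) (slice a b f) (slice a b f)
          \<le> inner (V - {a, b}) (slice a b f) (switch (V - {a, b}) v (slice a b f))"
        using ab less.prems False by (intro less.IH card_remove_pair) auto
      then show "- (real n - 2) * inner (V - {a, b}) (slice a b f) (slice a b f)
          \<le> inner (V - {a, b}) (slice a b f) (switch (V - {a, b}) v (slice a b f))"
        using False by (simp add: of_nat_diff)
    qed
    also have "(\<Sum>a\<in>V - {v}. \<Sum>b\<in>V - {v} - {a}. - (real n - 2) * inner (V - {a, b}) (slice a b f) (slice a b f))
        = - (real n - 2) * ((2 * real n - 2) * inner V f f)"
      using inner_average[OF less.prems, of f] by (simp add: sum_distrib_left flip: sum_distrib_left)
    finally have "(2 * (real n - 2)) * (- (real n - 1) * inner V f f) \<le> (2 * (real n - 2)) * inner V f (switch V v f)"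
      by (simp add: algebra_simps)
    then show ?thesis using False by (subst (asm) mult_le_cancel_left_pos) auto
  qed
qed

section \<open>The Gram matrix of the edge indicators\<close>

text \<open>Two distinct edges sharing a vertex never occur together, and fixing one or two disjoint
  edges leaves a smaller complete graph. The truncated n - 2 is harmless at n = 1, where no two
  disjoint pairs exist.\<close>

lemma edge_pair_count:
  assumes "finite V" "card V = 2 * n" "a \<in> V" "b \<in> V" "a \<noteq> b" "c \<in> V" "d \<in> V" "c \<noteq> d"
  shows "(\<Sum>M\<in>matchings V. edge M a b * edge M c d)
    = (if {c, d} = {a, b} then odd_fact (n - 1) else if c \<notin> {a, b} \<and> d \<notin> {a, b} then odd_fact (n - 2) else 0)"
proof -
  have W: "card (V - {a, b}) = 2 * (n - 1)" "finite (V - {a, b})"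
    using card_remove_pair[OF assms(1-5)] assms(1) by auto
  have e: "(\<Sum>M\<in>matchings V. edge M a b * edge M c d) = (\<Sum>M\<in>matchings (V - {a, b}). edge (insert {a, b} M) c d)"
    using assms by (intro sum_edge_slice) auto
  consider (1) "{c, d} = {a, b}" | (2) "c \<notin> {a, b}" "d \<notin> {a, b}"
    | (3) "{c, d} \<noteq> {a, b}" "c \<in> {a, b} \<or> d \<in> {a, b}" by blast
  then show ?thesis
  proof cases
    case 1
    then show ?thesis unfolding e using card_matchings[OF W(2,1)] by (simp add: edge_def)
  next
    case 2
    then have "{c, d} \<noteq> {a, b}" by auto
    have "(\<Sum>M\<in>matchings (V - {a, b}). edge (insert {a, b} M) c d) = (\<Sum>M\<in>matchings (V - {a, b}). edge M c d * 1)"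
      using \<open>{c, d} \<noteq> {a, b}\<close> by (simp add: edge_def)
    also have "\<dots> = (\<Sum>M\<in>matchings (V - {a, b} - {c, d}). 1)"
      using 2 assms by (intro sum_edge_slice) auto
    also have "\<dots> = odd_fact (n - 2)"
      using card_matchings[of "V - {a, b} - {c, d}" "n - 1 - 1"] card_remove_pair[OF W(2,1), of c d] 2 assms
      by (simp add: numeral_2_eq_2)
    finally show ?thesis using 2 \<open>{c, d} \<noteq> {a, b}\<close> by (simp add: e)
  next
    case 3
    have "edge (insert {a, b} M) c d = 0" if "M \<in> matchings (V - {a, b})" for M
      using matchings_pairD[OF that, of c d] 3 by (auto simp: edge_def)
    then have "(\<Sum>M\<in>matchings V. edge M a b * edge M c d) = 0" by (simp add: e)
    then show ?thesis using 3 by (auto simp only: if_False split: if_splits)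
  qed
qed

lemma odd_fact_pred:
  assumes "n \<ge> 2"
  shows "odd_fact (n - 1) = (2 * real n - 3) * odd_fact (n - 2)"
proof -
  obtain k where "n = 2 + k" using assms le_Suc_ex by blast
  then show ?thesis by (simp add: odd_fact_simps algebra_simps)
qed

lemma slice_sum_commute: "slice_sum V b f a = slice_sum V a f b"
  by (simp add: slice_sum_def edge_commute)

lemma slice_sum_self: "slice_sum V a f a = 0"
  by (simp add: slice_sum_def edge_self)

lemma sum_slice_sum_all:
  assumes "finite V" "a \<in> V"
  shows "(\<Sum>b\<in>V. slice_sum V b f a) = (\<Sum>M\<in>matchings V. f M)"
  using sum_slice_sum[OF assms, of f] assms by (simp add: sum.remove[of V a] slice_sum_self slice_sum_commute[of V _ f a])

text \<open>Pair f with the edges that avoid v and expand again in the same edges, each counted in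
  both orders. On functions with vanishing partner averages this is a fixed multiple of a
  projection; the multiple is computed in \<open>slice_sum_edge_proj\<close>.\<close>

definition edge_proj :: "'a set \<Rightarrow> 'a \<Rightarrow> ('a set set \<Rightarrow> real) \<Rightarrow> 'a set set \<Rightarrow> real" where
  "edge_proj V v f M = (\<Sum>a\<in>V - {v}. \<Sum>b\<in>V - {v}. edge M a b * slice_sum V b f a)"

lemma inner_edge_proj: "inner V g (edge_proj V v f) = (\<Sum>a\<in>V - {v}. \<Sum>b\<in>V - {v}. slice_sum V b f a * slice_sum V b g a)"
proof -
  have "inner V g (edge_proj V v f)
      = (\<Sum>M\<in>matchings V. \<Sum>a\<in>V - {v}. \<Sum>b\<in>V - {v}. slice_sum V b f a * (edge M a b * g M))"
    by (simp add: inner_def edge_proj_def sum_distrib_left mult_ac)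
  also have "\<dots> = (\<Sum>a\<in>V - {v}. \<Sum>M\<in>matchings V. \<Sum>b\<in>V - {v}. slice_sum V b f a * (edge M a b * g M))"
    by (rule sum.swap)
  also have "\<dots> = (\<Sum>a\<in>V - {v}. \<Sum>b\<in>V - {v}. \<Sum>M\<in>matchings V. slice_sum V b f a * (edge M a b * g M))"
    by (rule sum.cong[OF refl], rule sum.swap)
  finally show ?thesis by (simp add: slice_sum_def sum_distrib_left)
qed

lemma sum_delta2:
  assumes "finite U" "a \<in> U" "b \<in> U"
  shows "(\<Sum>c\<in>U. \<Sum>d\<in>U. if c = a \<and> d = b then g c d else 0) = (g a b :: real)"
proof -
  have "(\<Sum>d\<in>U. if c = a \<and> d = b then g c d else 0) = (if c = a then g a b else 0)" for c
    using assms by (cases "c = a") auto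
  then show ?thesis using assms by simp
qed

lemma sum_if_notin:
  "finite U \<Longrightarrow> (\<Sum>d\<in>U. if d \<notin> D then g d else 0) = (\<Sum>d\<in>U - D. g d :: real)"
  by (rule sum.mono_neutral_cong_right) auto

text \<open>Equivalently, f is orthogonal to every function of the partner of v.\<close>

definition partner_free :: "'a set \<Rightarrow> 'a \<Rightarrow> ('a set set \<Rightarrow> real) \<Rightarrow> bool" where
  "partner_free V v f \<longleftrightarrow> (\<forall>x\<in>V - {v}. slice_sum V v f x = 0)"

lemma partner_free_row:
  assumes "finite V" "v \<in> V" "partner_free V v f" "a \<in> V - {v}"
  shows "(\<Sum>b\<in>V - {v}. slice_sum V b f a) = 0"
proof -
  have "(\<Sum>M\<in>matchings V. f M) = 0"
    using sum_slice_sum[OF assms(1,2), of f] assms(3) by (simp add: partner_free_def)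
  then show ?thesis
    using sum_slice_sum_all[OF assms(1), of a f] assms by (simp add: sum.remove[of V v] partner_free_def)
qed

text \<open>The Gram matrix acts as a scalar on a symmetric matrix h with zero diagonal and zero row
  sums. The pair a b itself contributes 2 (2 n - 3)!! times h a b. By inclusion-exclusion the
  entries of h away from a and b sum to 2 h a b, weighted by (2 n - 5)!!. Together this is 2 ((2 n -
  3) + 1) (2 n - 5)!!.\<close>

lemma slice_sum_edge_proj:
  assumes "finite V" "card V = 2 * n" "n \<ge> 2" "v \<in> V" "partner_free V v f"
    and "a \<in> V - {v}" "b \<in> V - {v}" "a \<noteq> b"
  shows "slice_sum V b (edge_proj V v f) a = 4 * (real n - 1) * odd_fact (n - 2) * slice_sum V b f a"
proof -
  define U where "U = V - {v}"
  define h where "h = (\<lambda>a b. slice_sum V b f a)"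
  have U: "finite U" "a \<in> U" "b \<in> U" using assms by (auto simp: U_def)
  have row: "(\<Sum>d\<in>U. h c d) = 0" if "c \<in> U" for c
    using partner_free_row[OF assms(1,4,5)] that by (simp add: U_def h_def)
  have hs: "h c d = h d c" and h0: "h c c = 0" for c d
    by (simp_all add: h_def slice_sum_self slice_sum_commute[of V d])
  have "slice_sum V b (edge_proj V v f) a = (\<Sum>M\<in>matchings V. \<Sum>c\<in>U. \<Sum>d\<in>U. h c d * (edge M a b * edge M c d))"
    by (simp add: slice_sum_def[of V b "edge_proj V v f"] edge_proj_def sum_distrib_left h_def U_def mult_ac)
  also have "\<dots> = (\<Sum>c\<in>U. \<Sum>M\<in>matchings V. \<Sum>d\<in>U. h c d * (edge M a b * edge M c d))"
    by (rule sum.swap)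
  also have "\<dots> = (\<Sum>c\<in>U. \<Sum>d\<in>U. \<Sum>M\<in>matchings V. h c d * (edge M a b * edge M c d))"
    by (rule sum.cong[OF refl], rule sum.swap)
  also have "\<dots> = (\<Sum>c\<in>U. \<Sum>d\<in>U. odd_fact (n - 1) * (if c = a \<and> d = b then h c d else 0)
      + odd_fact (n - 1) * (if c = b \<and> d = a then h c d else 0)
      + odd_fact (n - 2) * (if c \<notin> {a, b} then if d \<notin> {a, b} then h c d else 0 else 0))"
  proof (rule sum.cong[OF refl], rule sum.cong[OF refl])
    fix c d assume cd: "c \<in> U" "d \<in> U"
    show "(\<Sum>M\<in>matchings V. h c d * (edge M a b * edge M c d)) = odd_fact (n - 1) * (if c = a \<and> d = b then h c d else 0)
      + odd_fact (n - 1) * (if c = b \<and> d = a then h c d else 0)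
      + odd_fact (n - 2) * (if c \<notin> {a, b} then if d \<notin> {a, b} then h c d else 0 else 0)"
    proof (cases "c = d")
      case True
      then show ?thesis using h0 assms(8) by auto
    next
      case False
      have "(\<Sum>M\<in>matchings V. h c d * (edge M a b * edge M c d)) = h c d *
        (if {c, d} = {a, b} then odd_fact (n - 1) else if c \<notin> {a, b} \<and> d \<notin> {a, b} then odd_fact (n - 2) else 0)"
        using edge_pair_count[OF assms(1,2), of a b c d] assms cd False
        by (simp add: U_def flip: sum_distrib_left)
      then show ?thesis using assms(8) False by (auto simp: doubleton_eq_iff)
    qed
  qed
  also have "\<dots> = odd_fact (n - 1) * h a b + odd_fact (n - 1) * h b a
      + odd_fact (n - 2) * (\<Sum>c\<in>U. \<Sum>d\<in>U. if c \<notin> {a, b} then if d \<notin> {a, b} then h c d else 0 else 0)"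
    using U by (simp only: sum.distrib sum_delta2 flip: sum_distrib_left)
  also have "(\<Sum>c\<in>U. \<Sum>d\<in>U. if c \<notin> {a, b} then if d \<notin> {a, b} then h c d else 0 else 0)
      = (\<Sum>c\<in>U. if c \<notin> {a, b} then - h a c - h b c else 0)"
  proof (rule sum.cong[OF refl])
    fix c assume c: "c \<in> U"
    have "(\<Sum>d\<in>U. if d \<notin> {a, b} then h c d else 0) = (\<Sum>d\<in>U - {a, b}. h c d)"
      using U(1) by (rule sum_if_notin)
    also have "\<dots> = - h a c - h b c"
      using U row[OF c] hs[of c] assms(8) by (simp add: sum_diff)
    finally show "(\<Sum>d\<in>U. if c \<notin> {a, b} then if d \<notin> {a, b} then h c d else 0 else 0)
        = (if c \<notin> {a, b} then - h a c - h b c else 0)" by simp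
  qed
  also have "\<dots> = (\<Sum>c\<in>U - {a, b}. - h a c - h b c)"
    using U(1) by (rule sum_if_notin)
  also have "\<dots> = 2 * h a b"
    using U row[of a] row[of b] h0 hs[of b a] assms(8) by (simp add: sum_diff sum_subtractf sum_negf)
  finally have "slice_sum V b (edge_proj V v f) a = 2 * (odd_fact (n - 1) + odd_fact (n - 2)) * h a b"
    using hs[of b a] by (simp add: algebra_simps)
  then show ?thesis unfolding odd_fact_pred[OF assms(3)] by (simp add: h_def algebra_simps)
qed

text \<open>Pythagoras: the normalised edge part of f is orthogonal to the residual, and its squared
  norm is the sum of the squared pairings divided by \<mu>.\<close>

lemma edge_proj_residual:
  assumes "finite V" "card V = 2 * n" "n \<ge> 2" "v \<in> V" "partner_free V v f"
  defines "\<mu> \<equiv> 4 * (real n - 1) * odd_fact (n - 2)"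
  shows "inner V (\<lambda>M. f M - inverse \<mu> * edge_proj V v f M) (\<lambda>M. f M - inverse \<mu> * edge_proj V v f M)
    = inner V f f - inverse \<mu> * (\<Sum>a\<in>V - {v}. \<Sum>b\<in>V - {v}. (slice_sum V b f a)\<^sup>2)"
proof -
  have \<mu>: "\<mu> > 0" using assms(3) odd_fact_pos[of "n - 2"] by (simp add: \<mu>_def)
  let ?N = "\<Sum>a\<in>V - {v}. \<Sum>b\<in>V - {v}. (slice_sum V b f a)\<^sup>2"
  have 1: "inner V f (edge_proj V v f) = ?N" by (simp add: inner_edge_proj power2_eq_square)
  have "inner V (edge_proj V v f) (edge_proj V v f)
      = (\<Sum>a\<in>V - {v}. \<Sum>b\<in>V - {v}. slice_sum V b f a * slice_sum V b (edge_proj V v f) a)"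
    by (rule inner_edge_proj)
  also have "\<dots> = (\<Sum>a\<in>V - {v}. \<Sum>b\<in>V - {v}. \<mu> * (slice_sum V b f a)\<^sup>2)"
  proof (rule sum.cong[OF refl], rule sum.cong[OF refl])
    fix a b assume ab: "a \<in> V - {v}" "b \<in> V - {v}"
    show "slice_sum V b f a * slice_sum V b (edge_proj V v f) a = \<mu> * (slice_sum V b f a)\<^sup>2"
      using slice_sum_edge_proj[OF assms(1-5) ab] by (cases "a = b") (simp_all add: slice_sum_self \<mu>_def power2_eq_square)
  qed
  finally have 2: "inner V (edge_proj V v f) (edge_proj V v f) = \<mu> * ?N" by (simp add: sum_distrib_left)
  show ?thesis
    using \<mu> by (simp add: inner_linear inner_commute[of V "edge_proj V v f" f] 1 2 algebra_simps)
qed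

text \<open>The sum of the squares of \<open>F\<close> is bounded from below by pairing \<open>F\<close> with the test function
  \<open>h a b + c (h a x + h b x)\<close> on distinct triples; the terms with \<open>c\<close> do not contribute to the pairing.\<close>

lemma triple_sum_bound:
  fixes h :: "'a \<Rightarrow> 'a \<Rightarrow> real" and F :: "'a \<Rightarrow> 'a \<Rightarrow> 'a \<Rightarrow> real" and c t :: real
  assumes U: "finite U" "real (card U) = u"
    and hs: "\<And>a b. h a b = h b a" and h0: "\<And>a. h a a = 0"
    and row: "\<And>a. a \<in> U \<Longrightarrow> (\<Sum>b\<in>U. h a b) = 0"
    and F0: "\<And>a b x. a = b \<or> x = a \<or> x = b \<Longrightarrow> F a b x = 0"
    and Fx: "\<And>a b. a \<in> U \<Longrightarrow> b \<in> U \<Longrightarrow> (\<Sum>x\<in>U. F a b x) = h a b"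
    and Fb: "\<And>a x. a \<in> U \<Longrightarrow> x \<in> U \<Longrightarrow> (\<Sum>b\<in>U. F a b x) = 0"
    and Fs: "\<And>a b x. F a b x = F b a x"
  defines "N \<equiv> \<Sum>a\<in>U. \<Sum>b\<in>U. (h a b)\<^sup>2"
  shows "2 * t * N - t\<^sup>2 * (N * (u * (1 + 2 * c\<^sup>2) - 4 * c\<^sup>2 - 2 * (1 + c)\<^sup>2))
    \<le> (\<Sum>a\<in>U. \<Sum>b\<in>U. \<Sum>x\<in>U. (F a b x)\<^sup>2)"
proof -
  define \<phi> where "\<phi> = (\<lambda>a b x. if a = b \<or> x = a \<or> x = b then 0 else h a b + c * (h a x + h b x))"
  define S :: "('a \<Rightarrow> 'a \<Rightarrow> 'a \<Rightarrow> real) \<Rightarrow> real" where "S = (\<lambda>g. \<Sum>a\<in>U. \<Sum>b\<in>U. \<Sum>x\<in>U. g a b x)"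
  have Sadd: "S (\<lambda>a b x. g a b x + k a b x) = S g + S k"
    and Sdiff: "S (\<lambda>a b x. g a b x - k a b x) = S g - S k"
    and Scale: "S (\<lambda>a b x. r * g a b x) = r * S g" for g k r
    by (simp_all add: S_def sum.distrib sum_subtractf sum_distrib_left)
  have Sswap: "S g = S (\<lambda>a b x. g a x b)" for g
    unfolding S_def by (rule sum.cong[OF refl], rule sum.swap)
  have Sswap2: "S g = S (\<lambda>a b x. g b a x)" for g
    unfolding S_def by (rule sum.swap)
  have Scong: "S g = S k" if "\<And>a b x. a \<in> U \<Longrightarrow> b \<in> U \<Longrightarrow> x \<in> U \<Longrightarrow> g a b x = k a b x" for g k
    unfolding S_def using that by (intro sum.cong refl) auto
  have S1: "S (\<lambda>a b x. (h a b)\<^sup>2) = u * N"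
    by (simp add: S_def N_def sum_distrib_left U(2))
  then have S2: "S (\<lambda>a b x. (h a x)\<^sup>2) = u * N" by (subst Sswap)
  then have S3: "S (\<lambda>a b x. (h b x)\<^sup>2) = u * N" by (subst Sswap2)
  have S4: "S (\<lambda>a b x. h a b * h a x) = 0"
    unfolding S_def using row by (simp add: sum.neutral flip: sum_distrib_left)
  have S5: "S (\<lambda>a b x. h a b * h b x) = 0"
    unfolding S_def using row by (simp add: sum.neutral flip: sum_distrib_left)
  have "S (\<lambda>a b x. h a x * h b x) = S (\<lambda>a b x. h a b * h x b)" by (rule Sswap)
  also have "\<dots> = 0" using S5 hs by simp
  finally have S6: "S (\<lambda>a b x. h a x * h b x) = 0" .
  have S7: "S (\<lambda>a b x. if x = a then (h a b)\<^sup>2 else 0) = N"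
    "S (\<lambda>a b x. if x = b then (h a b)\<^sup>2 else 0) = N"
    using U(1) by (simp_all add: S_def N_def)
  have "S (\<lambda>a b x. if a = b then (h a x)\<^sup>2 else 0) = S (\<lambda>a b x. if a = x then (h a b)\<^sup>2 else 0)"
    by (rule Sswap)
  also have "\<dots> = S (\<lambda>a b x. if x = a then (h a b)\<^sup>2 else 0)" by (rule Scong) auto
  finally have S8: "S (\<lambda>a b x. if a = b then (h a x)\<^sup>2 else 0) = N" using S7 by simp
  \<comment> \<open>The expansion over all triples is corrected on the degenerate ones, where \<phi>
    is zero: there the unrestricted square equals 4 c^2 times the square of h a x if a = b, and (1 +
    c)^2 times the square of h a b if x is a or b.\<close>
  have "S (\<lambda>a b x. (\<phi> a b x)\<^sup>2)
      = S (\<lambda>a b x. (h a b)\<^sup>2 + c\<^sup>2 * (h a x)\<^sup>2 + c\<^sup>2 * (h b x)\<^sup>2 + 2 * c * (h a b * h a x)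
          + 2 * c * (h a b * h b x) + 2 * c\<^sup>2 * (h a x * h b x)
          - 4 * c\<^sup>2 * (if a = b then (h a x)\<^sup>2 else 0)
          - (1 + c)\<^sup>2 * (if x = a then (h a b)\<^sup>2 else 0) - (1 + c)\<^sup>2 * (if x = b then (h a b)\<^sup>2 else 0))"
  proof (rule Scong)
    fix a b x :: 'a
    consider "a = b" "x = a" | "a = b" "x \<noteq> a" | "a \<noteq> b" "x = a" | "a \<noteq> b" "x = b" | "a \<noteq> b" "x \<noteq> a" "x \<noteq> b"
      by blast
    then show "(\<phi> a b x)\<^sup>2 = (h a b)\<^sup>2 + c\<^sup>2 * (h a x)\<^sup>2 + c\<^sup>2 * (h b x)\<^sup>2 + 2 * c * (h a b * h a x)
          + 2 * c * (h a b * h b x) + 2 * c\<^sup>2 * (h a x * h b x)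
          - 4 * c\<^sup>2 * (if a = b then (h a x)\<^sup>2 else 0)
          - (1 + c)\<^sup>2 * (if x = a then (h a b)\<^sup>2 else 0) - (1 + c)\<^sup>2 * (if x = b then (h a b)\<^sup>2 else 0)"
      by cases (auto simp: \<phi>_def h0 hs[of b a] power2_eq_square algebra_simps)
  qed
  also have "\<dots> = N * (u * (1 + 2 * c\<^sup>2) - 4 * c\<^sup>2 - 2 * (1 + c)\<^sup>2)"
    by (simp only: Sadd Sdiff Scale S1 S2 S3 S4 S5 S6 S7 S8) algebra
  finally have \<phi>2: "S (\<lambda>a b x. (\<phi> a b x)\<^sup>2) = N * (u * (1 + 2 * c\<^sup>2) - 4 * c\<^sup>2 - 2 * (1 + c)\<^sup>2)" .
  have F1: "S (\<lambda>a b x. F a b x * h a b) = N"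
    unfolding S_def N_def using Fx by (simp add: power2_eq_square flip: sum_distrib_right)
  have "S (\<lambda>a b x. F a b x * h a x) = S (\<lambda>a b x. F a x b * h a b)" by (rule Sswap)
  also have "\<dots> = 0" unfolding S_def using Fb by (simp add: sum.neutral flip: sum_distrib_right)
  finally have F2: "S (\<lambda>a b x. F a b x * h a x) = 0" .
  have "S (\<lambda>a b x. F a b x * h b x) = S (\<lambda>a b x. F b a x * h a x)" by (rule Sswap2)
  then have F3: "S (\<lambda>a b x. F a b x * h b x) = 0" using F2 Fs by simp
  have "S (\<lambda>a b x. F a b x * \<phi> a b x)
      = S (\<lambda>a b x. F a b x * h a b + c * (F a b x * h a x) + c * (F a b x * h b x))"
    by (rule Scong) (auto simp: \<phi>_def F0 algebra_simps)
  then have F\<phi>: "S (\<lambda>a b x. F a b x * \<phi> a b x) = N"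
    by (simp add: Sadd Scale F1 F2 F3)
  \<comment> \<open>Cauchy-Schwarz in quadratic form, with the multiplier t left free; it also
    covers the case that \<phi> vanishes.\<close>
  have "0 \<le> S (\<lambda>a b x. (F a b x - t * \<phi> a b x)\<^sup>2)"
    unfolding S_def by (intro sum_nonneg) auto
  also have "\<dots> = S (\<lambda>a b x. (F a b x)\<^sup>2 - 2 * t * (F a b x * \<phi> a b x) + t\<^sup>2 * (\<phi> a b x)\<^sup>2)"
    by (rule Scong) (simp add: power2_eq_square algebra_simps)
  also have "\<dots> = S (\<lambda>a b x. (F a b x)\<^sup>2) - 2 * t * N
      + t\<^sup>2 * (N * (u * (1 + 2 * c\<^sup>2) - 4 * c\<^sup>2 - 2 * (1 + c)\<^sup>2))"
    by (simp only: Sadd Sdiff Scale F\<phi> \<phi>2)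
  finally show ?thesis by (simp add: S_def)
qed

section \<open>The spectral gap of the switch operator\<close>

definition gap_bound :: "'a set \<Rightarrow> 'a \<Rightarrow> nat \<Rightarrow> bool" where
  "gap_bound V v n \<longleftrightarrow> (\<forall>f. partner_free V v f \<longrightarrow> inner V f (switch V v f) \<le> (2 * real n - 4) * inner V f f)"

lemma slice_sum_diff: "slice_sum V v (\<lambda>M. f M - g M) x = slice_sum V v f x - slice_sum V v g x"
  by (simp add: slice_sum_def algebra_simps sum_subtractf)

text \<open>Split g into its class averages k, a function of the partner of v, and a partner-free
  rest. J is symmetric and maps functions of the partner to such functions, so the mixed terms
  vanish. On k it is a complete graph matrix, whose quadratic form is the square of the total minus
  the sum of squares.\<close>

lemma gap_bound_general:
  assumes "finite V" "card V = 2 * n" "v \<in> V" "gap_bound V v n"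
  shows "inner V g (switch V v g) \<le> (2 * real n - 4) * inner V g g
    + ((\<Sum>x\<in>V - {v}. slice_sum V v g x)\<^sup>2 - (2 * real n - 3) * (\<Sum>x\<in>V - {v}. (slice_sum V v g x)\<^sup>2)) / odd_fact (n - 1)"
proof -
  define F where "F = slice_sum V v g"
  define d where "d = odd_fact (n - 1)"
  have d: "d > 0" by (simp add: d_def odd_fact_pos)
  define a where "a = (\<lambda>x. F x / d)"
  define b where "b = (\<lambda>x. \<Sum>y\<in>V - {v} - {x}. a y)"
  let ?k = "partner_fun V v a"
  let ?X = "((\<Sum>x\<in>V - {v}. F x)\<^sup>2 - (\<Sum>x\<in>V - {v}. (F x)\<^sup>2)) / d"
  let ?Y = "(\<Sum>x\<in>V - {v}. (F x)\<^sup>2) / d"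
  have ssk: "slice_sum V v ?k x = F x" if "x \<in> V - {v}" for x
    using slice_sum_partner_fun[OF assms(1-3) that, of a] d by (simp add: a_def d_def)
  have "partner_free V v (\<lambda>M. g M - ?k M)"
    using ssk by (simp add: partner_free_def slice_sum_diff F_def)
  then have gap: "inner V (\<lambda>M. g M - ?k M) (switch V v (\<lambda>M. g M - ?k M))
      \<le> (2 * real n - 4) * inner V (\<lambda>M. g M - ?k M) (\<lambda>M. g M - ?k M)"
    using assms(4) by (simp add: gap_bound_def)
  have Jk: "inner V f (switch V v ?k) = (\<Sum>x\<in>V - {v}. b x * slice_sum V v f x)" for f
    using switch_partner_fun[OF assms(1) _ assms(3), of _ a]
    by (simp add: inner_partner_fun[symmetric] b_def cong: inner_cong)
  have X: "(\<Sum>x\<in>V - {v}. b x * F x) = ?X"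
  proof -
    have "(\<Sum>x\<in>V - {v}. b x * F x) = (\<Sum>x\<in>V - {v}. F x * (\<Sum>y\<in>V - {v} - {x}. F y)) / d"
      by (simp add: b_def a_def sum_divide_distrib[symmetric] mult_ac)
    then show ?thesis using assms(1) by (simp only: sum_mult_others finite_Diff)
  qed
  have gk: "inner V g (switch V v ?k) = ?X" using X by (simp add: Jk F_def)
  have kk: "inner V ?k (switch V v ?k) = ?X" using X by (simp add: Jk ssk)
  have kg: "inner V ?k (switch V v g) = ?X" using switch_sym[OF assms(1), of ?k v g] gk by simp
  have Y: "inner V f ?k = ?Y" if "\<And>x. x \<in> V - {v} \<Longrightarrow> slice_sum V v f x = F x" for f
    using that by (simp add: inner_partner_fun a_def power2_eq_square sum_divide_distrib)
  have gk': "inner V g ?k = ?Y" "inner V ?k g = ?Y" "inner V ?k ?k = ?Y"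
    using Y[of g] Y[of ?k] ssk by (simp_all add: F_def inner_commute[of V ?k g])
  have "inner V g (switch V v g) - ?X \<le> (2 * real n - 4) * (inner V g g - ?Y)"
    using gap by (simp add: switch_linear inner_linear gk kk kg gk')
  moreover have "?X - (2 * real n - 4) * ?Y
      = ((\<Sum>x\<in>V - {v}. F x)\<^sup>2 - (2 * real n - 3) * (\<Sum>x\<in>V - {v}. (F x)\<^sup>2)) / d"
    using d by (simp add: field_simps)
  ultimately show ?thesis by (simp add: F_def d_def algebra_simps)
qed

lemma slice_sum_slice:
  assumes "finite V" "a \<in> V - {v}" "b \<in> V - {v} - {a}" "x \<notin> {a, b}"
  shows "slice_sum (V - {a, b}) v (slice a b f) x = (\<Sum>M\<in>matchings V. edge M a b * (edge M x v * f M))"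
proof -
  have "{x, v} \<noteq> {a, b}" using assms by auto
  then show ?thesis
    using assms unfolding slice_sum_def by (subst sum_edge_slice) (auto simp: slice_def edge_def)
qed

text \<open>Averaging the bound 2 n - 6 of the slices gives (2 n - 6) (2 n - 2) = (2 n - 4)^2 - 4,
  so there are four units of the squared norm of f to spare. The partner averages of the slices cost
  at most four times the squared norm of the edge part of f. What is left over is the residual
  \<open>r\<close>, kept in the statement for the equality case.\<close>

lemma gap_bound_step:
  assumes "finite V" "card V = 2 * n" "v \<in> V" "n \<ge> 3" "partner_free V v f"
    and gap: "\<And>a b. a \<in> V - {v} \<Longrightarrow> b \<in> V - {v} - {a} \<Longrightarrow> gap_bound (V - {a, b}) v (n - 1)"
  defines "r \<equiv> \<lambda>M. f M - inverse (4 * (real n - 1) * odd_fact (n - 2)) * edge_proj V v f M"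
  shows "(2 * real n - 4) * inner V f (switch V v f) \<le> (2 * real n - 4)\<^sup>2 * inner V f f - 4 * inner V r r"
proof -
  define U where "U = V - {v}"
  define h where "h = (\<lambda>a b. slice_sum V b f a)"
  \<comment> \<open>Up to degenerate triples, F a b x is the sum of f over the matchings containing
    both edges a b and x v. All that is used about it are its marginals: h a b over x, and zero over
    b.\<close>
  define F where "F = (\<lambda>a b x. if a = b \<or> x = a \<or> x = b then 0 else slice_sum (V - {a, b}) v (slice a b f) x)"
  define N where "N = (\<Sum>a\<in>U. \<Sum>b\<in>U. (h a b)\<^sup>2)"
  define d where "d = odd_fact (n - 2)"
  define T where "T = (\<Sum>a\<in>U. \<Sum>b\<in>U. \<Sum>x\<in>U. (F a b x)\<^sup>2)"
  have d: "d > 0" by (simp add: d_def odd_fact_pos)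
  have n3: "real n \<ge> 3" using assms(4) by simp
  have U: "finite U" "real (card U) = 2 * real n - 1"
    using assms(1-4) by (auto simp: U_def of_nat_diff)
  have hs: "h a b = h b a" and h0: "h a a = 0" for a b
    by (simp_all add: h_def slice_sum_self slice_sum_commute[of V b])
  have row: "(\<Sum>b\<in>U. h a b) = 0" if "a \<in> U" for a
    using partner_free_row[OF assms(1,3,5)] that by (simp add: U_def h_def)
  have W: "(V - {a, b}) - {v} = U - {a, b}" for a b by (auto simp: U_def)
  have Fx': "(\<Sum>x\<in>U - {a, b}. F a b x) = h a b" if "a \<in> U" "b \<in> U" "a \<noteq> b" for a b
  proof -
    have "(\<Sum>x\<in>U - {a, b}. F a b x) = (\<Sum>x\<in>V - {a, b} - {v}. slice_sum (V - {a, b}) v (slice a b f) x)"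
      unfolding W using that by (intro sum.cong refl) (auto simp: F_def)
    also have "\<dots> = (\<Sum>M\<in>matchings (V - {a, b}). slice a b f M)"
      using assms that by (intro sum_slice_sum) (auto simp: U_def)
    also have "\<dots> = h a b"
      using assms(1) that by (simp add: h_def slice_def U_def slice_sum_def sum_edge_slice)
    finally show ?thesis .
  qed
  have Fsum: "(\<Sum>x\<in>U. g (F a b x)) = (\<Sum>x\<in>U - {a, b}. g (F a b x))" if "g 0 = 0" for a b and g :: "real \<Rightarrow> real"
    using U(1) that by (intro sum.mono_neutral_right) (auto simp: F_def)
  have Fx: "(\<Sum>x\<in>U. F a b x) = h a b" if "a \<in> U" "b \<in> U" for a b
  proof (cases "a = b")
    case True
    then show ?thesis by (simp add: F_def h0)
  next
    case False
    then show ?thesis using Fsum[of "\<lambda>x. x"] Fx' that by simp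
  qed
  have Fs: "F a b x = F b a x" for a b x
    by (auto simp: F_def slice_def[abs_def] insert_commute)
  \<comment> \<open>Summing over b frees the partner of a, which cannot be v or x once x v is an
    edge; what remains is a partner class sum of f.\<close>
  have Fb: "(\<Sum>b\<in>U. F a b x) = 0" if "a \<in> U" "x \<in> U" for a x
  proof (cases "a = x")
    case True
    then show ?thesis by (simp add: F_def)
  next
    case False
    have "(\<Sum>b\<in>U. F a b x) = (\<Sum>b\<in>U - {a, x}. F a b x)"
      using U(1) by (intro sum.mono_neutral_right) (auto simp: F_def)
    also have "\<dots> = (\<Sum>b\<in>U - {a, x}. \<Sum>M\<in>matchings V. edge M a b * (edge M x v * f M))"
    proof (rule sum.cong[OF refl])
      fix b assume "b \<in> U - {a, x}"
      then show "F a b x = (\<Sum>M\<in>matchings V. edge M a b * (edge M x v * f M))"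
        using slice_sum_slice[OF assms(1), of a v b x f] False that by (auto simp: F_def U_def)
    qed
    also have "\<dots> = (\<Sum>M\<in>matchings V. \<Sum>b\<in>U - {a, x}. edge M a b * (edge M x v * f M))" by (rule sum.swap)
    also have "\<dots> = (\<Sum>M\<in>matchings V. edge M x v * f M)"
    proof (rule sum.cong[OF refl])
      fix M assume M: "M \<in> matchings V"
      have "U - {a, x} = V - {v, a, x}" by (auto simp: U_def)
      then have "(\<Sum>b\<in>U - {a, x}. edge M a b) = 1 - (\<Sum>b\<in>{v, a, x}. edge M a b)"
        using that assms sum_edge_diff[OF M, of a "{v, a, x}"] by (simp add: U_def)
      also have "(\<Sum>b\<in>{v, a, x}. edge M a b) = edge M a v + edge M a x"
        using that False by (auto simp: U_def edge_self[OF M])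
      finally have e: "(\<Sum>b\<in>U - {a, x}. edge M a b) = 1 - edge M a v - edge M a x" by simp
      have z: "edge M a v * edge M x v = 0" "edge M a x * edge M x v = 0"
        using edge_mult_cancel[OF M, of a x v] edge_mult_cancel[OF M, of a v x] False that
        by (auto simp: U_def edge_commute)
      have "(\<Sum>b\<in>U - {a, x}. edge M a b * (edge M x v * f M)) = (1 - edge M a v - edge M a x) * edge M x v * f M"
        by (simp add: e mult.assoc flip: sum_distrib_right)
      also have "\<dots> = edge M x v * f M"
        using z by (auto simp: left_diff_distrib)
      finally show "(\<Sum>b\<in>U - {a, x}. edge M a b * (edge M x v * f M)) = edge M x v * f M" .
    qed
    also have "\<dots> = 0" using assms(5) that by (simp add: partner_free_def U_def slice_sum_def)
    finally show ?thesis .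
  qed
  have F0: "F a b x = 0" if "a = b \<or> x = a \<or> x = b" for a b x using that by (auto simp: F_def)
  \<comment> \<open>The value c = 1 / (2 n - 4) minimises the quadratic polynomial in c that bounds
    the test function in \<open>triple_sum_bound\<close>; \<rho> is that minimum, and t = 1 / \<rho>
    is then the best multiplier.\<close>
  define \<rho> where "\<rho> = (2 * real n - 5) * (real n - 1) / (real n - 2)"
  define c where "c = 1 / (2 * real n - 4)"
  have \<rho>: "\<rho> > 0" using n3 by (simp add: \<rho>_def)
  have c1: "c * (2 * real n - 4) = 1" using n3 by (simp add: c_def)
  have "(2 * real n - 1) * (1 + 2 * c\<^sup>2) - 4 * c\<^sup>2 - 2 * (1 + c)\<^sup>2
      = (2 * real n - 3) - 4 * c + 2 * c * (c * (2 * real n - 4))"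
    by (simp add: power2_eq_square algebra_simps)
  also have "\<dots> = \<rho>"
  proof -
    define m where "m = real n - 2"
    then have "real n = m + 2" "m > 0" using n3 by auto
    then show ?thesis unfolding c1 by (simp add: c_def \<rho>_def field_simps)
  qed
  finally have \<rho>_eq: "(2 * real n - 1) * (1 + 2 * c\<^sup>2) - 4 * c\<^sup>2 - 2 * (1 + c)\<^sup>2 = \<rho>" .
  have "2 * inverse \<rho> * N - (inverse \<rho>)\<^sup>2 * (N * \<rho>) \<le> T"
    using triple_sum_bound[of U "2 * real n - 1" h F "inverse \<rho>" c, OF U hs h0 row F0 Fx Fb Fs]
    unfolding \<rho>_eq N_def[symmetric] T_def[symmetric] by simp
  moreover have "2 * inverse \<rho> * N - (inverse \<rho>)\<^sup>2 * (N * \<rho>) = N / \<rho>"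
    using \<rho> by (simp add: power2_eq_square field_simps)
  ultimately have T: "N / \<rho> \<le> T" by simp
  \<comment> \<open>The factor 2 n - 5 from the slice bound cancels the one in \<rho>. The loss N -
    N (n - 2) / (n - 1) = N / (n - 1), divided by d, is exactly four times the squared norm of the
    edge part of f.\<close>
  have "(2 * real n - 5) * (N / \<rho>) = N * ((real n - 2) / (real n - 1))"
    using n3 by (simp add: \<rho>_def)
  then have T2: "N * ((real n - 2) / (real n - 1)) \<le> (2 * real n - 5) * T"
    using T n3 mult_left_mono[of "N / \<rho>" T "2 * real n - 5"] by simp
  have "(2 * real n - 4) * inner V f (switch V v f)
      = (\<Sum>a\<in>U. \<Sum>b\<in>U - {a}. inner (V - {a, b}) (slice a b f) (switch (V - {a, b}) v (slice a b f)))"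
    using switch_average[OF assms(1-3), of f] by (simp add: U_def)
  also have "\<dots> \<le> (\<Sum>a\<in>U. \<Sum>b\<in>U - {a}. (2 * real n - 6) * inner (V - {a, b}) (slice a b f) (slice a b f)
      + ((h a b)\<^sup>2 - (2 * real n - 5) * (\<Sum>x\<in>U. (F a b x)\<^sup>2)) / d)"
  proof (intro sum_mono)
    fix a b assume ab: "a \<in> U" "b \<in> U - {a}"
    have sums: "(\<Sum>x\<in>V - {a, b} - {v}. slice_sum (V - {a, b}) v (slice a b f) x) = h a b"
      "(\<Sum>x\<in>V - {a, b} - {v}. (slice_sum (V - {a, b}) v (slice a b f) x)\<^sup>2) = (\<Sum>x\<in>U. (F a b x)\<^sup>2)"
      unfolding W Fsum[of "\<lambda>x. x\<^sup>2", simplified] Fx'[of a b, symmetric]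
      using ab Fx'[of a b] by (auto simp: F_def intro!: sum.cong simp flip: Fx')
    have "card (V - {a, b}) = 2 * (n - 1)"
      using ab assms by (intro card_remove_pair) (auto simp: U_def)
    then have "inner (V - {a, b}) (slice a b f) (switch (V - {a, b}) v (slice a b f))
       \<le> (2 * real (n - 1) - 4) * inner (V - {a, b}) (slice a b f) (slice a b f)
         + ((h a b)\<^sup>2 - (2 * real (n - 1) - 3) * (\<Sum>x\<in>U. (F a b x)\<^sup>2)) / odd_fact (n - 1 - 1)"
      using gap_bound_general[of "V - {a, b}" "n - 1" v "slice a b f", unfolded sums] gap[of a b] ab assms
      by (auto simp: U_def)
    then show "inner (V - {a, b}) (slice a b f) (switch (V - {a, b}) v (slice a b f))
       \<le> (2 * real n - 6) * inner (V - {a, b}) (slice a b f) (slice a b f)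
         + ((h a b)\<^sup>2 - (2 * real n - 5) * (\<Sum>x\<in>U. (F a b x)\<^sup>2)) / d"
      using assms(4) by (simp add: of_nat_diff d_def numeral_2_eq_2)
  qed
  also have "\<dots> = (2 * real n - 6) * ((2 * real n - 2) * inner V f f)
      + (\<Sum>a\<in>U. \<Sum>b\<in>U - {a}. ((h a b)\<^sup>2 - (2 * real n - 5) * (\<Sum>x\<in>U. (F a b x)\<^sup>2)) / d)"
    using inner_average[OF assms(1-3), of f] by (simp add: sum.distrib U_def flip: sum_distrib_left)
  also have "(\<Sum>a\<in>U. \<Sum>b\<in>U - {a}. ((h a b)\<^sup>2 - (2 * real n - 5) * (\<Sum>x\<in>U. (F a b x)\<^sup>2)) / d)
      = (\<Sum>a\<in>U. \<Sum>b\<in>U. ((h a b)\<^sup>2 - (2 * real n - 5) * (\<Sum>x\<in>U. (F a b x)\<^sup>2)) / d)"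
    using U(1) by (intro sum.cong refl sum.mono_neutral_left) (auto simp: h0 F0)
  also have "\<dots> = (N - (2 * real n - 5) * T) / d"
    by (simp add: N_def T_def sum_subtractf sum_distrib_left flip: sum_divide_distrib)
  also have "\<dots> \<le> (N - N * ((real n - 2) / (real n - 1))) / d"
    using T2 d by (intro divide_right_mono) auto
  also have "N - N * ((real n - 2) / (real n - 1)) = N / (real n - 1)"
    using n3 by (simp add: field_simps)
  also have "N / (real n - 1) / d = 4 * (inverse (4 * (real n - 1) * d) * N)"
    using n3 d by (simp add: field_simps)
  also have "inverse (4 * (real n - 1) * d) * N = inner V f f - inner V r r"
    using edge_proj_residual[OF assms(1,2) _ assms(3,5)] assms(4) by (simp add: r_def d_def N_def U_def h_def)
  finally show ?thesis by (simp add: power2_eq_square algebra_simps)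
qed

text \<open>The induction starts at n = 2, where partner classes are singletons and both sides are
  zero.\<close>

lemma gap_bound:
  assumes "finite V" "card V = 2 * n" "n \<ge> 2" "v \<in> V"
  shows "gap_bound V v n"
  using assms
proof (induction n arbitrary: V rule: less_induct)
  case (less n)
  show ?case unfolding gap_bound_def
  proof (intro allI impI)
    fix f assume f: "partner_free V v f"
    show "inner V f (switch V v f) \<le> (2 * real n - 4) * inner V f f"
    proof (cases "n = 2")
      case True
      then have "inner V f (switch V v f) = 0"
        using inner_small[of V n v f] less.prems f by (simp add: partner_free_def)
      then show ?thesis using True by simp
    next
      case False
      then have n: "n \<ge> 3" using less.prems by simp
      have "gap_bound (V - {a, b}) v (n - 1)" if "a \<in> V - {v}" "b \<in> V - {v} - {a}" for a b
        using that less.prems n by (intro less.IH card_remove_pair) auto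
      then have "(2 * real n - 4) * inner V f (switch V v f) \<le> (2 * real n - 4)\<^sup>2 * inner V f f"
        using gap_bound_step[OF less.prems(1,2,4) n f] inner_self_ge0 by (smt (verit))
      then show ?thesis using n by (simp add: power2_eq_square mult.assoc)
    qed
  qed
qed

section \<open>Equality in the gap bound and the norm of J\<close>

definition in_edge_span :: "'a set \<Rightarrow> ('a set set \<Rightarrow> real) \<Rightarrow> bool" where
  "in_edge_span V f \<longleftrightarrow> (\<exists>w. \<forall>M\<in>matchings V. f M = (\<Sum>a\<in>V. \<Sum>b\<in>V. w a b * edge M a b))"

lemma in_edge_span_edge_proj: 
  assumes "finite V" "v \<in> V"
  shows "in_edge_span V (\<lambda>M. s * edge_proj V v f M)"
  unfolding in_edge_span_def
proof (intro exI ballI)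
  fix M assume "M \<in> matchings V"
  let ?w = "\<lambda>a b. if a \<notin> {v} then if b \<notin> {v} then s * slice_sum V b f a else 0 else 0"
  have "(\<Sum>a\<in>V. \<Sum>b\<in>V. ?w a b * edge M a b)
      = (\<Sum>a\<in>V. if a \<notin> {v} then (\<Sum>b\<in>V. if b \<notin> {v} then s * slice_sum V b f a * edge M a b else 0) else 0)"
    by (intro sum.cong refl) (auto intro!: sum.cong)
  also have "\<dots> = s * edge_proj V v f M"
    using assms(1) by (simp only: sum_if_notin) (simp add: edge_proj_def sum_distrib_left mult_ac)
  finally show "s * edge_proj V v f M = (\<Sum>a\<in>V. \<Sum>b\<in>V. ?w a b * edge M a b)" by simp
qed

text \<open>Equality leaves no room for the residual of \<open>gap_bound_step\<close>, so f is a
  multiple of its edge projection.\<close>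

lemma gap_bound_equality:
  assumes "finite V" "card V = 2 * n" "v \<in> V" "n \<ge> 3" "partner_free V v f"
    and "inner V f (switch V v f) \<ge> (2 * real n - 4) * inner V f f"
  shows "in_edge_span V f"
proof -
  define s where "s = inverse (4 * (real n - 1) * odd_fact (n - 2))"
  define r where "r = (\<lambda>M. f M - s * edge_proj V v f M)"
  have "gap_bound (V - {a, b}) v (n - 1)" if "a \<in> V - {v}" "b \<in> V - {v} - {a}" for a b
    using that assms by (intro gap_bound card_remove_pair) auto
  then have "(2 * real n - 4) * inner V f (switch V v f) \<le> (2 * real n - 4)\<^sup>2 * inner V f f - 4 * inner V r r"
    using gap_bound_step[OF assms(1-5)] by (simp add: r_def s_def)
  moreover have "(2 * real n - 4)\<^sup>2 * inner V f f \<le> (2 * real n - 4) * inner V f (switch V v f)"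
    using mult_left_mono[OF assms(6), of "2 * real n - 4"] assms(4) by (simp add: power2_eq_square mult.assoc)
  ultimately have "inner V r r = 0" using inner_self_ge0[of V r] by linarith
  then have "f M = s * edge_proj V v f M" if "M \<in> matchings V" for M
    using inner_self_eq0[OF assms(1) _ that, of r] by (simp add: r_def)
  then show ?thesis
    using in_edge_span_edge_proj[OF assms(1,3), of s f] by (simp add: in_edge_span_def)
qed

lemma partner_free_switch:
  assumes "finite V" "v \<in> V" "partner_free V v f"
  shows "partner_free V v (switch V v f)"
  using assms by (simp add: partner_free_def slice_sum_switch)

text \<open>For a symmetric operator with spectrum in \<open>[a, c]\<close>, \<open>(c - J) (J - a)\<close> is positive
  semidefinite, because \<open>c - a\<close> times it is
  \<open>(c - J) (J - a) (c - J) + (J - a) (c - J) (J - a)\<close>.\<close>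

lemma switch_norm:
  assumes "finite V" "card V = 2 * n" "v \<in> V" "n \<ge> 2" "partner_free V v f"
  shows "inner V (switch V v f) (switch V v f)
    \<le> (real n - 3) * inner V f (switch V v f) + (real n - 1) * (2 * real n - 4) * inner V f f"
proof -
  define c where "c = 2 * real n - 4"
  define a where "a = - (real n - 1)"
  define u where "u = (\<lambda>M. c * f M - switch V v f M)"
  define w where "w = (\<lambda>M. switch V v f M - a * f M)"
  \<comment> \<open>The upper bound is available on partner-free functions only, and w stays among
    them; the lower bound used for u holds for every function.\<close>
  have "partner_free V v w"
    using assms(5) partner_free_switch[OF assms(1,3,5)]
    by (simp add: partner_free_def w_def slice_sum_diff) (simp add: slice_sum_def mult.left_commute flip: sum_distrib_left)
  then have w: "inner V w (switch V v w) \<le> c * inner V w w"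
    using gap_bound[OF assms(1,2,4,3)] by (simp add: gap_bound_def c_def)
  have u: "inner V u (switch V v u) \<ge> a * inner V u u"
    using switch_lower[OF assms(1-3), of u] by (simp add: a_def)
  define p q r s where "p = inner V f f" and "q = inner V f (switch V v f)"
    and "r = inner V (switch V v f) (switch V v f)" and "s = inner V (switch V v f) (switch V v (switch V v f))"
  have e: "inner V f (switch V v (switch V v f)) = r" using switch_sym[OF assms(1), of f v "switch V v f"] by (simp add: r_def)
  have e2: "inner V (switch V v f) f = q" by (simp add: q_def inner_commute)
  have "a * (c\<^sup>2 * p - 2 * c * q + r) \<le> c\<^sup>2 * q - 2 * c * r + s"
    using u by (simp add: u_def switch_linear inner_linear e e2 power2_eq_square algebra_simps flip: p_def q_def r_def s_def)
  moreover have "s - 2 * a * r + a\<^sup>2 * q \<le> c * (r - 2 * a * q + a\<^sup>2 * p)"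
    using w by (simp add: w_def switch_linear inner_linear e e2 power2_eq_square algebra_simps flip: p_def q_def r_def s_def)
  ultimately have "0 \<le> (c - a) * ((c + a) * q - a * c * p - r)"
    by (simp add: power2_eq_square algebra_simps)
  moreover have "c - a > 0" using assms(4) by (simp add: c_def a_def)
  ultimately have "0 \<le> (c + a) * q - a * c * p - r" by (simp add: zero_le_mult_iff)
  then show ?thesis by (simp add: c_def a_def p_def q_def r_def algebra_simps)
qed

section \<open>Hamiltonian pairs of matchings and the ratio bound\<close>

text \<open>\<open>ham_op k V f M\<close> sums \<open>f\<close> over the matchings whose union with \<open>M\<close> is a Hamiltonian cycle, for
  \<open>card V = 2 * k + 2\<close>. Only disjointness from \<open>M\<close> is needed later, and it fails for \<open>k = 0\<close>.\<close>

definition slicewise :: "('a set \<Rightarrow> ('a set set \<Rightarrow> real) \<Rightarrow> 'a set set \<Rightarrow> real) \<Rightarrow> 'a set \<Rightarrow> 'a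
    \<Rightarrow> ('a set set \<Rightarrow> real) \<Rightarrow> 'a set set \<Rightarrow> real" where
  "slicewise K V v f M = (\<Sum>x\<in>V - {v}. edge M x v * K (V - {x, v}) (slice x v f) (M - {{x, v}}))"

definition base_vertex :: "'a set \<Rightarrow> 'a" where "base_vertex V = (SOME v. v \<in> V)"

primrec ham_op :: "nat \<Rightarrow> 'a set \<Rightarrow> ('a set set \<Rightarrow> real) \<Rightarrow> 'a set set \<Rightarrow> real" where
  "ham_op 0 V f = f"
| "ham_op (Suc k) V f = slicewise (ham_op k) V (base_vertex V) (switch V (base_vertex V) f)"

lemma base_vertex_in: "V \<noteq> {} \<Longrightarrow> base_vertex V \<in> V"
  by (simp add: base_vertex_def some_in_eq)

lemma slicewise_at:
  assumes "finite V" "M \<in> matchings V" "{x, v} \<in> M"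
  shows "slicewise K V v f M = K (V - {x, v}) (slice x v f) (M - {{x, v}})"
  using partner_fun_at[OF assms, of "\<lambda>x. K (V - {x, v}) (slice x v f) (M - {{x, v}})"] by (simp add: slicewise_def partner_fun_def)

lemma slice_slicewise:
  assumes "finite V" "x \<in> V" "v \<in> V" "x \<noteq> v" "M \<in> matchings (V - {x, v})"
  shows "slice x v (slicewise K V v f) M = K (V - {x, v}) (slice x v f) M"
  using slicewise_at[OF assms(1) matchings_insert(1)[OF assms(2-5)], of x v K f] matchings_insert(2)[OF assms(2-5)]
  by (simp add: slice_def[of x v "slicewise K V v f"])

lemma slice_linear:
  "slice a b (\<lambda>M. f M + g M) = (\<lambda>M. slice a b f M + slice a b g M)"
  "slice a b (\<lambda>M. f M - g M) = (\<lambda>M. slice a b f M - slice a b g M)"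
  "slice a b (\<lambda>M. c * f M) = (\<lambda>M. c * slice a b f M)"
  by (simp_all add: slice_def fun_eq_iff)

lemma ham_op_diff: "ham_op k V (\<lambda>M. f M - g M) = (\<lambda>M. ham_op k V f M - ham_op k V g M)"
proof (induction k arbitrary: V f g)
  case (Suc k)
  show ?case
    by (rule ext) (simp add: switch_linear slice_linear slicewise_def Suc.IH right_diff_distrib sum_subtractf)
qed simp

lemma ham_op_scale: "ham_op k V (\<lambda>M. c * f M) = (\<lambda>M. c * ham_op k V f M)"
proof (induction k arbitrary: V f)
  case (Suc k)
  show ?case
    by (rule ext) (simp add: switch_linear slice_linear slicewise_def Suc.IH sum_distrib_left mult.left_commute)
qed simp

lemmas ham_op_linear = ham_op_diff ham_op_scale

lemma card_even_nonempty: "card V = 2 * Suc k \<Longrightarrow> V \<noteq> {}"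
  by auto

lemma ham_op_cong:
  assumes "finite V" "card V = 2 * Suc k" "\<And>N. N \<in> matchings V \<Longrightarrow> f N = g N" "M \<in> matchings V"
  shows "ham_op k V f M = ham_op k V g M"
  using assms
proof (induction k arbitrary: V f g M)
  case 0
  then show ?case by simp
next
  case (Suc k)
  define v where "v = base_vertex V"
  have v: "v \<in> V" using base_vertex_in card_even_nonempty Suc.prems(2) by (metis v_def)
  obtain x where x: "x \<in> V" "x \<noteq> v" "{v, x} \<in> M" using matchings_partner[OF Suc.prems(4) v] .
  then have xv: "{x, v} \<in> M" by (simp add: insert_commute)
  have "ham_op k (V - {x, v}) (slice x v (switch V v f)) (M - {{x, v}}) = ham_op k (V - {x, v}) (slice x v (switch V v g)) (M - {{x, v}})"
  proof (rule Suc.IH)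
    show "card (V - {x, v}) = 2 * Suc k"
      using card_remove_pair[OF Suc.prems(1,2)] x v by simp
    show "slice x v (switch V v f) N = slice x v (switch V v g) N" if "N \<in> matchings (V - {x, v})" for N
      unfolding slice_def using matchings_insert(1)[OF x(1) v x(2) that] Suc.prems(3) by (rule switch_cong)
  qed (use Suc.prems xv matchings_remove in auto)
  then show ?case using Suc.prems by (simp add: slicewise_at[OF _ _ xv[unfolded v_def]] v_def)
qed

section \<open>Disjointness and the support of H\<close>

text \<open>After the switch v is matched to y, no longer to x. The edge arriving at x could lie in
  M only if it were x v, but v is taken. Edges meeting neither x nor y do not move and are covered
  by the last assumption.\<close>

lemma swap_pts_disjoint:
  assumes "M \<in> matchings V" "N \<in> matchings V" "{x, v} \<in> M" "{x, v} \<in> N" "y \<noteq> x" "y \<noteq> v"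
    and "\<And>e. e \<in> M \<Longrightarrow> e \<in> N \<Longrightarrow> x \<in> e \<or> y \<in> e"
  shows "swap_pts x y N \<inter> M = {}"
proof (rule ccontr)
  assume "swap_pts x y N \<inter> M \<noteq> {}"
  then obtain e where e: "e \<in> N" "transpose x y ` e \<in> M" by (auto simp: swap_pts_def)
  have xv: "x \<noteq> v" using matchings_pairD(3)[OF assms(1,3)] .
  consider "x \<in> e" | "x \<notin> e" "y \<in> e" | "x \<notin> e" "y \<notin> e" by blast
  then show False
  proof cases
    case 1
    then have "e = {x, v}" using matchings_edge_unique[OF assms(2) e(1) assms(4), of x] by simp
    then have "transpose x y ` e = {v, y}" using assms(6) xv by (auto simp: transpose_def)
    then have "{v, y} \<in> M" "{v, x} \<in> M" using e(2) assms(3) by (auto simp: insert_commute)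
    then show False using matchings_pair_unique[OF assms(1)] assms(5) by blast
  next
    case 2
    obtain z where z: "e = {y, z}" "z \<noteq> y"
      using 2 matchings_edgeD(2)[OF assms(2) e(1)] by (auto simp: card_2_iff)
    then have "transpose x y ` e = {x, z}" using 2 by (auto simp: transpose_def)
    then have "{x, z} \<in> M" using e(2) by simp
    then have "z = v" using matchings_pair_unique[OF assms(1) _ assms(3)] by blast
    then have "e = {x, v}" using matchings_edge_unique[OF assms(2) e(1) assms(4), of v] z by simp
    then show False using 2 by simp
  next
    case 3
    then have "transpose x y ` e = e" by (auto simp: transpose_def image_iff)
    then show False using assms(7)[of e] e 3 by simp
  qed
qed

text \<open>This is where H becomes a weighting of the derangement graph: the row of M sees only
  matchings disjoint from M. A matching that avoids the remainder of M on the smaller vertex set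
  becomes disjoint from all of M after the switch.\<close>

lemma ham_op_disjoint_support:
  assumes "finite V" "card V = 2 * Suc (Suc k)" "M \<in> matchings V"
    and "\<And>N. N \<in> matchings V \<Longrightarrow> N \<inter> M = {} \<Longrightarrow> f N = 0"
  shows "ham_op (Suc k) V f M = 0"
  using assms
proof (induction k arbitrary: V f M)
  case (0 V f M)
  define v where "v = base_vertex V"
  have v: "v \<in> V" using base_vertex_in card_even_nonempty 0(2) by (metis v_def)
  obtain x where x: "x \<in> V" "x \<noteq> v" "{v, x} \<in> M" using matchings_partner[OF 0(3) v] .
  then have xv: "{x, v} \<in> M" by (simp add: insert_commute)
  have "f (swap_pts x y M) = 0" if y: "y \<in> V - {v} - {x}" for y
  proof (rule 0(4))
    show "swap_pts x y M \<in> matchings V" using x y 0 by (intro swap_pts_matchings) auto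
    show "swap_pts x y M \<inter> M = {}"
    proof (rule swap_pts_disjoint[OF 0(3,3) xv xv])
      fix e assume e: "e \<in> M"
      show "x \<in> e \<or> y \<in> e"
      proof (rule ccontr)
        assume no: "\<not> (x \<in> e \<or> y \<in> e)"
        have "v \<notin> e" using matchings_edge_unique[OF 0(3) e xv, of v] no by auto
        \<comment> \<open>On four points, an edge avoiding x, y and v would require a fifth.\<close>
        then have "e \<union> {x, y, v} \<subseteq> V" "e \<inter> {x, y, v} = {}" using matchings_edgeD(1)[OF 0(3) e] x y v no by auto
        moreover have "card e = 2" "card {x, y, v} = 3" using matchings_edgeD(2)[OF 0(3) e] x y by auto
        ultimately have "5 \<le> card V"
          using card_Un_disjoint[of e "{x, y, v}"] card_mono[OF 0(1), of "e \<union> {x, y, v}"]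
            finite_subset[OF matchings_edgeD(1)[OF 0(3) e] 0(1)] by simp
        then show False using 0(2) by simp
      qed
    qed (use y in auto)
  qed
  then have "switch V v f M = 0" by (simp add: switch_at[OF 0(1,3) xv])
  then show ?case
    by (simp add: slicewise_at[OF 0(1,3) xv[unfolded v_def]] slice_def insert_absorb[OF xv[unfolded v_def]] v_def)
next
  case (Suc k V f M)
  define v where "v = base_vertex V"
  have v: "v \<in> V" using base_vertex_in card_even_nonempty Suc.prems(2) by (metis v_def)
  obtain x where x: "x \<in> V" "x \<noteq> v" "{v, x} \<in> M" using matchings_partner[OF Suc.prems(3) v] .
  then have xv: "{x, v} \<in> M" by (simp add: insert_commute)
  have "ham_op (Suc k) (V - {x, v}) (slice x v (switch V v f)) (M - {{x, v}}) = 0"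
  proof (rule Suc.IH)
    show "finite (V - {x, v})" using Suc.prems(1) by simp
    show "card (V - {x, v}) = 2 * Suc (Suc k)"
      using card_remove_pair[OF Suc.prems(1,2)] x v by simp
    show "M - {{x, v}} \<in> matchings (V - {x, v})" using matchings_remove Suc.prems(3) xv .
    fix N assume N: "N \<in> matchings (V - {x, v})" "N \<inter> (M - {{x, v}}) = {}"
    have N': "insert {x, v} N \<in> matchings V" "{x, v} \<in> insert {x, v} N"
      using matchings_insert(1)[OF x(1) v x(2) N(1)] by auto
    have "f (swap_pts x y (insert {x, v} N)) = 0" if y: "y \<in> V - {v} - {x}" for y
    proof (rule Suc.prems(4))
      show "swap_pts x y (insert {x, v} N) \<in> matchings V" using x y N' by (intro swap_pts_matchings) auto
      show "swap_pts x y (insert {x, v} N) \<inter> M = {}"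
        using y N(2) by (intro swap_pts_disjoint[OF Suc.prems(3) N'(1) xv N'(2)]) auto
    qed
    then show "slice x v (switch V v f) N = 0"
      by (simp add: slice_def switch_at[OF Suc.prems(1) N'])
  qed
  then show ?case by (simp add: slicewise_at[OF Suc.prems(1,3) xv[unfolded v_def]] v_def del: ham_op.simps(2) add: ham_op.simps(2)[of "Suc k"])
qed

section \<open>Row and column sums of H\<close>

text \<open>The double factorial (2 k)!!, the number of matchings that close a given one to a
  Hamiltonian cycle on 2 k + 2 points, for positive k.\<close>

definition ham_deg :: "nat \<Rightarrow> real" where "ham_deg k = 2 ^ k * fact k"

lemma ham_deg_simps: "ham_deg 0 = 1" "ham_deg (Suc k) = 2 * (real k + 1) * ham_deg k"
  by (simp_all add: ham_deg_def algebra_simps)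

lemma ham_deg_pos: "ham_deg k > 0" by (simp add: ham_deg_def)

lemma ham_op_const:
  assumes "finite V" "card V = 2 * Suc k" "M \<in> matchings V"
  shows "ham_op k V (\<lambda>_. c) M = ham_deg k * c"
  using assms
proof (induction k arbitrary: V M c)
  case 0
  then show ?case by (simp add: ham_deg_simps)
next
  case (Suc k)
  define v where "v = base_vertex V"
  have v: "v \<in> V" using base_vertex_in card_even_nonempty Suc.prems(2) by (metis v_def)
  obtain x where x: "x \<in> V" "x \<noteq> v" "{v, x} \<in> M" using matchings_partner[OF Suc.prems(3) v] .
  then have xv: "{x, v} \<in> M" by (simp add: insert_commute)
  have cW: "card (V - {x, v}) = 2 * Suc k" using card_remove_pair[OF Suc.prems(1,2)] x v by simp
  have "V - {v} - {x} = V - {x, v}" by auto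
  then have cU: "real (card (V - {v} - {x})) = 2 * (real k + 1)" using cW by simp
  have "ham_op k (V - {x, v}) (slice x v (switch V v (\<lambda>_. c))) (M - {{x, v}})
      = ham_op k (V - {x, v}) (\<lambda>_. 2 * (real k + 1) * c) (M - {{x, v}})"
  proof (rule ham_op_cong[OF _ cW])
    fix N assume "N \<in> matchings (V - {x, v})"
    then have "insert {x, v} N \<in> matchings V" using matchings_insert(1)[OF x(1) v x(2)] by simp
    then show "slice x v (switch V v (\<lambda>_. c)) N = 2 * (real k + 1) * c"
      by (simp only: slice_def switch_at[OF Suc.prems(1) _ insertI1] sum_constant cU)
  qed (use Suc.prems xv matchings_remove in auto)
  also have "\<dots> = ham_deg k * (2 * (real k + 1) * c)"
    using Suc.prems xv matchings_remove by (intro Suc.IH cW) auto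
  finally show ?case
    by (simp add: slicewise_at[OF Suc.prems(1,3) xv[unfolded v_def]] v_def ham_deg_simps mult_ac)
qed

lemma sum_slicewise:
  assumes "finite V" "v \<in> V" and K: "\<And>x. x \<in> V - {v} \<Longrightarrow>
      (\<Sum>M\<in>matchings (V - {x, v}). K (V - {x, v}) (slice x v f) M) = d * (\<Sum>M\<in>matchings (V - {x, v}). slice x v f M)"
  shows "x \<in> V - {v} \<Longrightarrow> slice_sum V v (slicewise K V v f) x = d * slice_sum V v f x"
    and "(\<Sum>M\<in>matchings V. slicewise K V v f M) = d * (\<Sum>M\<in>matchings V. f M)"
proof -
  show *: "slice_sum V v (slicewise K V v f) x = d * slice_sum V v f x" if x: "x \<in> V - {v}" for x
  proof -
    have "slice_sum V v (slicewise K V v f) x = (\<Sum>M\<in>matchings (V - {x, v}). slice x v (slicewise K V v f) M)"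
      using slice_sum_edge[OF assms(1,2) x] by (simp add: slice_def)
    also have "\<dots> = (\<Sum>M\<in>matchings (V - {x, v}). K (V - {x, v}) (slice x v f) M)"
      using assms(1,2) x by (intro sum.cong refl slice_slicewise) auto
    also have "\<dots> = d * slice_sum V v f x" using K[OF x] slice_sum_edge[OF assms(1,2) x, of f] by (simp add: slice_def)
    finally show ?thesis .
  qed
  show "(\<Sum>M\<in>matchings V. slicewise K V v f M) = d * (\<Sum>M\<in>matchings V. f M)"
    using * by (simp add: sum_distrib_left flip: sum_slice_sum[OF assms(1,2)])
qed

lemma sum_switch:
  assumes "finite V" "card V = 2 * n" "v \<in> V"
  shows "(\<Sum>M\<in>matchings V. switch V v f M) = (2 * real n - 2) * (\<Sum>M\<in>matchings V. f M)"
proof -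
  have n: "n \<ge> 1" using assms card_gt_0_iff[of V] by auto
  have "(\<Sum>M\<in>matchings V. switch V v f M) = (\<Sum>x\<in>V - {v}. \<Sum>y\<in>V - {v} - {x}. slice_sum V v f y)"
    using assms by (simp add: slice_sum_switch flip: sum_slice_sum)
  also have "\<dots> = (\<Sum>x\<in>V - {v}. (\<Sum>y\<in>V - {v}. slice_sum V v f y) - slice_sum V v f x)"
    using assms by (intro sum.cong refl) (simp add: sum_diff1)
  also have "\<dots> = (real (card (V - {v})) - 1) * (\<Sum>y\<in>V - {v}. slice_sum V v f y)"
    by (simp add: sum_subtractf algebra_simps)
  also have "real (card (V - {v})) - 1 = 2 * real n - 2"
    using assms n by (simp add: of_nat_diff)
  finally show ?thesis using assms by (simp add: sum_slice_sum)
qed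

text \<open>Column sums, complementing the row sums in \<open>ham_op_const\<close>: slices multiply
  each partner class sum by the smaller degree, and J multiplies the total by its own
  degree.\<close>

lemma sum_ham_op:
  assumes "finite V" "card V = 2 * Suc k"
  shows "(\<Sum>M\<in>matchings V. ham_op k V f M) = ham_deg k * (\<Sum>M\<in>matchings V. f M)"
  using assms
proof (induction k arbitrary: V f)
  case 0
  then show ?case by (simp add: ham_deg_simps)
next
  case (Suc k)
  define v where "v = base_vertex V"
  have v: "v \<in> V" using base_vertex_in card_even_nonempty Suc.prems(2) by (metis v_def)
  have "(\<Sum>M\<in>matchings V. slicewise (ham_op k) V v (switch V v f) M) = ham_deg k * (\<Sum>M\<in>matchings V. switch V v f M)"
    using Suc.prems v card_remove_pair[OF Suc.prems]
    by (intro sum_slicewise(2) Suc.IH) auto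
  then show ?case
    using sum_switch[OF Suc.prems v, of f] by (simp add: ham_deg_simps flip: v_def)
qed

section \<open>The norm of H on functions with sum zero\<close>

lemma inner_slices:
  assumes "finite V" "v \<in> V"
  shows "inner V f g = (\<Sum>x\<in>V - {v}. inner (V - {x, v}) (slice x v f) (slice x v g))"
  unfolding inner_def slice_def using sum_matchings_slices[OF assms] by simp

text \<open>Inserting the gap bound into \<open>switch_norm\<close> gives ((n - 3) + (n - 1)) (2 n -
  4) = (2 n - 4)^2. At n = 2 the coefficient n - 3 is negative, but there partner-free functions
  vanish.\<close>

lemma switch_norm_le:
  assumes "finite V" "card V = 2 * n" "v \<in> V" "n \<ge> 2" "partner_free V v f"
  shows "inner V (switch V v f) (switch V v f) \<le> (2 * real n - 4)\<^sup>2 * inner V f f"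
proof (cases "n = 2")
  case True
  then show ?thesis
    using inner_small[of V n v "switch V v f"] partner_free_switch[OF assms(1,3,5)] assms by (simp add: partner_free_def)
next
  case False
  have "inner V f (switch V v f) \<le> (2 * real n - 4) * inner V f f"
    using gap_bound[OF assms(1,2,4,3)] assms(5) by (simp add: gap_bound_def)
  then have "(real n - 3) * inner V f (switch V v f) \<le> (real n - 3) * ((2 * real n - 4) * inner V f f)"
    using False assms(4) by (intro mult_left_mono) auto
  with switch_norm[OF assms] show ?thesis by (simp add: power2_eq_square algebra_simps)
qed

text \<open>The orthogonal projection of f onto the functions of the partner of v: class sums
  divided by the class size (2 n - 3)!!.\<close>

definition partner_part :: "'a set \<Rightarrow> 'a \<Rightarrow> nat \<Rightarrow> ('a set set \<Rightarrow> real) \<Rightarrow> 'a set set \<Rightarrow> real" where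
  "partner_part V v n f = partner_fun V v (\<lambda>x. slice_sum V v f x / odd_fact (n - 1))"

lemma partner_part_partner_free:
  assumes "finite V" "card V = 2 * n" "v \<in> V"
  shows "partner_free V v (\<lambda>M. f M - partner_part V v n f M)"
  using slice_sum_partner_fun[OF assms] odd_fact_pos[of "n - 1"] by (simp add: partner_free_def slice_sum_diff partner_part_def)

lemma inner_partner_part_partner_free:
  assumes "partner_free V v g"
  shows "inner V g (partner_part V v n f) = 0"
  using assms by (simp add: partner_part_def inner_partner_fun partner_free_def)

text \<open>The class averages of f sum to zero, so the complete graph matrix of J acts on them as -
  1. The result is constant on each partner class, where the remaining factor of H multiplies by its
  degree. These are explicit eigenfunctions for - (2 n - 4)!!.\<close>

lemma ham_op_partner_part:
  assumes "finite V" "card V = 2 * Suc (Suc k)" "(\<Sum>M\<in>matchings V. f M) = 0" "M \<in> matchings V"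
  defines "f0 \<equiv> partner_part V (base_vertex V) (Suc (Suc k)) f"
  shows "ham_op (Suc k) V f0 M = - ham_deg k * f0 M"
proof -
  define v where "v = base_vertex V"
  define a where "a = (\<lambda>x. slice_sum V v f x / odd_fact (Suc k))"
  have v: "v \<in> V" using base_vertex_in card_even_nonempty assms(2) by (metis v_def)
  have f0: "f0 = partner_fun V v a" by (simp add: f0_def partner_part_def a_def v_def)
  obtain x where x: "x \<in> V" "x \<noteq> v" "{v, x} \<in> M" using matchings_partner[OF assms(4) v] .
  then have xv: "{x, v} \<in> M" by (simp add: insert_commute)
  have cW: "card (V - {x, v}) = 2 * Suc k" using card_remove_pair[OF assms(1,2)] x v by simp
  have "(\<Sum>y\<in>V - {v}. a y) = 0"
    using sum_slice_sum[OF assms(1) v, of f] assms(3) by (simp add: a_def flip: sum_divide_distrib)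
  then have a: "(\<Sum>y\<in>V - {v} - {x}. a y) = - a x" if "x \<in> V - {v}" for x
    using assms(1) that by (simp add: sum_diff1)
  have "ham_op k (V - {x, v}) (slice x v (switch V v f0)) (M - {{x, v}}) = ham_op k (V - {x, v}) (\<lambda>_. - a x) (M - {{x, v}})"
  proof (rule ham_op_cong[OF _ cW])
    fix N assume "N \<in> matchings (V - {x, v})"
    then have N: "insert {x, v} N \<in> matchings V" using matchings_insert(1)[OF x(1) v x(2)] by simp
    show "slice x v (switch V v f0) N = - a x"
      using a[of x] x by (simp add: slice_def f0 switch_partner_fun[OF assms(1) N v] partner_fun_at[OF assms(1) N insertI1])
  qed (use assms xv matchings_remove in auto)
  also have "\<dots> = ham_deg k * (- a x)"
    using assms xv matchings_remove by (intro ham_op_const cW) auto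
  also have "a x = f0 M" by (simp add: f0 partner_fun_at[OF assms(1,4) xv])
  finally show ?thesis by (simp add: slicewise_at[OF assms(1,4) xv[unfolded v_def]] v_def)
qed

lemma partner_free_slicewise:
  assumes "finite V" "card V = 2 * Suc (Suc k)" "v \<in> V" "partner_free V v f"
  shows "partner_free V v (slicewise (ham_op k) V v f)"
  using sum_slicewise(1)[OF assms(1,3), of "ham_op k" f "ham_deg k"] assms card_remove_pair[OF assms(1,2)]
  by (simp add: partner_free_def sum_ham_op)

text \<open>The partner classes decompose the function space orthogonally, and partner-freeness says
  precisely that every slice has sum zero, the hypothesis under which \<open>K\<close> is
  bounded.\<close>

lemma slicewise_norm:
  assumes "finite V" "v \<in> V" "partner_free V v g"
    and K: "\<And>x f. x \<in> V - {v} \<Longrightarrow> (\<Sum>M\<in>matchings (V - {x, v}). f M) = 0 \<Longrightarrow>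
        inner (V - {x, v}) (K (V - {x, v}) f) (K (V - {x, v}) f) \<le> r * inner (V - {x, v}) f f"
  shows "inner V (slicewise K V v g) (slicewise K V v g) \<le> r * inner V g g"
proof -
  have "inner V (slicewise K V v g) (slicewise K V v g)
      = (\<Sum>x\<in>V - {v}. inner (V - {x, v}) (K (V - {x, v}) (slice x v g)) (K (V - {x, v}) (slice x v g)))"
    unfolding inner_slices[OF assms(1,2)]
    using assms(1,2) by (intro sum.cong refl inner_cong slice_slicewise) auto
  also have "\<dots> \<le> (\<Sum>x\<in>V - {v}. r * inner (V - {x, v}) (slice x v g) (slice x v g))"
  proof (intro sum_mono K)
    fix x assume x: "x \<in> V - {v}"
    then show "(\<Sum>M\<in>matchings (V - {x, v}). slice x v g M) = 0"
      using assms(3) slice_sum_edge[OF assms(1,2) x, of g] by (simp add: partner_free_def slice_def)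
  qed
  also have "\<dots> = r * inner V g g" by (simp add: inner_slices[OF assms(1,2)] sum_distrib_left)
  finally show ?thesis .
qed

text \<open>Split off the functions of the partner of the base vertex. H scales them by - (2 k)!!
  and maps the partner-free rest to partner-free functions, so the two images are orthogonal. On the
  rest J contributes the factor 2 k and the slices, by induction, (2 k - 2)!!.\<close>

lemma ham_op_norm:
  assumes "finite V" "card V = 2 * Suc k" "(\<Sum>M\<in>matchings V. f M) = 0"
  shows "inner V (ham_op k V f) (ham_op k V f) \<le> (ham_deg (k - 1))\<^sup>2 * inner V f f"
  using assms
proof (induction k arbitrary: V f)
  case 0
  then show ?case by (simp add: ham_deg_simps)
next
  case (Suc k)
  define v where "v = base_vertex V"
  define n where "n = Suc (Suc k)"
  have n: "card V = 2 * n" "n \<ge> 2" using Suc.prems by (auto simp: n_def)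
  have v: "v \<in> V" using base_vertex_in card_even_nonempty Suc.prems(2) by (metis v_def)
  define f0 where "f0 = partner_part V v n f"
  define f1 where "f1 = (\<lambda>M. f M - f0 M)"
  have f1: "partner_free V v f1" unfolding f1_def f0_def by (rule partner_part_partner_free[OF Suc.prems(1) n(1) v])
  have ham_op: "ham_op (Suc k) V g = slicewise (ham_op k) V v (switch V v g)" for g by (simp add: v_def)
  have Jf1: "partner_free V v (switch V v f1)" by (rule partner_free_switch[OF Suc.prems(1) v f1])
  have Hf1: "partner_free V v (ham_op (Suc k) V f1)"
    unfolding ham_op by (rule partner_free_slicewise[OF Suc.prems(1,2) v Jf1])
  have "inner V (ham_op (Suc k) V f1) (ham_op (Suc k) V f1) \<le> (ham_deg (k - 1))\<^sup>2 * inner V (switch V v f1) (switch V v f1)"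
    unfolding ham_op using Suc.prems v card_remove_pair[OF Suc.prems(1,2)]
    by (intro slicewise_norm Jf1 Suc.IH) auto
  also have "\<dots> \<le> (ham_deg (k - 1))\<^sup>2 * ((2 * real n - 4)\<^sup>2 * inner V f1 f1)"
    by (intro mult_left_mono switch_norm_le[OF Suc.prems(1) n(1) v n(2) f1]) simp
  also have "\<dots> = (ham_deg (k - 1) * (2 * real k))\<^sup>2 * inner V f1 f1"
    by (simp add: n_def power_mult_distrib mult.assoc)
  also have "\<dots> \<le> (ham_deg k)\<^sup>2 * inner V f1 f1"
  proof (intro mult_right_mono power_mono inner_self_ge0)
    \<comment> \<open>At k = 0 the truncated k - 1 is harmless, because the factor 2 k from J
      vanishes.\<close>
    show "ham_deg (k - 1) * (2 * real k) \<le> ham_deg k"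
      using ham_deg_pos[of k] by (cases k) (simp_all add: ham_deg_simps algebra_simps)
    show "0 \<le> ham_deg (k - 1) * (2 * real k)" using ham_deg_pos[of "k - 1"] by simp
  qed
  finally have 1: "inner V (ham_op (Suc k) V f1) (ham_op (Suc k) V f1) \<le> (ham_deg k)\<^sup>2 * inner V f1 f1" .
  have H0: "ham_op (Suc k) V f M = ham_op (Suc k) V f1 M - ham_deg k * f0 M" if "M \<in> matchings V" for M
    using ham_op_partner_part[OF Suc.prems that] by (simp add: f1_def f0_def v_def n_def ham_op_linear)
  have "inner V (ham_op (Suc k) V f) (ham_op (Suc k) V f)
      = inner V (\<lambda>M. ham_op (Suc k) V f1 M - ham_deg k * f0 M) (\<lambda>M. ham_op (Suc k) V f1 M - ham_deg k * f0 M)"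
    using H0 by (intro inner_cong) auto
  also have "\<dots> = inner V (ham_op (Suc k) V f1) (ham_op (Suc k) V f1) + (ham_deg k)\<^sup>2 * inner V f0 f0"
    using inner_partner_part_partner_free[OF Hf1, of n f]
    by (simp add: inner_linear inner_commute[of V f0 "ham_op (Suc k) V f1"] power2_eq_square mult.assoc flip: f0_def del: ham_op.simps)
  also have "\<dots> \<le> (ham_deg k)\<^sup>2 * (inner V f1 f1 + inner V f0 f0)" using 1 by (simp add: algebra_simps)
  also have "inner V f1 f1 + inner V f0 f0 = inner V f f"
  proof -
    have "inner V f f = inner V (\<lambda>M. f1 M + f0 M) (\<lambda>M. f1 M + f0 M)" by (simp add: f1_def)
    then show ?thesis
      using inner_partner_part_partner_free[OF f1, of n f] by (simp add: inner_linear inner_commute[of V f0 f1] flip: f0_def)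
  qed
  finally show ?case by simp
qed

section \<open>The eigenspace of the least eigenvalue\<close>

lemma slicewise_cong:
  assumes "finite V" "v \<in> V" "M \<in> matchings V"
    and "\<And>x N. x \<in> V - {v} \<Longrightarrow> N \<in> matchings (V - {x, v}) \<Longrightarrow> K (V - {x, v}) (slice x v f) N = d * slice x v f N"
  shows "slicewise K V v f M = d * f M"
proof -
  obtain x where x: "x \<in> V" "x \<noteq> v" "{v, x} \<in> M" using matchings_partner[OF assms(3,2)] .
  then have xv: "{x, v} \<in> M" by (simp add: insert_commute)
  have "K (V - {x, v}) (slice x v f) (M - {{x, v}}) = d * slice x v f (M - {{x, v}})"
    using x matchings_remove[OF assms(3) xv] by (intro assms(4)) auto
  then show ?thesis
    using slicewise_at[OF assms(1,3) xv, of K f] by (simp add: slice_def insert_absorb[OF xv])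
qed

lemma inner_ge_zero_off:
  assumes "finite V" "inner V f f \<le> 0" "M \<in> matchings V"
  shows "f M = 0"
  using inner_self_eq0[OF assms(1) _ assms(3)] inner_self_ge0[of V f] assms(2) by simp

text \<open>On four points there are three matchings, told apart by the partner of any vertex, so
  every function is a function of the partner.\<close>

lemma ham_op_one:
  assumes "finite V" "card V = 4" "(\<Sum>M\<in>matchings V. f M) = 0" "M \<in> matchings V"
  shows "ham_op 1 V f M = - f M" and "f M = partner_part V (base_vertex V) 2 f M"
proof -
  have V: "card V = 2 * Suc (Suc 0)" "card V = 2 * 2" using assms(2) by auto
  have v: "base_vertex V \<in> V" using base_vertex_in card_even_nonempty[OF V(1)] by metis
  have "inner V (\<lambda>M. f M - partner_part V (base_vertex V) 2 f M) (\<lambda>M. f M - partner_part V (base_vertex V) 2 f M) = 0"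
    using inner_small[OF assms(1) V(2) _ v] partner_part_partner_free[OF assms(1) V(2) v, of f]
    by (simp add: partner_free_def)
  then have e: "f N = partner_part V (base_vertex V) 2 f N" if "N \<in> matchings V" for N
    using inner_self_eq0[OF assms(1) _ that] by force
  then show "f M = partner_part V (base_vertex V) 2 f M" using assms(4) by blast
  have "ham_op 1 V f M = ham_op 1 V (partner_part V (base_vertex V) 2 f) M"
    using ham_op_cong[OF assms(1), of 1 f "partner_part V (base_vertex V) 2 f" M] e V(1) assms(4) by simp
  also have "\<dots> = - f M"
    using ham_op_partner_part[OF assms(1) V(1) assms(3,4)] e[OF assms(4)]
    by (simp add: ham_deg_simps numeral_2_eq_2)
  finally show "ham_op 1 V f M = - f M" .
qed

lemma in_edge_span_add:
  assumes "in_edge_span V f" "in_edge_span V g"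
  shows "in_edge_span V (\<lambda>M. f M + g M)"
proof -
  obtain u w where "\<forall>M\<in>matchings V. f M = (\<Sum>a\<in>V. \<Sum>b\<in>V. u a b * edge M a b)"
    "\<forall>M\<in>matchings V. g M = (\<Sum>a\<in>V. \<Sum>b\<in>V. w a b * edge M a b)"
    using assms unfolding in_edge_span_def by blast
  then have "\<forall>M\<in>matchings V. f M + g M = (\<Sum>a\<in>V. \<Sum>b\<in>V. (u a b + w a b) * edge M a b)"
    by (simp add: algebra_simps sum.distrib)
  then show ?thesis unfolding in_edge_span_def by (intro exI)
qed

lemma in_edge_span_partner_fun:
  assumes "finite V" "v \<in> V"
  shows "in_edge_span V (partner_fun V v a)"
  unfolding in_edge_span_def
proof (intro exI ballI)
  fix M assume M: "M \<in> matchings V"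
  have "(\<Sum>x\<in>V. \<Sum>y\<in>V. (if y = v then a x else 0) * edge M x y)
      = (\<Sum>x\<in>V. \<Sum>y\<in>V. if y = v then a x * edge M x y else 0)"
    by (intro sum.cong refl) simp
  also have "\<dots> = (\<Sum>x\<in>V. a x * edge M x v)" using assms by simp
  also have "\<dots> = partner_fun V v a M"
    using assms M by (simp add: sum.remove[of V v] edge_self partner_fun_def mult.commute)
  finally show "partner_fun V v a M = (\<Sum>x\<in>V. \<Sum>y\<in>V. (if y = v then a x else 0) * edge M x y)" by simp
qed

text \<open>The edges at a fixed vertex sum to the constant 1.\<close>

lemma in_edge_span_const:
  assumes "finite V" "V \<noteq> {}"
  shows "in_edge_span V (\<lambda>_. c)"
proof -
  obtain v where v: "v \<in> V" using assms(2) by blast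
  have "partner_fun V v (\<lambda>_. c) M = c" if M: "M \<in> matchings V" for M
  proof -
    obtain x where "x \<in> V" "x \<noteq> v" "{v, x} \<in> M" using matchings_partner[OF M v] .
    then show ?thesis using partner_fun_at[OF assms(1) M, of x v] by (simp add: insert_commute)
  qed
  then show ?thesis using in_edge_span_partner_fun[OF assms(1) v, of "\<lambda>_. c"] by (simp add: in_edge_span_def)
qed

text \<open>The partner part is a combination of edges at the base vertex, so the partner-free part
  f1 is an eigenfunction too. Its eigenvalue is so large in modulus that J must stretch f1 by its
  full norm, and the upper end 2 n - 4 of the spectrum of J is then attained on f1;
  \<open>gap_bound_equality\<close> applies.\<close>

lemma ham_op_eigenspace:
  assumes "finite V" "card V = 2 * Suc (Suc k)" "(\<Sum>M\<in>matchings V. f M) = 0"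
    and eig: "\<And>M. M \<in> matchings V \<Longrightarrow> ham_op (Suc k) V f M = - ham_deg k * f M"
  shows "in_edge_span V f"
proof -
  define v where "v = base_vertex V"
  define n where "n = Suc (Suc k)"
  have n: "card V = 2 * n" "n \<ge> 2" using assms(2) by (auto simp: n_def)
  have v: "v \<in> V" using base_vertex_in card_even_nonempty assms(2) by (metis v_def)
  define f0 where "f0 = partner_part V v n f"
  define f1 where "f1 = (\<lambda>M. f M - f0 M)"
  have f0: "in_edge_span V f0" unfolding f0_def partner_part_def by (rule in_edge_span_partner_fun[OF assms(1) v])
  have f1: "partner_free V v f1" unfolding f1_def f0_def by (rule partner_part_partner_free[OF assms(1) n(1) v])
  have Jf1: "partner_free V v (switch V v f1)" by (rule partner_free_switch[OF assms(1) v f1])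
  have ham_op: "ham_op (Suc k) V g = slicewise (ham_op k) V v (switch V v g)" for g by (simp add: v_def)
  have H1: "slicewise (ham_op k) V v (switch V v f1) M = - ham_deg k * f1 M" if "M \<in> matchings V" for M
  proof -
    have "ham_op (Suc k) V f1 M = ham_op (Suc k) V f M - ham_op (Suc k) V f0 M" by (simp only: f1_def ham_op_linear)
    also have "\<dots> = - ham_deg k * f1 M"
      using ham_op_partner_part[OF assms(1-3) that] eig[OF that]
      by (simp add: f0_def f1_def v_def n_def algebra_simps del: ham_op.simps)
    finally show ?thesis by (simp add: v_def)
  qed
  have zero: "(\<Sum>N\<in>matchings (V - {x, v}). slice x v (switch V v f1) N) = 0" if "x \<in> V - {v}" for x
    using Jf1 slice_sum_edge[OF assms(1) v that, of "switch V v f1"] that by (simp add: partner_free_def slice_def)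
  have "in_edge_span V f1"
  proof (cases "k = 0")
    case True
    then have "f1 M = 0" if "M \<in> matchings V" for M
      using ham_op_one(2)[OF assms(1) _ assms(3) that] assms(2)
      by (simp add: f1_def f0_def v_def n_def numeral_2_eq_2)
    then show ?thesis using in_edge_span_const[OF assms(1), of 0] v by (auto simp: in_edge_span_def)
  next
    case k: False
    have "(2 * real n - 4) * inner V f1 f1 \<le> inner V f1 (switch V v f1)"
    proof (cases "k = 1")
      case True
      \<comment> \<open>For n = 3 the spectral interval of J is [-2, 2], and its norm cannot tell
        the two ends apart. Instead the four-point operator acts as - 1 on the slices, so the
        eigenvalue equation of H reads J f1 = 2 f1.\<close>
      have "switch V v f1 M = 2 * f1 M" if M: "M \<in> matchings V" for M
      proof -
        have "ham_op 1 (V - {x, v}) (slice x v (switch V v f1)) N = - 1 * slice x v (switch V v f1) N"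
          if "x \<in> V - {v}" "N \<in> matchings (V - {x, v})" for x N
          using ham_op_one(1)[OF _ _ zero[OF that(1)] that(2)] assms(1) True v that(1)
            card_remove_pair[OF assms(1,2), of x v] by simp
        then have "slicewise (ham_op 1) V v (switch V v f1) M = - 1 * switch V v f1 M"
          by (rule slicewise_cong[OF assms(1) v M])
        then show ?thesis using H1[OF M] True by (simp add: ham_deg_simps)
      qed
      then have "inner V f1 (switch V v f1) = inner V f1 (\<lambda>M. 2 * f1 M)" by (intro inner_cong) auto
      then show ?thesis using True by (simp add: inner_linear n_def)
    next
      case False
      then have k2: "k \<ge> 2" using k by simp
      have dk: "ham_deg k = 2 * real k * ham_deg (k - 1)" using k by (cases k) (simp_all add: ham_deg_simps)
      have "(ham_deg k)\<^sup>2 * inner V f1 f1 = inner V (\<lambda>M. - ham_deg k * f1 M) (\<lambda>M. - ham_deg k * f1 M)"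
        unfolding inner_linear by (simp add: power2_eq_square)
      also have "\<dots> = inner V (slicewise (ham_op k) V v (switch V v f1)) (slicewise (ham_op k) V v (switch V v f1))"
        using H1 by (intro inner_cong) auto
      also have "\<dots> \<le> (ham_deg (k - 1))\<^sup>2 * inner V (switch V v f1) (switch V v f1)"
        using assms v card_remove_pair[OF assms(1,2)] by (intro slicewise_norm Jf1 ham_op_norm) auto
      finally have "(ham_deg (k - 1))\<^sup>2 * ((2 * real k)\<^sup>2 * inner V f1 f1) \<le> (ham_deg (k - 1))\<^sup>2 * inner V (switch V v f1) (switch V v f1)"
        by (simp add: dk power_mult_distrib mult_ac)
      then have "(2 * real k)\<^sup>2 * inner V f1 f1 \<le> inner V (switch V v f1) (switch V v f1)"
        using ham_deg_pos[of "k - 1"] by (subst (asm) mult_le_cancel_left_pos) auto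
      also note switch_norm[OF assms(1) n(1) v n(2) f1]
      \<comment> \<open>Combining the lower bound on the norm of J f1 with
        \<open>switch_norm\<close> leaves the factor k - 1, which may be cancelled only for k at
        least 2.\<close>
      finally have "(real k - 1) * ((2 * real k) * inner V f1 f1) \<le> (real k - 1) * inner V f1 (switch V v f1)"
        by (simp add: n_def power2_eq_square algebra_simps)
      then show ?thesis using k2 by (simp add: n_def)
    qed
    then show ?thesis
      using k f1 by (intro gap_bound_equality[OF assms(1) n(1) v]) (auto simp: n_def)
  qed
  then show ?thesis using in_edge_span_add[OF f0, of f1] by (simp add: f1_def)
qed

section \<open>The ratio bound with equality\<close>

text \<open>Let c be the density of S, g its indicator minus c, and d = (2 n - 4)!!. Intersection
  makes the quadratic form of H vanish on the indicator, so that the squared norm of H g + d g is at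
  most 2 d^2 s (1 - c (2 n - 1)), where s is the size of S. The size assumption makes this
  nonpositive, hence g is an eigenfunction.\<close>

lemma intersecting_in_edge_span:
  assumes "finite V" "card V = 2 * n" "n \<ge> 1" "S \<subseteq> matchings V"
    and "\<And>M N. M \<in> S \<Longrightarrow> N \<in> S \<Longrightarrow> M \<inter> N \<noteq> {}"
    and "real (card S) \<ge> odd_fact (n - 1)"
  shows "in_edge_span V (indicator S)"
proof (cases "n = 1")
  case True
  \<comment> \<open>On two points \<open>ham_op\<close> is the identity and carries no disjointness,
    so this case is settled directly.\<close>
  have "card (matchings V) = 1" using card_matchings[OF assms(1,2)] True by (simp add: odd_fact_simps)
  then obtain m where "matchings V = {m}" by (auto simp: card_1_singleton_iff)
  then have "indicator S M = (indicator S m :: real)" if "M \<in> matchings V" for M using that by simp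
  moreover have "V \<noteq> {}" using assms(2,3) by auto
  ultimately show ?thesis
    using in_edge_span_const[OF assms(1), of "indicator S m"] by (auto simp: in_edge_span_def)
next
  case False
  define k where "k = n - 2"
  have k: "n = Suc (Suc k)" using False assms(3) by (simp add: k_def)
  have V: "card V = 2 * Suc (Suc k)" using assms(2) k by simp
  define s where "s = real (card S)"
  define c where "c = s / odd_fact n"
  define D where "D = ham_deg (Suc k)"
  let ?v = "indicator S :: 'a set set \<Rightarrow> real"
  define g where "g = (\<lambda>M. ?v M - c)"
  have fin: "finite (matchings V)" using finite_matchings[OF assms(1)] .
  have sv: "(\<Sum>M\<in>matchings V. ?v M) = s"
    using fin assms(4) by (simp add: s_def indicator_def sum_of_bool_eq Int_absorb1)
  have cN: "c * odd_fact n = s" using odd_fact_pos[of n] by (simp add: c_def)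
  have N: "(\<Sum>M\<in>matchings V. 1) = odd_fact n" using card_matchings[OF assms(1,2)] by simp
  have sg: "(\<Sum>M\<in>matchings V. g M) = 0"
    using cN card_matchings[OF assms(1,2)] by (simp add: g_def sum_subtractf sv mult.commute)
  \<comment> \<open>For M in S, no member of S is disjoint from M, so the row of M in H annihilates
    the indicator.\<close>
  have Hv: "?v M * ham_op (Suc k) V ?v M = 0" if "M \<in> matchings V" for M
  proof (cases "M \<in> S")
    case True
    then have "?v N = 0" if "N \<inter> M = {}" for N using assms(5)[of N M] that by (auto simp: indicator_def)
    then have "ham_op (Suc k) V ?v M = 0" using ham_op_disjoint_support[OF assms(1) V that] by blast
    then show ?thesis by simp
  qed simp
  have Hg: "ham_op (Suc k) V g M = ham_op (Suc k) V ?v M - c * D" if "M \<in> matchings V" for M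
    using ham_op_const[OF assms(1) V that, of c] unfolding g_def ham_op_linear by (simp add: D_def mult.commute)
  have "inner V g (ham_op (Suc k) V g) = inner V g (\<lambda>M. ham_op (Suc k) V ?v M - c * D)"
    using Hg by (intro inner_cong) auto
  also have "\<dots> = (\<Sum>M\<in>matchings V. ?v M * ham_op (Suc k) V ?v M) - c * D * (\<Sum>M\<in>matchings V. ?v M)
      - c * (\<Sum>M\<in>matchings V. ham_op (Suc k) V ?v M) + c * c * D * (\<Sum>M\<in>matchings V. 1)"
    unfolding inner_def g_def sum_distrib_left sum_subtractf[symmetric] sum.distrib[symmetric]
    by (intro sum.cong refl) (simp add: algebra_simps del: ham_op.simps)
  also have "\<dots> = - c * D * s"
    using sum.neutral[of "matchings V", OF ballI, OF Hv]
    unfolding sum_ham_op[OF assms(1) V] sv N by (simp add: D_def cN[symmetric] algebra_simps del: ham_op.simps)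
  finally have gHg: "inner V g (ham_op (Suc k) V g) = - c * D * s" .
  have "inner V g g = (\<Sum>M\<in>matchings V. ?v M) - 2 * c * (\<Sum>M\<in>matchings V. ?v M) + c * c * (\<Sum>M\<in>matchings V. 1)"
    unfolding inner_def g_def sum_distrib_left sum_subtractf[symmetric] sum.distrib[symmetric]
    by (intro sum.cong refl) (auto simp: algebra_simps indicator_def)
  also have "\<dots> = s * (1 - c)" using cN unfolding sv N by (simp add: algebra_simps)
  finally have gg: "inner V g g = s * (1 - c)" .
  have HH: "inner V (ham_op (Suc k) V g) (ham_op (Suc k) V g) \<le> (ham_deg k)\<^sup>2 * inner V g g"
    using ham_op_norm[OF assms(1) V sg] by simp
  \<comment> \<open>The family through a fixed edge has density (2 n - 3)!! / (2 n - 1)!! = 1 / (2 n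
    - 1), and S is at least as large.\<close>
  have "c * (2 * real n - 1) \<ge> 1"
  proof -
    have "odd_fact n = (2 * real n - 1) * odd_fact (n - 1)" using k odd_fact_simps(2)[of "n - 1"] by simp
    then have "(c * (2 * real n - 1)) * odd_fact (n - 1) = s" using cN by simp
    then have "1 * odd_fact (n - 1) \<le> (c * (2 * real n - 1)) * odd_fact (n - 1)" using assms(6) by (simp add: s_def)
    then show ?thesis using odd_fact_pos[of "n - 1"] by (simp only: mult_le_cancel_right_pos)
  qed
  moreover have "s \<ge> 0" by (simp add: s_def)
  ultimately have c1: "s * (1 - c * (2 * real n - 1)) \<le> 0" by (simp add: mult_nonneg_nonpos)
  have D: "D = (2 * real n - 2) * ham_deg k" by (simp add: D_def ham_deg_simps k)
  have "inner V (\<lambda>M. ham_op (Suc k) V g M + ham_deg k * g M) (\<lambda>M. ham_op (Suc k) V g M + ham_deg k * g M)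
      = inner V (ham_op (Suc k) V g) (ham_op (Suc k) V g) + 2 * ham_deg k * inner V g (ham_op (Suc k) V g) + (ham_deg k)\<^sup>2 * inner V g g"
    by (simp add: inner_linear inner_commute[of V "ham_op (Suc k) V g" g] power2_eq_square algebra_simps del: ham_op.simps)
  also have "\<dots> \<le> 2 * (ham_deg k)\<^sup>2 * (s * (1 - c * (2 * real n - 1)))"
    using HH unfolding gHg gg D by (simp add: power2_eq_square algebra_simps)
  also have "\<dots> \<le> 0" using c1 by (rule mult_nonneg_nonpos[rotated]) simp
  finally have le0: "inner V (\<lambda>M. ham_op (Suc k) V g M + ham_deg k * g M) (\<lambda>M. ham_op (Suc k) V g M + ham_deg k * g M) \<le> 0" .
  have "in_edge_span V g"
  proof (rule ham_op_eigenspace[OF assms(1) V sg])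
    fix M assume "M \<in> matchings V"
    then show "ham_op (Suc k) V g M = - ham_deg k * g M" using inner_ge_zero_off[OF assms(1) le0] by (simp add: eq_neg_iff_add_eq_0 del: ham_op.simps)
  qed
  then have "in_edge_span V (\<lambda>M. g M + c)"
    by (intro in_edge_span_add in_edge_span_const[OF assms(1)] card_even_nonempty[OF V])
  then show ?thesis by (simp add: g_def)
qed

section \<open>The components of the permutation representation\<close>

lemma sum_apply: "(\<Sum>i\<in>A. f i) x = (\<Sum>i\<in>A. f i x)"
  by (induction A rule: infinite_finite_induct) auto

lemma cfun_linear_span:
  assumes add: "\<And>f g. L (f + g) = L f + L g" and scale: "\<And>c f. L (cscale c f) = cscale c (L f)"
    and "cfun.subspace W" "\<And>f. f \<in> B \<Longrightarrow> L f \<in> W" "f \<in> cfun.span B"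
  shows "L f \<in> W"
proof -
  have "L 0 = 0" using add[of 0 0] by simp
  then have "cfun.subspace {f. L f \<in> W}"
    using assms(3) by (auto simp: cfun.subspace_def add scale)
  then show ?thesis using cfun.span_induct[OF assms(5), of "\<lambda>f. L f \<in> W"] assms(4) by auto
qed

lemma fun_action_linear:
  "fun_action a p (f + g) = fun_action a p f + fun_action a p g"
  "fun_action a p (cscale c f) = cscale c (fun_action a p f)"
  by (auto simp: fun_action_def cscale_def fun_eq_iff)

lemma matching_action_comp: "matching_action p (matching_action q M) = matching_action (p \<circ> q) M"
  by (simp add: matching_action_def image_image image_comp)

lemma tabloid_action_comp: "tabloid_action p (tabloid_action q T) = tabloid_action (p \<circ> q) T"
  by (simp add: tabloid_action_def image_comp)

lemma matching_action_id: "matching_action id M = M"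
  by (simp add: matching_action_def)

lemma tabloid_action_id: "tabloid_action id T = T"
  by (simp add: tabloid_action_def)

lemma fun_action_comp:
  assumes "p permutes V" "q permutes V"
  shows "fun_action tabloid_action p (fun_action tabloid_action q f) = fun_action tabloid_action (p \<circ> q) f"
  using assms by (simp add: fun_action_def tabloid_action_comp permutes_inv_o o_inv_distrib permutes_bij)

text \<open>The last assumption is Schur's lemma together with multiplicity one.\<close>

lemma component_eqI:
  fixes T0 :: "(nat set list \<Rightarrow> complex) \<Rightarrow> nat set set \<Rightarrow> complex"
  assumes part: "is_partition (2 * n) \<mu>"
    and S: "S = specht_module \<mu>"
      "\<And>p f. p permutes {1..2 * n} \<Longrightarrow> f \<in> S \<Longrightarrow> fun_action tabloid_action p f \<in> S"
    and add: "\<And>f g. T0 (f + g) = T0 f + T0 g" and scale: "\<And>c f. T0 (cscale c f) = cscale c (T0 f)"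
    and equi: "\<And>p f. p permutes {1..2 * n} \<Longrightarrow>
        T0 (fun_action tabloid_action p f) = fun_action matching_action p (T0 f)"
    and supp: "\<And>f. T0 f \<in> functions_on (perfect_matchings n)"
    and inj: "\<And>f. f \<in> S \<Longrightarrow> T0 f = 0 \<Longrightarrow> f = 0"
    and nontriv: "f0 \<in> S" "f0 \<noteq> 0"
    and schur: "\<And>T :: (nat set list \<Rightarrow> complex) \<Rightarrow> nat set set \<Rightarrow> complex.
      \<lbrakk>\<And>f. f \<in> S \<Longrightarrow> T f \<in> functions_on (perfect_matchings n);
       \<And>f g. f \<in> S \<Longrightarrow> g \<in> S \<Longrightarrow> T (f + g) = T f + T g;
       \<And>c f. f \<in> S \<Longrightarrow> T (cscale c f) = cscale c (T f);
       \<And>p f. p permutes {1..2 * n} \<Longrightarrow> f \<in> S \<Longrightarrow>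
          T (fun_action tabloid_action p f) = fun_action matching_action p (T f)\<rbrakk>
      \<Longrightarrow> \<exists>\<kappa>. \<forall>f\<in>S. T f = cscale \<kappa> (T0 f)"
  shows "matching_component n \<mu> = T0 ` S"
proof -
  have sub: "cfun.subspace S" by (simp add: S(1) specht_module_def)
  have diff: "T0 (f - g) = T0 f - T0 g" for f g
  proof -
    have "T0 f = T0 ((f - g) + g)" by simp
    then show ?thesis unfolding add by simp
  qed
  have inj': "inj_on T0 S"
  proof (rule inj_onI)
    fix f g assume "f \<in> S" "g \<in> S" "T0 f = T0 g"
    then have "f - g = 0" by (intro inj cfun.subspace_diff[OF sub]) (auto simp: diff)
    then show "f = g" by simp
  qed
  have subW: "cfun.subspace (T0 ` S)"
  proof -
    have "T0 0 = 0" using add[of 0 0] by simp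
    then show ?thesis
      using sub unfolding cfun.subspace_def by (auto simp flip: add scale intro: rev_image_eqI)
  qed
  have ex: "subrepresentation (2 * n) matching_action (perfect_matchings n) (T0 ` S)"
    unfolding subrepresentation_def using subW supp S(2) by (auto simp flip: equi)
  have iso: "isomorphic_reps (2 * n) tabloid_action S matching_action (T0 ` S)"
    unfolding isomorphic_reps_def using inj' add scale equi
    by (intro exI[of _ T0]) (auto simp: bij_betw_def)
  have uniq: "W = T0 ` S"
    if W: "subrepresentation (2 * n) matching_action (perfect_matchings n) W"
      "isomorphic_reps (2 * n) tabloid_action S matching_action W" for W
  proof -
    obtain T where T: "bij_betw T S W" "\<forall>f\<in>S. \<forall>g\<in>S. T (f + g) = T f + T g"
      "\<forall>c. \<forall>f\<in>S. T (cscale c f) = cscale c (T f)"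
      "\<forall>p. p permutes {1..2 * n} \<longrightarrow> (\<forall>f\<in>S. T (fun_action tabloid_action p f) = fun_action matching_action p (T f))"
      using W(2) unfolding isomorphic_reps_def by blast
    have TW: "T ` S = W" using T(1) by (simp add: bij_betw_def)
    have "\<exists>\<kappa>. \<forall>f\<in>S. T f = cscale \<kappa> (T0 f)"
      using T W(1) TW by (intro schur) (auto simp: subrepresentation_def)
    then obtain \<kappa> where \<kappa>: "\<And>f. f \<in> S \<Longrightarrow> T f = cscale \<kappa> (T0 f)" by blast
    \<comment> \<open>An isomorphism cannot kill the nonzero f0. Hence T and T0 differ by an
      invertible scalar and have the same image.\<close>
    have "\<kappa> \<noteq> 0"
    proof
      assume "\<kappa> = 0"
      then have "T f0 = T 0" using \<kappa> nontriv(1) cfun.subspace_0[OF sub] by (simp add: cscale_def fun_eq_iff)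
      then show False
        using T(1) nontriv cfun.subspace_0[OF sub] by (auto simp: bij_betw_def inj_on_def)
    qed
    have "T ` S = T0 ` S"
    proof
      show "T ` S \<subseteq> T0 ` S"
        using \<kappa> cfun.subspace_scale[OF sub] by (auto simp flip: scale)
      show "T0 ` S \<subseteq> T ` S"
      proof
        fix F assume "F \<in> T0 ` S"
        then obtain f where f: "f \<in> S" "F = T0 f" by blast
        have "T (cscale (1 / \<kappa>) f) = F"
          using \<open>\<kappa> \<noteq> 0\<close> \<kappa>[OF cfun.subspace_scale[OF sub f(1)], of "1 / \<kappa>"]
          by (simp only: scale f(2)) (simp add: cscale_def)
        then show "F \<in> T ` S" using f cfun.subspace_scale[OF sub] by blast
      qed
    qed
    then show ?thesis using TW by simp
  qed
  have "(THE W. subrepresentation (2 * n) matching_action (perfect_matchings n) W \<and>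
      isomorphic_reps (2 * n) tabloid_action S matching_action W) = T0 ` S"
    by (rule the_equality) (use ex iso uniq in blast)+
  then show ?thesis using part by (simp add: matching_component_def S(1))
qed

section \<open>The trivial component\<close>

definition matching_const :: "nat \<Rightarrow> complex \<Rightarrow> nat set set \<Rightarrow> complex" where
  "matching_const n c M = (if M \<in> perfect_matchings n then c else 0)"

lemma matching_action_permutes:
  assumes "p permutes {1..2 * n}"
  shows "matching_action p M \<in> perfect_matchings n \<longleftrightarrow> M \<in> perfect_matchings n"
proof -
  have *: "matching_action q N \<in> perfect_matchings n" if "q permutes {1..2 * n}" "N \<in> perfect_matchings n" for q N
    using matchings_image[OF that(1)] that(2) by (simp add: matching_action_def perfect_matchings_eq_matchings)
  have "matching_action (inv p) (matching_action p M) = M"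
    using permutes_inv_o[OF assms] by (simp add: matching_action_comp matching_action_id)
  then show ?thesis using *[OF assms, of M] *[OF permutes_inv[OF assms], of "matching_action p M"] by metis
qed

text \<open>Transitivity as an induction rule. Invariance in one direction suffices, because
  transpositions are involutions.\<close>

lemma perfect_matchings_transitive:
  assumes P: "M \<in> perfect_matchings n" "P M"
    and step: "\<And>p M. p permutes {1..2 * n} \<Longrightarrow> M \<in> perfect_matchings n \<Longrightarrow> P M \<Longrightarrow> P (matching_action p M)"
    and "N \<in> perfect_matchings n"
  shows "P N"
proof -
  have "P M = P N"
  proof (rule matchings_swap_pts_invariant_const[where V = "{1..2 * n}"])
    fix a b M assume ab: "a \<in> {1..2 * n}" "b \<in> {1..2 * n}" and M: "M \<in> matchings {1..2 * n}"
    have swap_pts: "swap_pts a b K = matching_action (transpose a b) K" for K by (simp add: swap_pts_def matching_action_def)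
    have p: "transpose a b permutes {1..2 * n}" using ab by (rule permutes_swap_id)
    have "P (swap_pts a b K)" if "K \<in> matchings {1..2 * n}" "P K" for K
      using step[OF p, of K] that by (simp add: swap_pts perfect_matchings_eq_matchings)
    then show "P (swap_pts a b M) = P M" using M swap_pts_matchings[OF ab M] by (metis swap_pts_swap_pts)
  qed (use assms in \<open>auto simp: perfect_matchings_eq_matchings\<close>)
  then show ?thesis using P(2) by simp
qed

lemma perfect_matchings_nonempty: "perfect_matchings n \<noteq> {}"
  using card_matchings[of "{1..2 * n}" n] odd_fact_pos[of n] by (auto simp: perfect_matchings_eq_matchings)

text \<open>In a one-row tableau every column is a single cell, so the column group is trivial and
  the polytabloid is the only tabloid.\<close>

lemma specht_module_trivial:
  assumes "n \<ge> 1"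
  shows "specht_module [2 * n] = cfun.span {indicator {[{1..2 * n}]}}"
proof -
  let ?\<mu> = "[2 * n]"
  have D: "diagram ?\<mu> = {(0, j) | j. j < 2 * n}" by (auto simp: diagram_def)
  have poly: "polytabloid ?\<mu> t = indicator {[{1..2 * n}]}" if t: "tableau ?\<mu> t" for t
  proof -
    have bij: "bij_betw t {(0, j) | j. j < 2 * n} {1..2 * n}" using t by (simp add: tableau_def D)
    have "tableau_row ?\<mu> t 0 = t ` {(0, j) | j. j < 2 * n}" by (auto simp: tableau_row_def D)
    then have pair_tabloid: "tabloid ?\<mu> t = [{1..2 * n}]" using bij by (simp add: tabloid_def bij_betw_def)
    have "p = id" if p: "p permutes {1..2 * n}" "\<forall>j. p ` tableau_column ?\<mu> t j = tableau_column ?\<mu> t j" for p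
    proof
      fix x show "p x = id x"
      proof (cases "x \<in> {1..2 * n}")
        case True
        then obtain j where j: "j < 2 * n" "x = t (0, j)" using bij by (force simp: bij_betw_def image_def)
        then have "tableau_column ?\<mu> t j = {x}" by (auto simp: tableau_column_def D)
        then show ?thesis using p(2)[rule_format, of j] by simp
      qed (use p(1) in \<open>auto simp: permutes_def\<close>)
    qed
    then have "column_stabilizer ?\<mu> t = {id}" by (auto simp: column_stabilizer_def permutes_id)
    then show ?thesis
      by (simp add: polytabloid_def pair_tabloid tabloid_action_id cscale_def)
  qed
  have "tableau ?\<mu> (\<lambda>(i, j). Suc j)"
    unfolding tableau_def D by (rule bij_betwI[where g = "\<lambda>x. (0, x - 1)"]) auto
  then have "indicator {[{1..2 * n}]} \<in> {polytabloid ?\<mu> t | t. tableau ?\<mu> t}"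
    using poly[symmetric] by blast
  then have "{polytabloid ?\<mu> t | t. tableau ?\<mu> t} = {indicator {[{1..2 * n}]}}"
    using poly by blast
  then show ?thesis by (simp add: specht_module_def)
qed

lemma matching_component_trivial:
  assumes "n \<ge> 1"
  shows "matching_const n c \<in> matching_component n [2 * n]"
proof -
  let ?R = "[{1..2 * n}]"
  define e :: "nat set list \<Rightarrow> complex" where "e = indicator {?R}"
  define T0 :: "(nat set list \<Rightarrow> complex) \<Rightarrow> nat set set \<Rightarrow> complex" where "T0 = (\<lambda>g. matching_const n (g ?R))"
  have S: "specht_module [2 * n] = {cscale k e | k. True}"
    using specht_module_trivial[OF assms] by (auto simp: cfun.span_singleton e_def)
  have inv: "fun_action tabloid_action p e = e" if "p permutes {1..2 * n}" for p
  proof -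
    have "tabloid_action (inv p) T = ?R \<longleftrightarrow> T = ?R" for T
    proof -
      have R: "tabloid_action q ?R = ?R" if "q permutes {1..2 * n}" for q
        using permutes_image[OF that] by (simp add: tabloid_action_def)
      have "tabloid_action p (tabloid_action (inv p) T) = T"
        using permutes_inv_o[OF that] by (simp add: tabloid_action_comp tabloid_action_id)
      then show ?thesis using R[OF that] R[OF permutes_inv[OF that]] by metis
    qed
    then show ?thesis by (auto simp: fun_action_def e_def indicator_def fun_eq_iff)
  qed
  have eR: "e ?R = 1" by (simp add: e_def)
  have "matching_component n [2 * n] = T0 ` specht_module [2 * n]"
  proof (rule component_eqI[where ?f0.0 = e, OF _ refl])
    show "is_partition (2 * n) [2 * n]" using assms by (simp add: is_partition_def)
    show "fun_action tabloid_action p f \<in> specht_module [2 * n]"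
      if "p permutes {1..2 * n}" "f \<in> specht_module [2 * n]" for p f
      using that by (auto simp: S fun_action_linear inv)
    show "T0 (fun_action tabloid_action p f) = fun_action matching_action p (T0 f)"
      if "p permutes {1..2 * n}" for p f
      using permutes_image[OF permutes_inv[OF that]] matching_action_permutes[OF permutes_inv[OF that]]
      by (auto simp: T0_def matching_const_def fun_action_def tabloid_action_def fun_eq_iff)
    show "f = 0" if f: "f \<in> specht_module [2 * n]" "T0 f = 0" for f
    proof -
      obtain k where k: "f = cscale k e" using f(1) S by auto
      obtain M where "M \<in> perfect_matchings n" using perfect_matchings_nonempty by blast
      then have "k = 0"
        using fun_cong[OF f(2), of M] eR by (simp add: k T0_def matching_const_def cscale_def)
      then show ?thesis by (simp add: k cscale_def fun_eq_iff)
    qed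
    show "e \<in> specht_module [2 * n]" using S by (auto simp: cscale_def intro!: exI[of _ 1])
    show "e \<noteq> 0" using eR by auto
    fix T :: "(nat set list \<Rightarrow> complex) \<Rightarrow> nat set set \<Rightarrow> complex"
    assume T: "\<And>f. f \<in> specht_module [2 * n] \<Longrightarrow> T f \<in> functions_on (perfect_matchings n)"
      "\<And>c f. f \<in> specht_module [2 * n] \<Longrightarrow> T (cscale c f) = cscale c (T f)"
      "\<And>p f. p permutes {1..2 * n} \<Longrightarrow> f \<in> specht_module [2 * n] \<Longrightarrow>
          T (fun_action tabloid_action p f) = fun_action matching_action p (T f)"
    have e: "e \<in> specht_module [2 * n]" using S by (auto simp: cscale_def intro!: exI[of _ 1])
    obtain M0 where M0: "M0 \<in> perfect_matchings n" using perfect_matchings_nonempty by blast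
    \<comment> \<open>The generator e is fixed by all permutations, so its image is an invariant
      function, which transitivity makes constant.\<close>
    have "T e N = T e M0" if "N \<in> perfect_matchings n" for N
    proof (rule perfect_matchings_transitive[where P = "\<lambda>N. T e N = T e M0", OF M0 refl _ that])
      fix p M assume p: "p permutes {1..2 * n}" and M: "M \<in> perfect_matchings n" "T e M = T e M0"
      have "T e (matching_action p M) = fun_action matching_action p (T e) (matching_action p M)"
        using T(3)[OF p e] inv[OF p] by simp
      also have "\<dots> = T e M"
        using permutes_inv_o[OF p] by (simp add: fun_action_def matching_action_comp matching_action_id)
      finally show "T e (matching_action p M) = T e M0" using M(2) by simp
    qed
    then have Te: "T e = matching_const n (T e M0)"
      using T(1)[OF e] by (auto simp: matching_const_def functions_on_def fun_eq_iff)
    show "\<exists>\<kappa>. \<forall>f\<in>specht_module [2 * n]. T f = cscale \<kappa> (T0 f)"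
    proof (intro exI ballI)
      fix f assume "f \<in> specht_module [2 * n]"
      then obtain k where k: "f = cscale k e" using S by auto
      have "T f = cscale k (matching_const n (T e M0))" unfolding k T(2)[OF e] using Te by simp
      then show "T f = cscale (T e M0) (T0 f)"
        using eR by (auto simp: k T0_def matching_const_def cscale_def fun_eq_iff)
    qed
  qed (auto simp: T0_def matching_const_def cscale_def functions_on_def fun_eq_iff)
  moreover have "matching_const n c = T0 (cscale c e)" using eR by (simp add: T0_def cscale_def)
  ultimately show ?thesis using S by auto
qed

section \<open>The Specht module of shape [2 n - 2, 2]\<close>

definition pair_tabloid :: "nat \<Rightarrow> nat \<Rightarrow> nat \<Rightarrow> nat set list" where
  "pair_tabloid n x y = [{1..2 * n} - {x, y}, {x, y}]"

text \<open>The polytabloid of a tableau whose two full columns are a over b and c over d, written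
  out over the four column permutations. A tabloid of this shape is determined by its second row, a
  pair of points.\<close>

definition quad_tabloid :: "nat \<Rightarrow> nat \<Rightarrow> nat \<Rightarrow> nat \<Rightarrow> nat \<Rightarrow> nat set list \<Rightarrow> complex" where
  "quad_tabloid n a b c d T = indicator {pair_tabloid n b d} T - indicator {pair_tabloid n a d} T
     - indicator {pair_tabloid n b c} T + indicator {pair_tabloid n a c} T"

lemma pair_tabloid_eq_iff: "pair_tabloid n x y = pair_tabloid n x' y' \<longleftrightarrow> {x, y} = {x', y'}"
  by (auto simp: pair_tabloid_def)

lemma pair_tabloid_commute: "pair_tabloid n x y = pair_tabloid n y x"
  by (simp add: pair_tabloid_eq_iff insert_commute)

lemma tabloid_action_pair_tabloid:
  assumes "p permutes {1..2 * n}"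
  shows "tabloid_action p (pair_tabloid n x y) = pair_tabloid n (p x) (p y)"
  using permutes_image[OF assms] image_set_diff[OF permutes_inj[OF assms], of "{1..2 * n}" "{x, y}"]
  by (simp add: tabloid_action_def pair_tabloid_def)

lemma fun_action_quad_tabloid:
  assumes "p permutes {1..2 * n}"
  shows "fun_action tabloid_action p (quad_tabloid n a b c d) = quad_tabloid n (p a) (p b) (p c) (p d)"
proof -
  have "tabloid_action (inv p) T = pair_tabloid n x y \<longleftrightarrow> T = pair_tabloid n (p x) (p y)" for T x y
  proof -
    have "tabloid_action p (tabloid_action (inv p) T) = T" "tabloid_action (inv p) (pair_tabloid n (p x) (p y)) = pair_tabloid n x y"
      using permutes_inv_o[OF assms] tabloid_action_pair_tabloid[OF permutes_inv[OF assms], of "p x" "p y"]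
        permutes_inverses[OF assms]
      by (simp_all add: tabloid_action_comp tabloid_action_id)
    then show ?thesis using tabloid_action_pair_tabloid[OF assms, of x y] by auto
  qed
  then show ?thesis by (simp add: fun_action_def quad_tabloid_def fun_eq_iff indicator_def)
qed

definition quad :: "nat \<Rightarrow> nat \<Rightarrow> nat \<Rightarrow> nat \<Rightarrow> nat \<Rightarrow> bool" where
  "quad n a b c d \<longleftrightarrow> {a, b, c, d} \<subseteq> {1..2 * n} \<and> distinct [a, b, c, d]"

lemma permutes_pair_cases:
  assumes "p permutes V" "p ` {a, b} = {a, b}"
  shows "p a = a \<and> p b = b \<or> p a = b \<and> p b = a"
proof (cases "a = b")
  case False
  then have "p a \<noteq> p b" using permutes_inj[OF assms(1)] by (auto dest: injD)
  then show ?thesis using assms(2) by (auto simp: doubleton_eq_iff)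
qed (use assms in auto)

text \<open>Only the first two columns have two cells. A permutation preserving every column fixes
  all other points and acts on {a, b} and {c, d} separately, so the column group is a Klein
  four-group.\<close>

lemma polytabloid_two_row:
  assumes n: "n \<ge> 2" and t: "tableau [2 * n - 2, 2] t"
  shows "polytabloid [2 * n - 2, 2] t = quad_tabloid n (t (0, 0)) (t (1, 0)) (t (0, 1)) (t (1, 1))"
    and "quad n (t (0, 0)) (t (1, 0)) (t (0, 1)) (t (1, 1))"
proof -
  let ?\<mu> = "[2 * n - 2, 2]" and ?V = "{1..2 * n}"
  define a b c d where "a = t (0, 0)" and "b = t (1, 0)" and "c = t (0, 1)" and "d = t (1, 1)"
  have D: "(i, j) \<in> diagram ?\<mu> \<longleftrightarrow> i = 0 \<and> j < 2 * n - 2 \<or> i = 1 \<and> j < 2" for i j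
    by (auto simp: diagram_def less_Suc_eq)
  have sum: "sum_list ?\<mu> = 2 * n" using n by simp
  have bij: "bij_betw t (diagram ?\<mu>) ?V" using t unfolding tableau_def sum .
  have inj: "t x = t y \<longleftrightarrow> x = y" if "x \<in> diagram ?\<mu>" "y \<in> diagram ?\<mu>" for x y
    using bij that by (auto simp: bij_betw_def inj_on_def)
  have tV: "t x \<in> ?V" if "x \<in> diagram ?\<mu>" for x using bij that by (auto simp: bij_betw_def)
  have cells: "(0, 0) \<in> diagram ?\<mu>" "(1, 0) \<in> diagram ?\<mu>" "(0, 1) \<in> diagram ?\<mu>" "(1, 1) \<in> diagram ?\<mu>"
    using n by (auto simp: D)
  show quad: "quad n (t (0, 0)) (t (1, 0)) (t (0, 1)) (t (1, 1))"
    unfolding quad_def using cells tV by (auto simp: inj)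
  have dist: "a \<noteq> b" "a \<noteq> c" "a \<noteq> d" "b \<noteq> c" "b \<noteq> d" "c \<noteq> d"
    and V: "a \<in> ?V" "b \<in> ?V" "c \<in> ?V" "d \<in> ?V"
    using quad by (auto simp: quad_def a_def b_def c_def d_def)
  have row1: "tableau_row ?\<mu> t 1 = {b, d}"
    by (auto simp: tableau_row_def D b_def d_def less_2_cases_iff)
  have row0: "tableau_row ?\<mu> t 0 = ?V - {b, d}"
  proof -
    have "tableau_row ?\<mu> t 0 \<union> tableau_row ?\<mu> t 1 = t ` diagram ?\<mu>"
      by (auto simp: tableau_row_def D image_iff)
    moreover have "tableau_row ?\<mu> t 0 \<inter> tableau_row ?\<mu> t 1 = {}"
      using inj by (fastforce simp: tableau_row_def D)
    ultimately show ?thesis using bij row1 by (auto simp: bij_betw_def)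
  qed
  have tabl: "tabloid ?\<mu> t = pair_tabloid n b d"
    using row0 row1 by (simp add: tabloid_def pair_tabloid_def numeral_2_eq_2)
  have col0: "tableau_column ?\<mu> t 0 = {a, b}" and col1: "tableau_column ?\<mu> t 1 = {c, d}"
    using n by (auto simp: tableau_column_def D a_def b_def c_def d_def)
  have colj: "tableau_column ?\<mu> t j = (if j < 2 * n - 2 then {t (0, j)} else {})" if "j \<ge> 2" for j
    using that by (auto simp: tableau_column_def D)
  let ?ab = "transpose a b" and ?cd = "transpose c d"
  have pab: "?ab permutes ?V" and pcd: "?cd permutes ?V" using V by (auto intro: permutes_swap_id)
  then have pabcd: "(?ab \<circ> ?cd) permutes ?V" by (intro permutes_compose)
  have cell: "x \<in> {a, b, c, d}" if "x \<in> ?V" "\<And>j. j \<ge> 2 \<Longrightarrow> j < 2 * n - 2 \<Longrightarrow> x \<noteq> t (0, j)" for x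
  proof -
    have "x \<in> t ` diagram ?\<mu>" using bij that(1) by (simp add: bij_betw_def)
    then obtain i j where ij: "x = t (i, j)" "(i, j) \<in> diagram ?\<mu>" by auto
    then have "j < 2" using that(2)[of j] by (cases "j < 2") (auto simp: D)
    then show ?thesis using ij by (auto simp: D a_def b_def c_def d_def less_2_cases_iff)
  qed
  have nocell: "t (0, j) \<notin> {a, b, c, d}" if "j \<ge> 2" "j < 2 * n - 2" for j
    using that cells inj[of "(0, j)"] by (auto simp: D a_def b_def c_def d_def)
  have "column_stabilizer ?\<mu> t = {id, ?ab, ?cd, ?ab \<circ> ?cd}"
  proof
    show "column_stabilizer ?\<mu> t \<subseteq> {id, ?ab, ?cd, ?ab \<circ> ?cd}"
    proof
      fix p assume "p \<in> column_stabilizer ?\<mu> t"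
      then have p: "p permutes ?V" "\<And>j. p ` tableau_column ?\<mu> t j = tableau_column ?\<mu> t j"
        unfolding column_stabilizer_def sum by auto
      have 1: "p a = a \<and> p b = b \<or> p a = b \<and> p b = a"
        using permutes_pair_cases[OF p(1)] p(2)[of 0] col0 by simp
      have 2: "p c = c \<and> p d = d \<or> p c = d \<and> p d = c"
        using permutes_pair_cases[OF p(1)] p(2)[of 1] col1 by simp
      have 3: "p x = x" if "x \<notin> {a, b, c, d}" for x
      proof (cases "x \<in> ?V")
        case True
        show ?thesis
        proof (rule ccontr)
          assume px: "p x \<noteq> x"
          have "x \<in> {a, b, c, d}"
          proof (rule cell[OF True])
            fix j assume j: "j \<ge> 2" "j < 2 * n - 2"
            show "x \<noteq> t (0, j)" using p(2)[of j] colj[OF j(1)] j(2) px by auto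
          qed
          then show False using that by contradiction
        qed
      qed (use p(1) in \<open>auto simp: permutes_def\<close>)
      have eqI: "p = q" if "p a = q a" "p b = q b" "p c = q c" "p d = q d"
        "\<And>x. x \<notin> {a, b, c, d} \<Longrightarrow> q x = x" for q
      proof
        fix x show "p x = q x" using that 3[of x] by (cases "x \<in> {a, b, c, d}") auto
      qed
      have "p = id \<or> p = ?ab \<or> p = ?cd \<or> p = ?ab \<circ> ?cd"
        using 1 2
      proof (elim disjE conjE, goal_cases)
        case 1 then show ?case by (intro disjI1 eqI) auto
      next
        case 2 then have "p = ?cd" using dist by (intro eqI) (auto simp: transpose_def)
        then show ?case by simp
      next
        case 3 then have "p = ?ab" using dist by (intro eqI) (auto simp: transpose_def)
        then show ?case by simp
      next
        case 4 then have "p = ?ab \<circ> ?cd" using dist by (intro eqI) (auto simp: transpose_def)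
        then show ?case by simp
      qed
      then show "p \<in> {id, ?ab, ?cd, ?ab \<circ> ?cd}" by simp
    qed
    show "{id, ?ab, ?cd, ?ab \<circ> ?cd} \<subseteq> column_stabilizer ?\<mu> t"
    proof -
      have inCS: "p \<in> column_stabilizer ?\<mu> t"
        if p: "p permutes ?V" "p ` {a, b} = {a, b}" "p ` {c, d} = {c, d}" "\<And>x. x \<notin> {a, b, c, d} \<Longrightarrow> p x = x"
        for p
      proof -
        have "p ` tableau_column ?\<mu> t j = tableau_column ?\<mu> t j" for j
        proof -
          consider "j = 0" | "j = 1" | "j \<ge> 2" by linarith
          then show ?thesis
            using p(2-4) col0 col1 colj[of j] nocell[of j] by cases auto
        qed
        then show ?thesis unfolding column_stabilizer_def sum using p(1) by simp
      qed
      have "?ab \<in> column_stabilizer ?\<mu> t" "?cd \<in> column_stabilizer ?\<mu> t"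
        "?ab \<circ> ?cd \<in> column_stabilizer ?\<mu> t" "id \<in> column_stabilizer ?\<mu> t"
        using dist pab pcd pabcd by (intro inCS; auto simp: transpose_def permutes_id)+
      then show ?thesis by simp
    qed
  qed
  \<comment> \<open>The polytabloid is a sum over a set, which expands into four terms only once the
    four permutations are known to be distinct.\<close>
  moreover have "id \<noteq> ?ab" "id \<noteq> ?cd" "id \<noteq> ?ab \<circ> ?cd" "?ab \<noteq> ?cd" "?ab \<noteq> ?ab \<circ> ?cd" "?cd \<noteq> ?ab \<circ> ?cd"
    using dist by (auto simp: fun_eq_iff transpose_def split: if_splits)
  moreover have "sign (?ab \<circ> ?cd) = 1"
    using dist by (simp add: sign_compose permutation_swap_id sign_swap_id)
  moreover have "?ab b = a" "?ab d = d" "?cd b = b" "?cd d = c" "(?ab \<circ> ?cd) b = a" "(?ab \<circ> ?cd) d = c"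
    using dist by (auto simp: transpose_def)
  ultimately have "polytabloid ?\<mu> t = quad_tabloid n a b c d"
    using dist tabloid_action_pair_tabloid[OF pab] tabloid_action_pair_tabloid[OF pcd] tabloid_action_pair_tabloid[OF pabcd]
    by (simp add: polytabloid_def tabl tabloid_action_id sign_swap_id cscale_def fun_eq_iff quad_tabloid_def
        del: comp_apply)
  then show "polytabloid [2 * n - 2, 2] t = quad_tabloid n (t (0, 0)) (t (1, 0)) (t (0, 1)) (t (1, 1))"
    by (simp add: a_def b_def c_def d_def)
qed

lemma ex_two_row_tableau:
  assumes n: "n \<ge> 2" and q: "quad n a b c d"
  shows "\<exists>t. tableau [2 * n - 2, 2] t \<and> t (0, 0) = a \<and> t (1, 0) = b \<and> t (0, 1) = c \<and> t (1, 1) = d"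
proof -
  let ?\<mu> = "[2 * n - 2, 2]" and ?V = "{1..2 * n}" and ?Q = "{a, b, c, d}"
  have Q: "?Q \<subseteq> ?V" "a \<noteq> b" "a \<noteq> c" "a \<noteq> d" "b \<noteq> c" "b \<noteq> d" "c \<noteq> d" using q by (auto simp: quad_def)
  then have "card (?V - ?Q) = card {2..<2 * n - 2}" by (simp add: card_Diff_subset)
  then obtain s where s: "bij_betw s {2..<2 * n - 2} (?V - ?Q)"
    using finite_same_card_bij[of "{2..<2 * n - 2}" "?V - ?Q"] by auto
  define t :: "nat \<times> nat \<Rightarrow> nat" where "t = (\<lambda>(i, j). if j = 0 then if i = 0 then a else b
    else if j = 1 then if i = 0 then c else d else s j)"
  have D: "diagram ?\<mu> = Pair 0 ` {2..<2 * n - 2} \<union> {(0, 0), (1, 0), (0, 1), (1, 1)}"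
    using n by (auto simp: diagram_def less_Suc_eq numeral_2_eq_2)
  have "bij_betw t (Pair 0 ` {2..<2 * n - 2}) (?V - ?Q)"
    using s by (simp add: bij_betw_def inj_on_def t_def image_image cong: image_cong_simp)
  moreover have "bij_betw t {(0, 0), (1, 0), (0, 1), (1, 1)} ?Q"
    using Q by (auto simp: bij_betw_def inj_on_def t_def)
  ultimately have "bij_betw t (diagram ?\<mu>) ((?V - ?Q) \<union> ?Q)"
    unfolding D by (rule bij_betw_combine) auto
  moreover have "(?V - ?Q) \<union> ?Q = ?V" using Q(1) by blast
  moreover have "sum_list ?\<mu> = 2 * n" using n by simp
  ultimately have "tableau ?\<mu> t" unfolding tableau_def by (simp only:)
  then show ?thesis by (intro exI[of _ t]) (simp add: t_def)
qed

lemma specht_module_two_row: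
  assumes "n \<ge> 2"
  shows "specht_module [2 * n - 2, 2] = cfun.span {quad_tabloid n a b c d | a b c d. quad n a b c d}"
proof -
  have "{polytabloid [2 * n - 2, 2] t | t. tableau [2 * n - 2, 2] t} = {quad_tabloid n a b c d | a b c d. quad n a b c d}"
  proof (intro equalityI subsetI)
    fix f assume "f \<in> {polytabloid [2 * n - 2, 2] t | t. tableau [2 * n - 2, 2] t}"
    then show "f \<in> {quad_tabloid n a b c d | a b c d. quad n a b c d}" using polytabloid_two_row[OF assms] by blast
  next
    fix f assume "f \<in> {quad_tabloid n a b c d | a b c d. quad n a b c d}"
    then obtain a b c d where f: "f = quad_tabloid n a b c d" "quad n a b c d" by blast
    obtain t where t: "tableau [2 * n - 2, 2] t" "t (0, 0) = a" "t (1, 0) = b" "t (0, 1) = c" "t (1, 1) = d"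
      using ex_two_row_tableau[OF assms f(2)] by blast
    have "f = polytabloid [2 * n - 2, 2] t" unfolding polytabloid_two_row(1)[OF assms t(1)] t(2-5) f(1) ..
    then show "f \<in> {polytabloid [2 * n - 2, 2] t | t. tableau [2 * n - 2, 2] t}" using t(1) by blast
  qed
  then show ?thesis by (simp add: specht_module_def)
qed

section \<open>Summation over the edges of a matching\<close>

lemma card_perfect_matching:
  assumes "M \<in> perfect_matchings n"
  shows "finite M" "card M = n"
proof -
  have M: "M \<in> matchings {1..2 * n}" using assms by (simp add: perfect_matchings_eq_matchings)
  show "finite M" by (rule finite_subset[of _ "Pow {1..2 * n}"]) (use M in \<open>auto simp: matchings_def\<close>)
  have "finite e" if "e \<in> M" for e using finite_subset[OF matchings_edgeD(1)[OF M that]] by simp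
  then have "(\<Sum>e\<in>M. card e) = card (\<Union>M)"
    using matchings_edge_unique[OF M]
    by (intro card_Union_disjoint[symmetric]) (auto simp: pairwise_def disjnt_def)
  also have "\<Union>M = {1..2 * n}" using matchings_edgeD(1)[OF M] matchings_partner[OF M] by blast
  also have "(\<Sum>e\<in>M. card e) = 2 * card M" using matchings_edgeD(2)[OF M] by simp
  finally show "card M = n" by simp
qed

text \<open>The tabloids of shape [2 n - 2, 2] correspond to the edges of the complete graph; this
  is the map from functions on edges to functions on matchings that sends an edge to the indicator
  of the matchings through it.\<close>

definition edge_sum :: "nat \<Rightarrow> (nat set list \<Rightarrow> complex) \<Rightarrow> nat set set \<Rightarrow> complex" where
  "edge_sum n g M = (if M \<in> perfect_matchings n then \<Sum>e\<in>M. g [{1..2 * n} - e, e] else 0)"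

lemma edge_sum_linear:
  "edge_sum n (f + g) = edge_sum n f + edge_sum n g"
  "edge_sum n (cscale c f) = cscale c (edge_sum n f)"
  by (auto simp: edge_sum_def cscale_def fun_eq_iff sum.distrib sum_distrib_left)

lemma edge_sum_equivariant:
  assumes "p permutes {1..2 * n}"
  shows "edge_sum n (fun_action tabloid_action p g) = fun_action matching_action p (edge_sum n g)"
proof
  fix M
  have inj: "inj (inv p)" using permutes_inj[OF permutes_inv[OF assms]] .
  have "(\<Sum>e\<in>matching_action (inv p) M. g [{1..2 * n} - e, e])
      = (\<Sum>e\<in>M. g [{1..2 * n} - inv p ` e, inv p ` e])"
    unfolding matching_action_def using inj
    by (subst sum.reindex) (auto simp: inj_on_def inj_image_eq_iff)
  also have "\<dots> = (\<Sum>e\<in>M. fun_action tabloid_action p g [{1..2 * n} - e, e])"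
    using permutes_image[OF permutes_inv[OF assms]]
    by (simp add: fun_action_def tabloid_action_def image_set_diff[OF inj])
  finally show "edge_sum n (fun_action tabloid_action p g) M = fun_action matching_action p (edge_sum n g) M"
    using matching_action_permutes[OF permutes_inv[OF assms]]
    by (simp add: edge_sum_def fun_action_def[of matching_action])
qed

lemma edge_sum_quad_tabloid:
  assumes "M \<in> perfect_matchings n"
  shows "edge_sum n (quad_tabloid n a b c d) M = of_real (edge M b d - edge M a d - edge M b c + edge M a c)"
proof -
  have "(\<Sum>e\<in>M. indicator {pair_tabloid n x y} [{1..2 * n} - e, e]) = (of_real (edge M x y) :: complex)" for x y
  proof -
    have "(\<Sum>e\<in>M. indicator {pair_tabloid n x y} [{1..2 * n} - e, e]) = (\<Sum>e\<in>M. if e = {x, y} then 1 else (0 :: complex))"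
      by (intro sum.cong refl) (auto simp: pair_tabloid_def indicator_def)
    then show ?thesis using card_perfect_matching(1)[OF assms] by (simp add: edge_def)
  qed
  then show ?thesis using assms by (simp add: edge_sum_def quad_tabloid_def sum.distrib sum_subtractf)
qed

text \<open>Functions on pairs of points whose sum over the pairs at each point is zero. This space
  contains the Specht module and replaces its span by linear equations that can be computed
  with.\<close>

definition balanced :: "nat \<Rightarrow> (nat set list \<Rightarrow> complex) set" where
  "balanced n = {g. (\<forall>T. (\<forall>x\<in>{1..2 * n}. \<forall>y\<in>{1..2 * n} - {x}. T \<noteq> pair_tabloid n x y) \<longrightarrow> g T = 0)
     \<and> (\<forall>x\<in>{1..2 * n}. (\<Sum>y\<in>{1..2 * n} - {x}. g (pair_tabloid n x y)) = 0)}"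

lemma balanced_supp: "g \<in> balanced n \<Longrightarrow> g T \<noteq> 0 \<Longrightarrow>
    \<exists>x y. x \<in> {1..2 * n} \<and> y \<in> {1..2 * n} \<and> x \<noteq> y \<and> T = pair_tabloid n x y"
  unfolding balanced_def by blast

lemma balanced_row: "g \<in> balanced n \<Longrightarrow> x \<in> {1..2 * n} \<Longrightarrow> (\<Sum>y\<in>{1..2 * n} - {x}. g (pair_tabloid n x y)) = 0"
  unfolding balanced_def by blast

text \<open>Each of a, b, c, d lies in one pair with sign + and one with sign -.\<close>

lemma quad_tabloid_balanced:
  assumes "quad n a b c d"
  shows "quad_tabloid n a b c d \<in> balanced n"
proof -
  let ?V = "{1..2 * n}"
  have V: "a \<in> ?V" "b \<in> ?V" "c \<in> ?V" "d \<in> ?V" "b \<noteq> d" "a \<noteq> d" "b \<noteq> c" "a \<noteq> c"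
    using assms by (auto simp: quad_def)
  have row: "(\<Sum>y\<in>?V - {x}. indicator {pair_tabloid n u w} (pair_tabloid n x y)) = (if x \<in> {u, w} then 1 else (0 :: complex))"
    if "u \<in> ?V" "w \<in> ?V" "u \<noteq> w" "x \<in> ?V" for u w x
  proof -
    have e: "indicator {pair_tabloid n u w} (pair_tabloid n x y)
        = (if y = w then if x = u then 1 else 0 else 0) + (if y = u then if x = w then 1 else (0 :: complex) else 0)" for y
      using that(3) by (auto simp: indicator_def pair_tabloid_eq_iff doubleton_eq_iff)
    show ?thesis unfolding e using that by (auto simp: sum.distrib)
  qed
  have "(\<Sum>y\<in>?V - {x}. quad_tabloid n a b c d (pair_tabloid n x y)) = 0" if "x \<in> ?V" for x
  proof -
    have "(\<Sum>y\<in>?V - {x}. quad_tabloid n a b c d (pair_tabloid n x y))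
        = (if x \<in> {b, d} then 1 else 0) - (if x \<in> {a, d} then 1 else 0)
          - (if x \<in> {b, c} then 1 else 0) + (if x \<in> {a, c} then 1 else 0)"
      unfolding quad_tabloid_def sum.distrib sum_subtractf using row V that by presburger
    also have "\<dots> = 0" using assms by (auto simp: quad_def)
    finally show ?thesis .
  qed
  moreover have "quad_tabloid n a b c d T = 0" if "\<forall>x\<in>?V. \<forall>y\<in>?V - {x}. T \<noteq> pair_tabloid n x y" for T
    using that V by (auto simp: quad_tabloid_def)
  ultimately show ?thesis by (simp add: balanced_def)
qed

lemma balanced_subspace: "cfun.subspace (balanced n)"
  by (auto simp: cfun.subspace_def balanced_def cscale_def sum.distrib simp flip: sum_distrib_left)

lemma specht_balanced: "n \<ge> 2 \<Longrightarrow> specht_module [2 * n - 2, 2] \<subseteq> balanced n"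
  unfolding specht_module_two_row
  by (intro cfun.span_minimal balanced_subspace) (auto simp: quad_tabloid_balanced)

lemma ex_matching_with_two_edges:
  assumes "quad n a b c d"
  shows "\<exists>N. N \<in> matchings ({1..2 * n} - {a, b} - {c, d})"
proof -
  let ?V = "{1..2 * n}"
  have "card (?V - {a, b} - {c, d}) = 2 * (n - 2)"
    using assms by (auto simp: quad_def card_Diff_subset Diff_insert2[symmetric])
  then have "real (card (matchings (?V - {a, b} - {c, d}))) = odd_fact (n - 2)" by (intro card_matchings) auto
  then have "matchings (?V - {a, b} - {c, d}) \<noteq> {}" using odd_fact_pos[of "n - 2"] by auto
  then show ?thesis by blast
qed

text \<open>Two matchings that differ only on four points give the exchange relation G a b + G c d =
  G a c + G b d. Summed against the zero row sums it forces all values of G to agree along rows, so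
  G is zero.\<close>

lemma edge_sum_inj:
  assumes n: "n \<ge> 2" and g: "g \<in> balanced n" and z: "edge_sum n g = 0"
  shows "g = 0"
proof -
  let ?V = "{1..2 * n}"
  define G where "G = (\<lambda>x y. g (pair_tabloid n x y))"
  have Gs: "G x y = G y x" for x y by (simp add: G_def pair_tabloid_commute)
  have row: "(\<Sum>y\<in>?V - {x}. G x y) = 0" if "x \<in> ?V" for x
    using balanced_row[OF g that] by (simp add: G_def)
  have M: "insert {a, b} (insert {c, d} N) \<in> perfect_matchings n"
      "G a b + G c d + (\<Sum>e\<in>N. g [?V - e, e]) = 0"
    if q: "quad n a b c d" and N: "N \<in> matchings (?V - {a, b} - {c, d})" for a b c d N
  proof -
    have V: "a \<in> ?V" "b \<in> ?V" "a \<noteq> b" "c \<in> ?V - {a, b}" "d \<in> ?V - {a, b}" "c \<noteq> d"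
      using q by (auto simp: quad_def)
    note 1 = matchings_insert[OF V(4-6) N]
    note 2 = matchings_insert[OF V(1-3) 1(1)]
    show M: "insert {a, b} (insert {c, d} N) \<in> perfect_matchings n"
      using 2(1) by (simp add: perfect_matchings_eq_matchings)
    have "finite N" using card_perfect_matching(1)[OF M] by simp
    then have "(\<Sum>e\<in>insert {a, b} (insert {c, d} N). g [?V - e, e]) = G a b + G c d + (\<Sum>e\<in>N. g [?V - e, e])"
      using 1(2) 2(2) by (simp add: G_def pair_tabloid_def add.assoc)
    then show "G a b + G c d + (\<Sum>e\<in>N. g [?V - e, e]) = 0"
      using fun_cong[OF z, of "insert {a, b} (insert {c, d} N)"] M by (simp add: edge_sum_def)
  qed
  have exch: "G a b + G c d = G a c + G b d" if q: "quad n a b c d" for a b c d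
  proof -
    obtain N where N: "N \<in> matchings (?V - {a, b} - {c, d})" using ex_matching_with_two_edges[OF q] by blast
    have "?V - {a, b} - {c, d} = ?V - {a, c} - {b, d}" by auto
    moreover have "quad n a c b d" using q by (auto simp: quad_def)
    ultimately show ?thesis using M(2)[OF q N] M(2)[of a c b d N] N by (simp add: add_eq_0_iff2)
  qed
  \<comment> \<open>Sum the exchange relation over the fourth point w. The row sums turn this into
    (2 n - 2) (G x z - G y z) = 0.\<close>
  have star: "G x z = G y z" if V: "x \<in> ?V" "y \<in> ?V" "z \<in> ?V" "x \<noteq> y" "x \<noteq> z" "y \<noteq> z" for x y z
  proof -
    have D: "?V - {x} - {y, z} = ?V - {x, y, z}" "?V - {y} - {x, z} = ?V - {x, y, z}" by auto
    have s1: "(\<Sum>w\<in>?V - {x, y, z}. G x w) = - G x y - G x z"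
      using row[OF V(1)] V by (simp add: sum_diff flip: D(1))
    have s2: "(\<Sum>w\<in>?V - {x, y, z}. G y w) = - G y x - G y z"
      using row[OF V(2)] V by (simp add: sum_diff flip: D(2))
    have "(\<Sum>w\<in>?V - {x, y, z}. G x z + G y w) = (\<Sum>w\<in>?V - {x, y, z}. G x w + G y z)"
    proof (rule sum.cong[OF refl])
      fix w assume "w \<in> ?V - {x, y, z}"
      then have "quad n x z w y" using V by (auto simp: quad_def)
      then show "G x z + G y w = G x w + G y z" using exch[of x z w y] by (simp add: Gs)
    qed
    then have "of_nat (card (?V - {x, y, z})) * G x z - G y x - G y z
        = of_nat (card (?V - {x, y, z})) * G y z - G x y - G x z"
      unfolding sum.distrib s1 s2 sum_constant by (simp add: algebra_simps)
    then have "(of_nat (card (?V - {x, y, z})) + 1) * (G x z - G y z) = 0"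
      by (simp add: algebra_simps Gs)
    moreover have "(of_nat (card (?V - {x, y, z})) + 1 :: complex) \<noteq> 0"
      by (metis of_nat_Suc of_nat_neq_0 add.commute)
    ultimately show ?thesis by simp
  qed
  have zero: "G z x = 0" if V: "x \<in> ?V" "z \<in> ?V" "x \<noteq> z" for x z
  proof -
    have "(\<Sum>y\<in>?V - {z}. G z y) = (\<Sum>y\<in>?V - {z}. G z x)"
    proof (rule sum.cong[OF refl])
      fix y assume "y \<in> ?V - {z}"
      then show "G z y = G z x" using star[of x y z] V by (cases "x = y") (auto simp: Gs)
    qed
    then have "of_nat (card (?V - {z})) * G z x = 0" using row[OF V(2)] by simp
    moreover have "card (?V - {z}) \<noteq> 0" using V n by simp
    ultimately show ?thesis by (metis mult_eq_0_iff of_nat_eq_0_iff)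
  qed
  show ?thesis
  proof
    fix T
    show "g T = 0 T"
    proof (rule ccontr)
      assume "g T \<noteq> 0 T"
      then obtain x y where xy: "x \<in> ?V" "y \<in> ?V" "x \<noteq> y" "T = pair_tabloid n x y"
        using balanced_supp[OF g, of T] by auto
      then show False using zero[of y x] \<open>g T \<noteq> 0 T\<close> by (simp add: G_def)
    qed
  qed
qed

section \<open>Averaging over the stabilizer of a matching\<close>

text \<open>The hyperoctahedral group of M, permuting the n edges and flipping each of them.\<close>

definition stab :: "nat \<Rightarrow> nat set set \<Rightarrow> (nat \<Rightarrow> nat) set" where
  "stab n M = {p. p permutes {1..2 * n} \<and> matching_action p M = M}"

lemma swap_edge_in_stab:
  assumes "M \<in> perfect_matchings n" "{a, b} \<in> M"
  shows "transpose a b \<in> stab n M"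
proof -
  have M: "M \<in> matchings {1..2 * n}" using assms by (simp add: perfect_matchings_eq_matchings)
  have "transpose a b ` e = e" if e: "e \<in> M" for e
  proof (cases "e = {a, b}")
    case False
    then have "a \<notin> e" "b \<notin> e" using matchings_edge_unique[OF M e assms(2)] by auto
    then show ?thesis by (auto simp: transpose_def image_iff)
  qed auto
  then have "matching_action (transpose a b) M = M" by (simp add: matching_action_def)
  then show ?thesis
    using matchings_pairD[OF M assms(2)] by (auto simp: stab_def intro: permutes_swap_id)
qed

lemma swap_edges_in_stab:
  assumes "M \<in> perfect_matchings n" "{a, b} \<in> M" "{c, d} \<in> M" "{a, b} \<noteq> {c, d}"
  shows "transpose a c \<circ> transpose b d \<in> stab n M"
proof -
  have M: "M \<in> matchings {1..2 * n}" using assms by (simp add: perfect_matchings_eq_matchings)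
  let ?p = "transpose a c \<circ> transpose b d"
  have dist: "a \<noteq> b" "c \<noteq> d" "a \<noteq> c" "a \<noteq> d" "b \<noteq> c" "b \<noteq> d"
    using matchings_pairD(3)[OF M assms(2)] matchings_pairD(3)[OF M assms(3)]
      matchings_edge_unique[OF M assms(2,3)] assms(4) by auto
  have "?p ` e = (if e = {a, b} then {c, d} else if e = {c, d} then {a, b} else e)" if e: "e \<in> M" for e
  proof -
    consider "e = {a, b}" | "e = {c, d}" | "e \<noteq> {a, b}" "e \<noteq> {c, d}" by blast
    then show ?thesis
    proof cases
      case 3
      then have "a \<notin> e" "b \<notin> e" "c \<notin> e" "d \<notin> e"
        using matchings_edge_unique[OF M e assms(2)] matchings_edge_unique[OF M e assms(3)] by auto
      then have "?p ` e = (\<lambda>x. x) ` e" by (intro image_cong) (auto simp: transpose_def)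
      then show ?thesis using 3 by simp
    qed (use dist assms(4) in \<open>auto simp: transpose_def\<close>)
  qed
  then have "matching_action ?p M = (\<lambda>e. if e = {a, b} then {c, d} else if e = {c, d} then {a, b} else e) ` M"
    unfolding matching_action_def by (intro image_cong) auto
  also have "\<dots> = M" using assms(2-4) by (auto simp: image_iff)
  finally have "matching_action ?p M = M" .
  moreover have "?p permutes {1..2 * n}"
    using matchings_pairD[OF M assms(2)] matchings_pairD[OF M assms(3)]
    by (intro permutes_compose permutes_swap_id) auto
  ultimately show ?thesis by (simp add: stab_def)
qed

text \<open>An invariant function takes one value on the edges of M and is constant on the non-edges
  at each point x. As x lies on one edge and 2 n - 2 non-edges, the zero row sum determines the
  second value from the first, so the invariant balanced functions form at most a line.\<close>

lemma stab_invariant_values: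
  assumes n: "n \<ge> 2" and M: "M \<in> perfect_matchings n" and u: "u \<in> balanced n"
    and inv: "\<And>q. q \<in> stab n M \<Longrightarrow> fun_action tabloid_action q u = u"
    and ab: "{a, b} \<in> M" and xy: "x \<in> {1..2 * n}" "y \<in> {1..2 * n}" "x \<noteq> y"
  shows "u (pair_tabloid n x y) = (if {x, y} \<in> M then u (pair_tabloid n a b) else - u (pair_tabloid n a b) / of_nat (2 * n - 2))"
proof -
  let ?V = "{1..2 * n}"
  define G where "G = (\<lambda>x y. u (pair_tabloid n x y))"
  have MV: "M \<in> matchings ?V" using M by (simp add: perfect_matchings_eq_matchings)
  have Gs: "G x y = G y x" for x y by (simp add: G_def pair_tabloid_commute)
  have Ginv: "G (q x) (q y) = G x y" if "q \<in> stab n M" for q x y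
  proof -
    have q: "q permutes ?V" using that by (simp add: stab_def)
    have "u (pair_tabloid n (q x) (q y)) = fun_action tabloid_action q u (pair_tabloid n (q x) (q y))" using inv[OF that] by simp
    also have "\<dots> = u (pair_tabloid n x y)"
      using tabloid_action_pair_tabloid[OF permutes_inv[OF q]] permutes_inverses[OF q] by (simp add: fun_action_def)
    finally show ?thesis by (simp add: G_def)
  qed
  have edge: "G c d = G a b" if cd: "{c, d} \<in> M" for c d
  proof (cases "{a, b} = {c, d}")
    case True
    then show ?thesis by (auto simp: doubleton_eq_iff Gs)
  next
    case False
    have "(transpose a c \<circ> transpose b d) a = c" "(transpose a c \<circ> transpose b d) b = d"
      using matchings_pairD(3)[OF MV ab] matchings_pairD(3)[OF MV cd] matchings_edge_unique[OF MV ab cd] False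
      by (auto simp: transpose_def)
    then show ?thesis using Ginv[OF swap_edges_in_stab[OF M ab cd False], of a b] by simp
  qed
  \<comment> \<open>If w and w' are matched, flip their edge; otherwise exchange the edges through
    them. Both permutations fix x, since x is matched to neither w nor w'.\<close>
  have nonedge: "G x w = G x w'"
    if w: "w \<in> ?V" "w' \<in> ?V" "x \<noteq> w" "x \<noteq> w'" "{x, w} \<notin> M" "{x, w'} \<notin> M" for w w'
  proof (cases "w = w'")
    case False
    show ?thesis
    proof (cases "{w, w'} \<in> M")
      case True
      then show ?thesis
        using Ginv[OF swap_edge_in_stab[OF M True], of x w] w by (simp add: transpose_def)
    next
      case F: False
      obtain s where s: "s \<in> ?V" "s \<noteq> w" "{w, s} \<in> M" using matchings_partner[OF MV w(1)] .
      obtain s' where s': "s' \<in> ?V" "s' \<noteq> w'" "{w', s'} \<in> M" using matchings_partner[OF MV w(2)] .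
      have "{w, s} \<noteq> {w', s'}" using False F s s' by (auto simp: doubleton_eq_iff)
      note q = swap_edges_in_stab[OF M s(3) s'(3) this]
      have "x \<noteq> s" "x \<noteq> s'" using w s s' by (auto simp: insert_commute)
      moreover have "w \<noteq> s'" "w \<noteq> s" "s \<noteq> s'"
        using s s' matchings_edge_unique[OF MV s(3) s'(3)] \<open>{w, s} \<noteq> {w', s'}\<close> by auto
      ultimately show ?thesis using Ginv[OF q, of x w] w by (simp add: transpose_def split: if_splits)
    qed
  qed simp
  show ?thesis
  proof (cases "{x, y} \<in> M")
    case True
    then show ?thesis using edge[OF True] by (simp add: G_def)
  next
    case False
    obtain s where s: "s \<in> ?V" "s \<noteq> x" "{x, s} \<in> M" using matchings_partner[OF MV xy(1)] .
    have D: "?V - {x} - {s} = ?V - {x, s}" by auto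
    have "0 = (\<Sum>w\<in>?V - {x}. G x w)" using balanced_row[OF u xy(1)] by (simp add: G_def)
    also have "\<dots> = G x s + (\<Sum>w\<in>?V - {x, s}. G x w)" using s by (simp only: D[symmetric]) (subst sum.remove[of "?V - {x}" s], auto)
    also have "(\<Sum>w\<in>?V - {x, s}. G x w) = (\<Sum>w\<in>?V - {x, s}. G x y)"
    proof (rule sum.cong[OF refl])
      fix w assume w: "w \<in> ?V - {x, s}"
      then have "{x, w} \<notin> M" using matchings_pair_unique[OF MV s(3), of w] by auto
      then show "G x w = G x y" using w xy False by (intro nonedge) auto
    qed
    also have "\<dots> = of_nat (2 * n - 2) * G x y" using s xy by (simp add: card_Diff_subset)
    also have "G x s = G a b" using edge[OF s(3)] .
    finally have "G a b + of_nat (2 * n - 2) * G x y = 0" by simp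
    moreover have "(of_nat (2 * n - 2) :: complex) \<noteq> 0" using n by simp
    ultimately have "G x y = - G a b / of_nat (2 * n - 2)"
      by (simp add: eq_divide_eq add_eq_0_iff2 mult.commute)
    then show ?thesis using False by (simp add: G_def)
  qed
qed

definition stab_sum :: "nat \<Rightarrow> nat set set \<Rightarrow> (nat set list \<Rightarrow> complex) \<Rightarrow> nat set list \<Rightarrow> complex" where
  "stab_sum n M g = (\<Sum>p\<in>stab n M. fun_action tabloid_action p g)"

lemma finite_stab: "finite (stab n M)"
  by (rule finite_subset[OF _ finite_permutations[of "{1..2 * n}"]]) (auto simp: stab_def)

lemma id_in_stab: "id \<in> stab n M"
  by (simp add: stab_def permutes_id matching_action_id)

lemma stab_comp: "p \<in> stab n M \<Longrightarrow> q \<in> stab n M \<Longrightarrow> p \<circ> q \<in> stab n M"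
  by (auto simp: stab_def permutes_compose simp flip: matching_action_comp)

lemma stab_inv:
  assumes "p \<in> stab n M"
  shows "inv p \<in> stab n M"
proof -
  have p: "p permutes {1..2 * n}" using assms by (simp add: stab_def)
  have "matching_action (inv p) (matching_action p M) = M"
    using permutes_inv_o[OF p] by (simp add: matching_action_comp matching_action_id)
  then show ?thesis using assms permutes_inv[OF p] by (simp add: stab_def)
qed

lemma stab_sum_invariant:
  assumes q: "q \<in> stab n M"
  shows "fun_action tabloid_action q (stab_sum n M g) = stab_sum n M g"
proof -
  have Q: "q permutes {1..2 * n}" using q by (simp add: stab_def)
  have "fun_action tabloid_action q (stab_sum n M g)
      = (\<Sum>p\<in>stab n M. fun_action tabloid_action q (fun_action tabloid_action p g))"
    by (simp add: stab_sum_def fun_action_def sum_apply fun_eq_iff)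
  also have "\<dots> = (\<Sum>p\<in>stab n M. fun_action tabloid_action (q \<circ> p) g)"
    using Q by (intro sum.cong refl fun_action_comp) (auto simp: stab_def)
  also have "\<dots> = stab_sum n M g"
    unfolding stab_sum_def
    by (rule sum.reindex_bij_witness[of _ "\<lambda>p. inv q \<circ> p" "\<lambda>p. q \<circ> p"])
      (auto simp: stab_comp q stab_inv permutes_inv_o[OF Q] simp flip: o_assoc, simp_all add: o_assoc permutes_inv_o[OF Q])
  finally show ?thesis .
qed

lemma stab_sum_in:
  assumes "cfun.subspace W" "\<And>p. p permutes {1..2 * n} \<Longrightarrow> fun_action tabloid_action p g \<in> W"
  shows "stab_sum n M g \<in> W"
  unfolding stab_sum_def using assms by (intro cfun.subspace_sum) (auto simp: stab_def)

text \<open>The stabilizer fixes M, so each summand has the same value at M. \<open>T\<close> is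
  additive only on \<open>W\<close>, hence the induction over the finite sum carries membership in
  \<open>W\<close> along.\<close>

lemma equivariant_stab_sum:
  fixes T :: "(nat set list \<Rightarrow> complex) \<Rightarrow> nat set set \<Rightarrow> complex"
  assumes W: "cfun.subspace W" "\<And>p f. p permutes {1..2 * n} \<Longrightarrow> f \<in> W \<Longrightarrow> fun_action tabloid_action p f \<in> W"
    and add: "\<And>f g. f \<in> W \<Longrightarrow> g \<in> W \<Longrightarrow> T (f + g) = T f + T g"
    and equi: "\<And>p f. p permutes {1..2 * n} \<Longrightarrow> f \<in> W \<Longrightarrow>
          T (fun_action tabloid_action p f) = fun_action matching_action p (T f)"
    and g: "g \<in> W"
  shows "T (stab_sum n M g) M = of_nat (card (stab n M)) * T g M"
proof -
  have T0: "T 0 = 0" using add[of 0 0] cfun.subspace_0[OF W(1)] by simp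
  have *: "(\<Sum>p\<in>P. fun_action tabloid_action p g) \<in> W
      \<and> T (\<Sum>p\<in>P. fun_action tabloid_action p g) = (\<Sum>p\<in>P. T (fun_action tabloid_action p g))"
    if "finite P" "P \<subseteq> stab n M" for P
    using that
  proof (induction P rule: finite_induct)
    case empty
    then show ?case using T0 cfun.subspace_0[OF W(1)] by (simp only: sum.empty)
  next
    case (insert p P)
    then have 1: "fun_action tabloid_action p g \<in> W" using W(2) g by (auto simp: stab_def)
    have 2: "(\<Sum>p\<in>P. fun_action tabloid_action p g) \<in> W"
      "T (\<Sum>p\<in>P. fun_action tabloid_action p g) = (\<Sum>p\<in>P. T (fun_action tabloid_action p g))"
      using insert by auto
    show ?case
      unfolding sum.insert[OF insert(1,2)] add[OF 1 2(1)] 2(2)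
      by (intro conjI refl cfun.subspace_add[OF W(1) 1 2(1)])
  qed
  have "T (stab_sum n M g) M = (\<Sum>p\<in>stab n M. T (fun_action tabloid_action p g) M)"
    using *[OF finite_stab subset_refl] by (simp add: stab_sum_def sum_apply)
  also have "\<dots> = (\<Sum>p\<in>stab n M. T g M)"
  proof (rule sum.cong[OF refl])
    fix p assume p: "p \<in> stab n M"
    then have "T (fun_action tabloid_action p g) = fun_action matching_action p (T g)"
      using equi g by (simp add: stab_def)
    then show "T (fun_action tabloid_action p g) M = T g M"
      using stab_inv[OF p] by (simp add: fun_action_def stab_def)
  qed
  finally show ?thesis by simp
qed

text \<open>Frobenius reciprocity by hand: the value of T f at M0 depends only on the average of f
  over the stabilizer of M0, and the averages lie on a line. So T and \<open>edge_sum\<close> are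
  proportional at M0, and equivariance carries this to every matching.\<close>

lemma schur_two_row:
  fixes T :: "(nat set list \<Rightarrow> complex) \<Rightarrow> nat set set \<Rightarrow> complex"
  assumes n: "n \<ge> 2"
    and W: "cfun.subspace W" "\<And>p f. p permutes {1..2 * n} \<Longrightarrow> f \<in> W \<Longrightarrow> fun_action tabloid_action p f \<in> W"
      "W \<subseteq> balanced n"
    and M0: "M0 \<in> perfect_matchings n" and g0: "g0 \<in> W" "edge_sum n g0 M0 \<noteq> 0"
    and supp: "\<And>f. f \<in> W \<Longrightarrow> T f \<in> functions_on (perfect_matchings n)"
    and add: "\<And>f g. f \<in> W \<Longrightarrow> g \<in> W \<Longrightarrow> T (f + g) = T f + T g"
    and scale: "\<And>c f. f \<in> W \<Longrightarrow> T (cscale c f) = cscale c (T f)"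
    and equi: "\<And>p f. p permutes {1..2 * n} \<Longrightarrow> f \<in> W \<Longrightarrow>
          T (fun_action tabloid_action p f) = fun_action matching_action p (T f)"
  shows "\<exists>\<kappa>. \<forall>f\<in>W. T f = cscale \<kappa> (edge_sum n f)"
proof -
  let ?V = "{1..2 * n}"
  define \<kappa> where "\<kappa> = T g0 M0 / edge_sum n g0 M0"
  have M0V: "M0 \<in> matchings ?V" using M0 by (simp add: perfect_matchings_eq_matchings)
  have "1 \<in> ?V" using n by simp
  from matchings_partner[OF M0V this] obtain b where ab: "{1, b} \<in> M0" .
  define B where "B = (of_nat (card (stab n M0)) :: complex)"
  have B: "B \<noteq> 0"
    using id_in_stab[of n M0] finite_stab[of n M0] by (auto simp: B_def card_eq_0_iff)
  have es: "edge_sum n (stab_sum n M0 g) M0 = B * edge_sum n g M0" if "g \<in> W" for g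
    unfolding B_def
  proof (rule equivariant_stab_sum[OF W(1,2) _ _ that])
    show "edge_sum n (f + h) = edge_sum n f + edge_sum n h" for f h by (rule edge_sum_linear)
    show "edge_sum n (fun_action tabloid_action p f) = fun_action matching_action p (edge_sum n f)"
      if "p permutes ?V" for p f using that by (rule edge_sum_equivariant)
  qed
  have Ts: "T (stab_sum n M0 g) M0 = B * T g M0" if "g \<in> W" for g
    unfolding B_def by (rule equivariant_stab_sum[OF W(1,2) add equi that])
  have sW: "stab_sum n M0 g \<in> W" if "g \<in> W" for g
    using W that by (intro stab_sum_in) auto
  define \<alpha> where "\<alpha> = (\<lambda>g. stab_sum n M0 g (pair_tabloid n 1 b))"
  have val: "stab_sum n M0 g (pair_tabloid n x y) = \<alpha> g * (if {x, y} \<in> M0 then 1 else - 1 / of_nat (2 * n - 2))"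
    if "g \<in> W" "x \<in> ?V" "y \<in> ?V" "x \<noteq> y" for g x y
    using stab_invariant_values[OF n M0 _ stab_sum_invariant[of _ n M0 g] ab that(2-4)] sW[OF that(1)] W(3)
    by (auto simp: \<alpha>_def)
  have es\<alpha>: "edge_sum n (stab_sum n M0 g) M0 = of_nat n * \<alpha> g" if g: "g \<in> W" for g
  proof -
    have "(\<Sum>e\<in>M0. stab_sum n M0 g [?V - e, e]) = (\<Sum>e\<in>M0. \<alpha> g)"
    proof (rule sum.cong[OF refl])
      fix e assume e: "e \<in> M0"
      have M: "M0 \<in> matchings ?V" using M0 by (simp add: perfect_matchings_eq_matchings)
      obtain x y where xy: "e = {x, y}" "x \<noteq> y" using matchings_edgeD(2)[OF M e] by (auto simp: card_2_iff)
      then show "stab_sum n M0 g [?V - e, e] = \<alpha> g"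
        using val[OF g, of x y] matchings_edgeD(1)[OF M e] e by (simp add: pair_tabloid_def)
    qed
    then show ?thesis using M0 card_perfect_matching(2)[OF M0] by (simp add: edge_sum_def)
  qed
  have at0: "T g M0 = \<kappa> * edge_sum n g M0" if g: "g \<in> W" for g
  proof -
    \<comment> \<open>Proportionality of the two averages, cross-multiplied so that it can be fed
      into T without dividing by \<alpha>.\<close>
    have "cscale (\<alpha> g0) (stab_sum n M0 g) = cscale (\<alpha> g) (stab_sum n M0 g0)"
    proof
      fix t
      show "cscale (\<alpha> g0) (stab_sum n M0 g) t = cscale (\<alpha> g) (stab_sum n M0 g0) t"
      proof (cases "\<exists>x y. x \<in> ?V \<and> y \<in> ?V \<and> x \<noteq> y \<and> t = pair_tabloid n x y")
        case True
        then show ?thesis using val[OF g] val[OF g0(1)] by (auto simp: cscale_def)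
      next
        case False
        then have "stab_sum n M0 g t = 0" "stab_sum n M0 g0 t = 0"
          using balanced_supp sW[OF g] sW[OF g0(1)] W(3) by blast+
        then show ?thesis by (simp add: cscale_def)
      qed
    qed
    then have "cscale (\<alpha> g0) (T (stab_sum n M0 g)) M0 = cscale (\<alpha> g) (T (stab_sum n M0 g0)) M0"
      using scale[OF sW[OF g]] scale[OF sW[OF g0(1)]] by metis
    then have "B * (\<alpha> g0 * T g M0) = B * (\<alpha> g * T g0 M0)"
      using Ts[OF g] Ts[OF g0(1)] by (simp add: cscale_def mult_ac)
    then have 1: "\<alpha> g0 * T g M0 = \<alpha> g * T g0 M0" using B by simp
    have 2: "B * edge_sum n g M0 = of_nat n * \<alpha> g" "B * edge_sum n g0 M0 = of_nat n * \<alpha> g0"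
      using es[OF g] es[OF g0(1)] es\<alpha>[OF g] es\<alpha>[OF g0(1)] by simp_all
    have "B * (edge_sum n g0 M0 * T g M0) = of_nat n * (\<alpha> g0 * T g M0)"
      using 2(2) by (metis mult.assoc)
    also have "\<dots> = of_nat n * (\<alpha> g * T g0 M0)" using 1 by simp
    also have "\<dots> = B * (edge_sum n g M0 * T g0 M0)" using 2(1) by (metis mult.assoc)
    finally have "edge_sum n g0 M0 * T g M0 = edge_sum n g M0 * T g0 M0" using B by simp
    then show ?thesis using g0(2) by (simp add: \<kappa>_def eq_divide_eq mult.commute)
  qed
  have all: "\<forall>g\<in>W. T g M = \<kappa> * edge_sum n g M" if "M \<in> perfect_matchings n" for M
  proof (rule perfect_matchings_transitive[where P = "\<lambda>M. \<forall>g\<in>W. T g M = \<kappa> * edge_sum n g M", OF M0 _ _ that])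
    show "\<forall>g\<in>W. T g M0 = \<kappa> * edge_sum n g M0" using at0 by blast
    fix p M assume p: "p permutes ?V" and M: "M \<in> perfect_matchings n" "\<forall>g\<in>W. T g M = \<kappa> * edge_sum n g M"
    have inner: "inv p permutes ?V" using permutes_inv[OF p] .
    \<comment> \<open>Evaluating at the moved matching amounts to evaluating at M after acting by
      the inverse permutation, which maps W into itself.\<close>
    have move: "fun_action matching_action (inv p) F M = F (matching_action p M)" for F
      using permutes_inv_inv[OF p] by (simp add: fun_action_def)
    show "\<forall>g\<in>W. T g (matching_action p M) = \<kappa> * edge_sum n g (matching_action p M)"
    proof
      fix g assume g: "g \<in> W"
      show "T g (matching_action p M) = \<kappa> * edge_sum n g (matching_action p M)"
        using M(2)[rule_format, OF W(2)[OF inner g]] unfolding equi[OF inner g] edge_sum_equivariant[OF inner] move .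
    qed
  qed
  have "T g = cscale \<kappa> (edge_sum n g)" if "g \<in> W" for g
  proof
    fix M
    show "T g M = cscale \<kappa> (edge_sum n g) M"
      using all[of M] supp[OF that] that
      by (cases "M \<in> perfect_matchings n") (auto simp: cscale_def functions_on_def edge_sum_def)
  qed
  then show ?thesis by blast
qed

text \<open>With the edges 1 3 and 2 4 present, both positive terms are 1 and both negative terms
  are 0, so the value is 2.\<close>

lemma ex_quad_edge_sum_nonzero:
  assumes "n \<ge> 2"
  shows "\<exists>a b c d M. quad n a b c d \<and> M \<in> perfect_matchings n \<and> edge_sum n (quad_tabloid n a b c d) M \<noteq> 0"
proof -
  have q: "quad n 1 2 3 4" using assms by (auto simp: quad_def)
  have "quad n 1 3 2 4" using assms by (auto simp: quad_def)
  then obtain N where N: "N \<in> matchings ({1..2 * n} - {1, 3} - {2, 4})"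
    using ex_matching_with_two_edges by blast
  have "insert {2, 4} N \<in> matchings ({1..2 * n} - {1, 3})"
    using assms by (intro matchings_insert(1)[OF _ _ _ N]) auto
  from matchings_insert(1)[OF _ _ _ this] have M: "insert {1, 3} (insert {2, 4} N) \<in> matchings {1..2 * n}"
    using assms by simp
  let ?M = "insert {1, 3} (insert {2, 4} N)"
  have "edge ?M 1 3 = 1" "edge ?M 2 4 = 1" by (simp_all add: edge_def)
  moreover have "edge ?M 1 4 = 0" "edge ?M 2 3 = 0"
    using edge_mult_cancel[OF M, of 3 4 1] edge_mult_cancel[OF M, of 4 3 2] calculation by auto
  moreover have "?M \<in> perfect_matchings n" using M by (simp add: perfect_matchings_eq_matchings)
  ultimately have "edge_sum n (quad_tabloid n 1 2 3 4) ?M \<noteq> 0" by (simp add: edge_sum_quad_tabloid)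
  then show ?thesis using q \<open>?M \<in> perfect_matchings n\<close> by blast
qed

lemma specht_two_row_action:
  assumes "n \<ge> 2" "p permutes {1..2 * n}" "f \<in> specht_module [2 * n - 2, 2]"
  shows "fun_action tabloid_action p f \<in> specht_module [2 * n - 2, 2]"
proof -
  have "fun_action tabloid_action p (quad_tabloid n a b c d) \<in> cfun.span {quad_tabloid n a b c d | a b c d. quad n a b c d}"
    if "quad n a b c d" for a b c d
  proof -
    have "quad n (p a) (p b) (p c) (p d)"
      using that permutes_in_image[OF assms(2)] permutes_inj[OF assms(2)] by (auto simp: quad_def dest: injD)
    then show ?thesis unfolding fun_action_quad_tabloid[OF assms(2)] by (intro cfun.span_base) blast
  qed
  then show ?thesis
    unfolding specht_module_two_row[OF assms(1)]
    by (intro cfun_linear_span[where L = "fun_action tabloid_action p", OF fun_action_linear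
          cfun.subspace_span _ assms(3)[unfolded specht_module_two_row[OF assms(1)]]]) blast
qed

lemma matching_component_two_row:
  assumes n: "n \<ge> 2"
  shows "matching_component n [2 * n - 2, 2] = edge_sum n ` specht_module [2 * n - 2, 2]"
proof -
  let ?S = "specht_module [2 * n - 2, 2]"
  have sub: "cfun.subspace ?S" by (simp add: specht_module_def)
  obtain a b c d M0 where q: "quad n a b c d" and M0: "M0 \<in> perfect_matchings n"
    and nz: "edge_sum n (quad_tabloid n a b c d) M0 \<noteq> 0"
    using ex_quad_edge_sum_nonzero[OF n] by blast
  have g0: "quad_tabloid n a b c d \<in> ?S"
    unfolding specht_module_two_row[OF n] using q by (intro cfun.span_base) blast
  show ?thesis
  proof (rule component_eqI[OF _ refl _ edge_sum_linear edge_sum_equivariant])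
    show "is_partition (2 * n) [2 * n - 2, 2]" using n by (auto simp: is_partition_def)
    show "f = 0" if "f \<in> ?S" "edge_sum n f = 0" for f
      using edge_sum_inj[OF n _ that(2)] specht_balanced[OF n] that(1) by blast
    show "quad_tabloid n a b c d \<in> ?S" by (rule g0)
    show "quad_tabloid n a b c d \<noteq> 0"
    proof
      assume "quad_tabloid n a b c d = 0"
      then show False using nz edge_sum_linear(1)[of n 0 0] by simp
    qed
  next
    fix T :: "(nat set list \<Rightarrow> complex) \<Rightarrow> nat set set \<Rightarrow> complex"
    assume "\<And>f. f \<in> ?S \<Longrightarrow> T f \<in> functions_on (perfect_matchings n)"
      "\<And>f g. f \<in> ?S \<Longrightarrow> g \<in> ?S \<Longrightarrow> T (f + g) = T f + T g"
      "\<And>c f. f \<in> ?S \<Longrightarrow> T (cscale c f) = cscale c (T f)"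
      "\<And>p f. p permutes {1..2 * n} \<Longrightarrow> f \<in> ?S \<Longrightarrow>
          T (fun_action tabloid_action p f) = fun_action matching_action p (T f)"
    then show "\<exists>\<kappa>. \<forall>f\<in>?S. T f = cscale \<kappa> (edge_sum n f)"
      by (intro schur_two_row[OF n sub specht_two_row_action[OF n] specht_balanced[OF n] M0 g0 nz])
  qed (auto simp: edge_sum_def functions_on_def specht_two_row_action[OF n])
qed

section \<open>Edge indicators in the sum of the two components\<close>

lemma edge_sum_sum: "edge_sum n (\<Sum>i\<in>I. f i) = (\<Sum>i\<in>I. edge_sum n (f i))"
proof
  fix M
  have "(\<Sum>e\<in>M. \<Sum>i\<in>I. f i [{1..2 * n} - e, e]) = (\<Sum>i\<in>I. \<Sum>e\<in>M. f i [{1..2 * n} - e, e])"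
    by (rule sum.swap)
  then show "edge_sum n (\<Sum>i\<in>I. f i) M = (\<Sum>i\<in>I. edge_sum n (f i)) M"
    by (simp add: edge_sum_def sum_apply)
qed

text \<open>Summing the polytabloids over all b and d isolates the edge a c: rows of
  \<open>edge\<close> sum to 1, so every other term collapses to a constant plus a multiple of
  \<open>edge M a c\<close>.\<close>

lemma sum_edge_quads:
  fixes V :: "'a set"
  assumes "finite V" "card V = 2 * n" "M \<in> matchings V" "a \<in> V" "c \<in> V" "a \<noteq> c"
  shows "(\<Sum>b\<in>V - {a, c}. \<Sum>d\<in>V - {a, c} - {b}. edge M b d - edge M a d - edge M b c + edge M a c)
    = (2 * real n - 1) * (2 * real n - 2) * edge M a c - (2 * real n - 2)"
proof -
  let ?D = "V - {a, c}"
  define x where "x = edge M a c"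
  have n: "n \<ge> 1" using assms card_gt_0_iff[of V] by auto
  have cD: "real (card ?D) = 2 * real n - 2" and finD: "finite ?D"
    using assms n by (simp_all add: card_Diff_subset of_nat_diff)
  have cb: "real (card (?D - {b})) = 2 * real n - 3" if "b \<in> ?D" for b
  proof -
    have "card ?D \<ge> 1" using that finD card_gt_0_iff[of ?D] by (simp add: Suc_le_eq) blast
    then show ?thesis using that finD cD by (simp add: card_Diff_singleton of_nat_diff)
  qed
  have pair: "(\<Sum>d\<in>{a, c}. edge M b d) = edge M b a + edge M b c" for b using assms(6) by simp
  have sa: "(\<Sum>d\<in>?D. edge M a d) = 1 - x"
    using sum_edge_diff[OF assms(3,4,1), of "{a, c}"] assms(4,5) by (simp add: pair edge_self[OF assms(3)] x_def)
  have sc: "(\<Sum>d\<in>?D. edge M c d) = 1 - x"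
    using sum_edge_diff[OF assms(3,5,1), of "{a, c}"] assms(4,5)
    by (simp add: pair edge_self[OF assms(3)] x_def edge_commute[of M c a])
  have 1: "(\<Sum>b\<in>?D. \<Sum>d\<in>?D - {b}. edge M b d) = 2 * real n - 4 + 2 * x"
  proof -
    have "(\<Sum>b\<in>?D. \<Sum>d\<in>?D - {b}. edge M b d) = (\<Sum>b\<in>?D. 1 - edge M a b - edge M c b)"
    proof (rule sum.cong[OF refl])
      fix b assume b: "b \<in> ?D"
      have "(\<Sum>d\<in>?D - {b}. edge M b d) = (\<Sum>d\<in>?D. edge M b d)"
        using sum.remove[OF finD b, of "edge M b"] by (simp add: edge_self[OF assms(3)])
      also have "\<dots> = 1 - (edge M b a + edge M b c)"
        using sum_edge_diff[OF assms(3) _ assms(1), of b "{a, c}"] b assms(4,5) unfolding pair by simp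
      finally show "(\<Sum>d\<in>?D - {b}. edge M b d) = 1 - edge M a b - edge M c b"
        by (simp add: edge_commute[of M b])
    qed
    then show ?thesis by (simp add: sum_subtractf sa sc cD)
  qed
  have 2: "(\<Sum>b\<in>?D. \<Sum>d\<in>?D - {b}. edge M a d) = (2 * real n - 3) * (1 - x)"
  proof -
    have "(\<Sum>b\<in>?D. \<Sum>d\<in>?D - {b}. edge M a d) = (\<Sum>b\<in>?D. (1 - x) - edge M a b)"
      using finD by (intro sum.cong refl) (simp add: sum_diff1 sa)
    then show ?thesis unfolding sum_subtractf sa sum_constant cD by (simp add: algebra_simps)
  qed
  have const: "(\<Sum>b\<in>?D. \<Sum>d\<in>?D - {b}. g b) = (2 * real n - 3) * (\<Sum>b\<in>?D. g b)" for g :: "'a \<Rightarrow> real"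
    unfolding sum_distrib_left by (rule sum.cong[OF refl]) (simp only: sum_constant cb)
  have 3: "(\<Sum>b\<in>?D. \<Sum>d\<in>?D - {b}. edge M b c) = (2 * real n - 3) * (1 - x)"
    unfolding const using sc by (simp add: edge_commute[of M _ c])
  have 4: "(\<Sum>b\<in>?D. \<Sum>d\<in>?D - {b}. edge M a c) = (2 * real n - 3) * ((2 * real n - 2) * x)"
    using const[of "\<lambda>_. edge M a c"] by (simp only: sum_constant cD x_def)
  show ?thesis
    unfolding sum.distrib sum_subtractf 1 2 3 4 by (simp add: x_def algebra_simps)
qed

text \<open>The constant (2 n - 2) / K = 1 / (2 n - 1) is the mean of the edge indicator over all
  matchings; the remainder is the image of an explicit element of the Specht module.\<close>

lemma edge_indicator_decomposition:
  assumes n: "n \<ge> 2" and ac: "a \<in> {1..2 * n}" "c \<in> {1..2 * n} - {a}"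
  defines "K \<equiv> (2 * real n - 1) * (2 * real n - 2)"
  defines "g \<equiv> \<Sum>b\<in>{1..2 * n} - {a, c}. \<Sum>d\<in>{1..2 * n} - {a, c} - {b}. quad_tabloid n a b c d"
  shows "M \<in> perfect_matchings n \<Longrightarrow>
      of_real (edge M a c) = matching_const n (of_real ((2 * real n - 2) / K)) M + edge_sum n (cscale (of_real (1 / K)) g) M"
    and "cscale (of_real (1 / K)) g \<in> specht_module [2 * n - 2, 2]"
proof -
  have K: "K > 0" using n by (simp add: K_def)
  have "quad n a b c d" if "b \<in> {1..2 * n} - {a, c}" "d \<in> {1..2 * n} - {a, c} - {b}" for b d
    using that ac by (auto simp: quad_def)
  then show "cscale (of_real (1 / K)) g \<in> specht_module [2 * n - 2, 2]"
    unfolding g_def specht_module_two_row[OF n]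
    by (intro cfun.span_scale cfun.span_sum cfun.span_base) blast
  assume M: "M \<in> perfect_matchings n"
  have "edge_sum n g M = of_real (K * edge M a c - (2 * real n - 2))"
    using sum_edge_quads[of "{1..2 * n}" n M a c] M ac
    by (simp add: g_def edge_sum_sum sum_apply edge_sum_quad_tabloid K_def perfect_matchings_eq_matchings
        flip: of_real_sum of_real_diff of_real_add)
  then show "of_real (edge M a c) = matching_const n (of_real ((2 * real n - 2) / K)) M + edge_sum n (cscale (of_real (1 / K)) g) M"
    unfolding edge_sum_linear unfolding cscale_def using M K by (simp add: matching_const_def field_simps)
qed

section \<open>Maximum intersecting families\<close>

text \<open>This family bounds the size of a maximum independent set from below, which is what makes
  the ratio bound tight for it.\<close>

lemma canonical_intersecting:
  assumes "n \<ge> 1"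
  shows "independent_set (perfect_matchings n) derangement_adj {M \<in> perfect_matchings n. {1, 2} \<in> M}"
    and "real (card {M \<in> perfect_matchings n. {1, 2} \<in> M}) = odd_fact (n - 1)"
proof -
  show "independent_set (perfect_matchings n) derangement_adj {M \<in> perfect_matchings n. {1, 2} \<in> M}"
    by (auto simp: independent_set_def derangement_adj_def)
  let ?V = "{1..2 * n}"
  have V: "1 \<in> ?V" "2 \<in> ?V" "(1 :: nat) \<noteq> 2" using assms by auto
  have "card {M \<in> matchings ?V. {1, 2} \<in> M} = card (matchings (?V - {1, 2}))"
    using bij_betw_same_card[OF bij_betw_insert_edge[OF V]] by simp
  also have "real \<dots> = odd_fact (n - 1)"
    using card_remove_pair[of ?V n 1 2] V by (intro card_matchings) auto
  finally show "real (card {M \<in> perfect_matchings n. {1, 2} \<in> M}) = odd_fact (n - 1)"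
    by (simp add: perfect_matchings_eq_matchings)
qed

theorem theorem5p1:
  fixes n :: nat and S :: "nat set set set"
  assumes "n \<ge> 1"
    and "maximum_independent_set (perfect_matchings n) derangement_adj S"
  shows "(indicator S :: nat set set \<Rightarrow> complex)
           \<in> matching_component n [2 * n] + matching_component n [2 * n - 2, 2]"
proof -
  let ?V = "{1..2 * n}"
  have S: "S \<subseteq> perfect_matchings n" "\<And>M N. M \<in> S \<Longrightarrow> N \<in> S \<Longrightarrow> M \<inter> N \<noteq> {}"
    using assms(2) by (auto simp: maximum_independent_set_def independent_set_def derangement_adj_def)
  have "odd_fact (n - 1) \<le> real (card S)"
    using assms(2) canonical_intersecting[OF assms(1)]
    unfolding maximum_independent_set_def by (metis of_nat_le_iff)
  then have "in_edge_span ?V (indicator S)"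
    using S assms(1) by (intro intersecting_in_edge_span[of ?V n]) (auto simp: perfect_matchings_eq_matchings)
  then obtain w where w: "\<And>M. M \<in> perfect_matchings n \<Longrightarrow>
      indicator S M = (\<Sum>a\<in>?V. \<Sum>c\<in>?V. w a c * edge M a c)"
    by (auto simp: in_edge_span_def perfect_matchings_eq_matchings)
  show ?thesis
  proof (cases "n = 1")
    case True
    \<comment> \<open>For n = 1 the list [0, 2] is not a partition and the second summand is the
      zero space; the only matching makes the indicator constant.\<close>
    have "card (perfect_matchings n) = 1"
      using card_matchings[of ?V n] True by (simp add: perfect_matchings_eq_matchings odd_fact_simps)
    then obtain m where m: "perfect_matchings n = {m}" by (auto simp: card_1_singleton_iff)
    have "(indicator S :: nat set set \<Rightarrow> complex) = matching_const n (indicator S m)"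
      using S(1) m by (auto simp: matching_const_def indicator_def fun_eq_iff)
    moreover have "matching_component n [2 * n - 2, 2] = {0}"
      using True by (simp add: matching_component_def is_partition_def)
    ultimately show ?thesis
      using set_plus_intro[OF matching_component_trivial[OF assms(1), of "indicator S m"], of 0 "{0}"]
      by (simp only: add.right_neutral singletonI)
  next
    case False
    then have n: "n \<ge> 2" using assms(1) by simp
    define K where "K = (2 * real n - 1) * (2 * real n - 2)"
    define g where "g = (\<lambda>a c. cscale (of_real (1 / K))
      (\<Sum>b\<in>?V - {a, c}. \<Sum>d\<in>?V - {a, c} - {b}. quad_tabloid n a b c d))"
    define k :: complex where "k = of_real ((2 * real n - 2) / K)"
    \<comment> \<open>The diagonal a = c is left out because polytabloids need distinct points; it
      returns below as zero terms, no matching having a loop.\<close>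
    define G where "G = (\<Sum>a\<in>?V. \<Sum>c\<in>?V - {a}. cscale (of_real (w a c)) (g a c))"
    define r :: complex where "r = (\<Sum>a\<in>?V. \<Sum>c\<in>?V - {a}. of_real (w a c) * k)"
    have gS: "g a c \<in> specht_module [2 * n - 2, 2]" if "a \<in> ?V" "c \<in> ?V - {a}" for a c
      using edge_indicator_decomposition(2)[OF n that] by (simp only: g_def K_def)
    have dec: "of_real (edge M a c) = k + edge_sum n (g a c) M"
      if "a \<in> ?V" "c \<in> ?V - {a}" "M \<in> perfect_matchings n" for a c M
      using edge_indicator_decomposition(1)[OF n that(1,2,3)] that(3)
      by (simp only: g_def K_def k_def matching_const_def if_True)
    have "G \<in> specht_module [2 * n - 2, 2]"
      unfolding G_def using gS unfolding specht_module_def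
      by (intro cfun.span_sum cfun.span_scale) blast
    then have "edge_sum n G \<in> matching_component n [2 * n - 2, 2]"
      unfolding matching_component_two_row[OF n] by (rule imageI)
    then have "matching_const n r + edge_sum n G
        \<in> matching_component n [2 * n] + matching_component n [2 * n - 2, 2]"
      by (intro set_plus_intro matching_component_trivial assms(1))
    also have "matching_const n r + edge_sum n G = indicator S"
    proof
      fix M
      show "(matching_const n r + edge_sum n G) M = indicator S M"
      proof (cases "M \<in> perfect_matchings n")
        case True
        then have MV: "M \<in> matchings ?V" by (simp add: perfect_matchings_eq_matchings)
        have "edge_sum n G M = (\<Sum>a\<in>?V. \<Sum>c\<in>?V - {a}. of_real (w a c) * edge_sum n (g a c) M)"
          unfolding G_def edge_sum_sum sum_apply edge_sum_linear by (simp only: cscale_def)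
        then have "(matching_const n r + edge_sum n G) M
            = (\<Sum>a\<in>?V. \<Sum>c\<in>?V - {a}. of_real (w a c) * (k + edge_sum n (g a c) M))"
          using True by (simp add: matching_const_def r_def sum.distrib distrib_left)
        also have "\<dots> = (\<Sum>a\<in>?V. \<Sum>c\<in>?V - {a}. of_real (w a c) * of_real (edge M a c))"
          by (rule sum.cong[OF refl], rule sum.cong[OF refl]) (simp only: dec[OF _ _ True])
        also have "\<dots> = (\<Sum>a\<in>?V. \<Sum>c\<in>?V. of_real (w a c) * of_real (edge M a c))"
          by (intro sum.cong refl sum.mono_neutral_left) (auto simp: edge_self[OF MV])
        also have "\<dots> = of_real (indicator S M)" by (simp add: w[OF True])
        finally show ?thesis by (simp add: indicator_def)
      next
        case False
        then show ?thesis using S(1) by (auto simp: matching_const_def edge_sum_def indicator_def)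
      qed
    qed
    finally show ?thesis .
  qed
qed

end
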